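(* For every sufficiently small $\delta>0$ and every $C>1$, there exist a small constant $\gamma>0$ and a large integer $D$ such that it is SSE-hard to distinguish, for a given bipartite graph $G$ on $[N]\cup[M]$ with left degree $D$, between the following two cases: (1) there exists a set $S\subseteq[N]$ of size $\gamma N$ with $|\Gamma(S)|\le(1+\delta)|S|$; (2) every subset $S\subseteq[N]$ of size $\gamma N$ satisfies $|\Gamma(S)|\ge C|S|$.
   Context: $\Gamma(S)$ is the neighbor set of $S$. For a $d$-regular graph $H=(V,E)$ and $S\subseteq V$, the edge expansion of $S$ is $\frac{|E(S,V\setminus S)|}{d\cdot\min\{|S|,|V\setminus S|\}}$. The Small-Set Expansion Hypothesis (SSE) states: for every constant $\eta>0$ there is a small $\delta_0>0$ such that, given a graph $H=(V,E)$, it is NP-hard to distinguish whether (a) some vertex set of size $\delta_0|V|$ has edge expansion at most $\eta$, or (b) every vertex set of size $\delta_0|V|$ has edge expansion at least $1-\eta$. A distinguishing problem is SSE-hard if, assuming the Small-Set Expansion Hypothesis, no polynomial-time algorithm can distinguish the two cases (unless P=NP), i.e. there is a polynomial-time reduction from the SSE problem to it. *)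

theory Defs
  imports Complex_Main "HOL-Computational_Algebra.Polynomial"
begin

section \<open>Polynomial time\<close>

text \<open>
  The machine model is a random access machine, presented as a structured language: a program
  works on finitely many arrays of natural numbers, with computed indices, addition and truncated
  subtraction, each elementary command and each test taking one time unit. Since there is no
  multiplication, the bit lengths of the numbers grow by at most a constant,
  depending on the program, per time unit, so this model is polynomially equivalent to Turing machines.
\<close>

type_synonym store = "nat \<Rightarrow> nat \<Rightarrow> nat"

datatype aexp =
    Const nat
  | Get nat aexp
  | Plus aexp aexp
  | Minus aexp aexp

fun aval :: "aexp \<Rightarrow> store \<Rightarrow> nat" where
  "aval (Const k) s = k"
| "aval (Get a e) s = s a (aval e s)"
| "aval (Plus e e') s = aval e s + aval e' s"
| "aval (Minus e e') s = aval e s - aval e' s"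

datatype com =
    Skip
  | Put nat aexp aexp
  | Seq com com
  | Cond aexp com com
  | While aexp com

inductive exec :: "com \<Rightarrow> store \<Rightarrow> nat \<Rightarrow> store \<Rightarrow> bool" where
  Skip: "exec Skip s 1 s"
| Put: "exec (Put a i e) s 1 (s(a := (s a)(aval i s := aval e s)))"
| Seq: "exec c s t s' \<Longrightarrow> exec c' s' t' s'' \<Longrightarrow> exec (Seq c c') s (t + t') s''"
| CondTrue: "aval b s \<noteq> 0 \<Longrightarrow> exec c s t s' \<Longrightarrow> exec (Cond b c c') s (Suc t) s'"
| CondFalse: "aval b s = 0 \<Longrightarrow> exec c' s t s' \<Longrightarrow> exec (Cond b c c') s (Suc t) s'"
| WhileFalse: "aval b s = 0 \<Longrightarrow> exec (While b c) s 1 s"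
| WhileTrue: "aval b s \<noteq> 0 \<Longrightarrow> exec c s t s' \<Longrightarrow> exec (While b c) s' t' s'' \<Longrightarrow>
    exec (While b c) s (Suc (t + t')) s''"

text \<open>
  A bit string occupies an array with one bit per cell, \<^term>\<open>False\<close> as 1 and \<^term>\<open>True\<close> as 2;
  the cells behind it are 0. In this way the output cannot be longer than the running time.
\<close>

definition cells :: "bool list \<Rightarrow> nat \<Rightarrow> nat" where
  "cells xs i = (if i < length xs then if xs ! i then 2 else 1 else 0)"

text \<open>Array 0 holds the input, array 1 receives the output.\<close>

definition polytime :: "(bool list \<Rightarrow> bool list) \<Rightarrow> bool" where
  "polytime f \<longleftrightarrow> (\<exists>(c :: com) (p :: nat poly). \<forall>xs. \<exists>t s.
     exec c ((\<lambda>_ _. 0)(0 := cells xs)) t s \<and> s 1 = cells (f xs) \<and> t \<le> poly p (length xs))"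

definition pair_code :: "bool list \<Rightarrow> bool list \<Rightarrow> bool list" where
  "pair_code xs ws = replicate (length xs) True @ [False] @ xs @ ws"

definition NP :: "bool list set set" where
  "NP = {L. \<exists>V (p :: nat poly). polytime V \<and>
     (\<forall>xs. xs \<in> L \<longleftrightarrow>
        (\<exists>ws. length ws \<le> poly p (length xs) \<and> V (pair_code xs ws) = [True]))}"

text \<open>
  A problem of distinguishing two cases is the pair of the sets of instances in the first and in
  the second case; nothing is required on inputs in neither set.
\<close>

type_synonym promise_problem = "bool list set \<times> bool list set"

definition poly_reducible :: "promise_problem \<Rightarrow> promise_problem \<Rightarrow> bool" where
  "poly_reducible P Q \<longleftrightarrow> (\<exists>f. polytime f \<and> f ` fst P \<subseteq> fst Q \<and> f ` snd P \<subseteq> snd Q)"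

definition NP_hard :: "promise_problem \<Rightarrow> bool" where
  "NP_hard P \<longleftrightarrow> (\<forall>L\<in>NP. poly_reducible (L, - L) P)"

section \<open>Small-set expansion\<close>

text \<open>
  Graphs on \<^term>\<open>{..<n}\<close> are given by their adjacency relation, bipartite graphs on
  \<open>[N] \<union> [M]\<close> by a relation from \<^term>\<open>{..<N}\<close> to \<^term>\<open>{..<M}\<close>. Both are written down as
  the two sizes in unary followed by the (bi)adjacency matrix, row by row.
\<close>

definition graph_code :: "nat \<Rightarrow> nat \<Rightarrow> nat rel \<Rightarrow> bool list" where
  "graph_code N M E = replicate N True @ [False] @ replicate M True @ [False] @
     concat (map (\<lambda>i. map (\<lambda>j. (i, j) \<in> E) [0..<M]) [0..<N])"

definition regular_graph :: "nat \<Rightarrow> nat \<Rightarrow> nat rel \<Rightarrow> bool" where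
  "regular_graph n d E \<longleftrightarrow> E \<subseteq> {..<n} \<times> {..<n} \<and> sym E \<and> irrefl E \<and>
     (\<forall>v<n. card (E `` {v}) = d)"

text \<open>Each edge between \<open>S\<close> and its complement has exactly one orientation leaving \<open>S\<close>.\<close>

definition edge_expansion :: "nat \<Rightarrow> nat \<Rightarrow> nat rel \<Rightarrow> nat set \<Rightarrow> real" where
  "edge_expansion n d E S =
     card (E \<inter> S \<times> ({..<n} - S)) / (d * min (card S) (card ({..<n} - S)))"

definition SSE_problem :: "real \<Rightarrow> real \<Rightarrow> promise_problem" where
  "SSE_problem \<eta> \<delta>\<^sub>0 =
    ({graph_code n n E | n d E. n > 0 \<and> d > 0 \<and> regular_graph n d E \<and>
        (\<exists>S\<subseteq>{..<n}. real (card S) = \<delta>\<^sub>0 * real n \<and> edge_expansion n d E S \<le> \<eta>)},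
     {graph_code n n E | n d E. n > 0 \<and> d > 0 \<and> regular_graph n d E \<and>
        (\<forall>S\<subseteq>{..<n}. real (card S) = \<delta>\<^sub>0 * real n \<longrightarrow> edge_expansion n d E S \<ge> 1 - \<eta>)})"

definition SSE_hypothesis :: bool where
  "SSE_hypothesis \<longleftrightarrow> (\<forall>\<eta>>0. \<exists>\<delta>\<^sub>0. 0 < \<delta>\<^sub>0 \<and> \<delta>\<^sub>0 < 1 \<and> NP_hard (SSE_problem \<eta> \<delta>\<^sub>0))"

text \<open>
  An SSE problem that is NP-hard if the hypothesis holds reduces to the given problem in polynomial
  time. The parameters have to be quantified existentially, since the hypothesis gives
  \<open>\<delta>\<^sub>0\<close> as a function of \<open>\<eta>\<close>, but not for every \<open>\<delta>\<^sub>0\<close>.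
\<close>

definition SSE_hard :: "promise_problem \<Rightarrow> bool" where
  "SSE_hard P \<longleftrightarrow> (\<exists>\<eta> \<delta>\<^sub>0. 0 < \<eta> \<and> 0 < \<delta>\<^sub>0 \<and> \<delta>\<^sub>0 < 1 \<and>
     (SSE_hypothesis \<longrightarrow> NP_hard (SSE_problem \<eta> \<delta>\<^sub>0)) \<and>
     poly_reducible (SSE_problem \<eta> \<delta>\<^sub>0) P)"

section \<open>Expansion of left sets in bipartite graphs\<close>

definition left_regular :: "nat \<Rightarrow> nat \<Rightarrow> nat \<Rightarrow> nat rel \<Rightarrow> bool" where
  "left_regular N M D G \<longleftrightarrow> G \<subseteq> {..<N} \<times> {..<M} \<and> (\<forall>u<N. card (G `` {u}) = D)"

text \<open>The neighbour set of \<open>S\<close> is the relational image \<^term>\<open>G `` S\<close>.\<close>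

definition left_expansion_problem :: "real \<Rightarrow> real \<Rightarrow> real \<Rightarrow> nat \<Rightarrow> promise_problem" where
  "left_expansion_problem \<delta> C \<gamma> D =
    ({graph_code N M G | N M G. N > 0 \<and> left_regular N M D G \<and>
        (\<exists>S\<subseteq>{..<N}. real (card S) = \<gamma> * real N \<and>
           real (card (G `` S)) \<le> (1 + \<delta>) * real (card S))},
     {graph_code N M G | N M G. N > 0 \<and> left_regular N M D G \<and>
        (\<forall>S\<subseteq>{..<N}. real (card S) = \<gamma> * real N \<longrightarrow>
           real (card (G `` S)) \<ge> C * real (card S))})"

end

theory Submission
  imports Defs
begin

text \<open>
  Let \<open>H\<close> be a \<open>d\<close>-regular graph on \<open>n\<close> vertices. Put \<open>m = d t\<close> for a large constant \<open>t\<close>, \<open>K = m\<^sup>2\<close> and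
  \<open>w = d t\<^sup>2\<close>, so that \<open>K = d w\<close>. The left vertices are the pairs \<open>(v, x)\<close> with \<open>x < K\<close>; such a pair
  is one of \<open>w\<close> copies of the arc from \<open>v\<close> to its neighbour number \<open>x div w\<close>, and it also has a position
  \<open>x'\<close> among the copies of the arcs ending in the head \<open>v'\<close>. The right vertices are the pairs
  \<open>(v, y)\<close> with \<open>y < K\<close>, and \<open>(v, x)\<close> is joined to \<open>(v, y)\<close> for \<open>y\<close> within \<open>k\<close> steps of \<open>x\<close> and to
  \<open>(v', y)\<close> for \<open>y\<close> within \<open>k\<close> steps of \<open>x'\<close> in a Margulis expander on \<open>(\<int>/m)\<^sup>2\<close>. This keeps the
  degree bounded although \<open>d\<close> is not; a few common dummy neighbours make it constant.

  If \<open>S\<close> hardly expands in \<open>H\<close>, the pairs over \<open>S\<close> have few neighbours outside the \<open>K |S|\<close> right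
  vertices over \<open>S\<close>. Conversely, if a set of left vertices has few neighbours, the expanders force
  most tails and most heads into \<open>O(|S|)\<close> vertices, which then span a constant fraction of
  \<open>d |S|\<close> arcs; splitting these vertices into blocks of size \<open>|S| / 2\<close> yields a set of size \<open>|S|\<close>
  with edge expansion below \<open>1 - \<eta>\<close>. The instances with \<open>\<delta>\<^sub>0 n\<close> not an integer or equal to 1 are negative
  and are mapped to a fixed graph with one left vertex.

  The expansion of the Margulis graph follows from Fourier analysis on \<open>(\<int>/m)\<^sup>2\<close>: the squared
  Fourier transform of a set with small boundary is a measure that is concentrated near 0 (by
  the translations) and almost invariant under two unipotent matrices, and
  these play ping-pong on the quadrants.
\<close>

section \<open>Compiling bounded sums to polynomial time programs\<close>

text \<open>The only iteration is a sum whose range is evaluated first, so values stay polynomially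
  bounded and every expression compiles to a polynomial-time program. The reduction is given by two
  such expressions, one for the length of the output and one for a single output bit.
  \<open>Inp\<close> reads a cell of the input array.\<close>

datatype ex =
    Cst nat
  | Var nat
  | Inp ex
  | Add ex ex
  | Sub ex ex
  | Sum nat ex ex
  | Bind nat ex ex

fun eval :: "ex \<Rightarrow> (nat \<Rightarrow> nat) \<Rightarrow> (nat \<Rightarrow> nat) \<Rightarrow> nat" where
  "eval (Cst k) g env = k"
| "eval (Var y) g env = env y"
| "eval (Inp e) g env = g (eval e g env)"
| "eval (Add e e') g env = eval e g env + eval e' g env"
| "eval (Sub e e') g env = eval e g env - eval e' g env"
| "eval (Sum y e e') g env = (\<Sum>i<eval e g env. eval e' g (env(y := i)))"
| "eval (Bind y e e') g env = eval e' g (env(y := eval e g env))"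

text \<open>Arrays 0 and 1 are reserved for input and output. Even arrays from 2 on hold variables
  and odd arrays from 3 on hold temporaries, each in its cell 0.\<close>

definition var :: "nat \<Rightarrow> nat" where "var y = 2 * y + 2"
definition tmp :: "nat \<Rightarrow> nat" where "tmp r = 2 * r + 3"

lemma var_tmp_simps [simp]:
  "var y = var z \<longleftrightarrow> y = z" "tmp r = tmp r' \<longleftrightarrow> r = r'" "var y \<noteq> tmp r" "tmp r \<noteq> var y"
  "var y \<noteq> 0" "0 \<noteq> var y" "var y \<noteq> Suc 0" "Suc 0 \<noteq> var y"
  "tmp r \<noteq> 0" "0 \<noteq> tmp r" "tmp r \<noteq> Suc 0" "Suc 0 \<noteq> tmp r"
  by (auto simp: var_def tmp_def) presburger+

abbreviation get :: "nat \<Rightarrow> aexp" where "get a \<equiv> Get a (Const 0)"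
abbreviation put :: "nat \<Rightarrow> aexp \<Rightarrow> com" where "put a e \<equiv> Put a (Const 0) e"
abbreviation upd :: "store \<Rightarrow> nat \<Rightarrow> nat \<Rightarrow> store" where "upd s a k \<equiv> s(a := (s a)(0 := k))"

text \<open>Calling convention: \<open>compile e r\<close> leaves the value in \<open>tmp r\<close>
  and may overwrite only temporaries from index \<open>r\<close> on. For \<open>Sum\<close>,
  \<open>tmp r\<close> accumulates, the next two temporaries hold the range and the saved value of
  the bound variable, and the body is compiled three levels higher. \<open>Bind\<close> saves and
  restores its variable in the same way.\<close>

fun compile :: "ex \<Rightarrow> nat \<Rightarrow> com" where
  "compile (Cst k) r = put (tmp r) (Const k)"
| "compile (Var y) r = put (tmp r) (get (var y))"
| "compile (Inp e) r = Seq (compile e r) (put (tmp r) (Get 0 (get (tmp r))))"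
| "compile (Add e e') r = Seq (compile e r) (Seq (compile e' (Suc r))
     (put (tmp r) (Plus (get (tmp r)) (get (tmp (Suc r))))))"
| "compile (Sub e e') r = Seq (compile e r) (Seq (compile e' (Suc r))
     (put (tmp r) (Minus (get (tmp r)) (get (tmp (Suc r))))))"
| "compile (Sum y e e') r = Seq (compile e (Suc r)) (Seq (put (tmp r) (Const 0))
     (Seq (put (tmp (Suc (Suc r))) (get (var y))) (Seq (put (var y) (Const 0))
     (Seq (While (Minus (get (tmp (Suc r))) (get (var y)))
        (Seq (compile e' (Suc (Suc (Suc r))))
        (Seq (put (tmp r) (Plus (get (tmp r)) (get (tmp (Suc (Suc (Suc r)))))))
             (put (var y) (Plus (get (var y)) (Const 1))))))
     (put (var y) (get (tmp (Suc (Suc r)))))))))"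
| "compile (Bind y e e') r = Seq (compile e r) (Seq (put (tmp (Suc r)) (get (var y)))
     (Seq (put (var y) (get (tmp r))) (Seq (compile e' (Suc (Suc r)))
     (Seq (put (tmp r) (get (tmp (Suc (Suc r))))) (put (var y) (get (tmp (Suc r))))))))"

lemma exec_put: "exec (put a e) s 1 (upd s a (aval e s))"
  using exec.Put[of a "Const 0" e s] by simp

text \<open>Loop rule with time: \<open>P\<close> is an invariant indexed by the number of completed
  rounds, \<open>T\<close> bounds one execution of the body, and every test, including the failing
  last one, costs one unit.\<close>

lemma exec_for:
  assumes step: "\<And>i s. i < n \<Longrightarrow> P i s \<Longrightarrow>
      aval b s \<noteq> 0 \<and> (\<exists>t s'. exec c s t s' \<and> P (Suc i) s' \<and> t \<le> T)"
    and stop: "\<And>s. P n s \<Longrightarrow> aval b s = 0"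
    and "P 0 s"
  shows "\<exists>t s'. exec (While b c) s t s' \<and> P n s' \<and> t \<le> n * (T + 1) + 1"
proof -
  have "\<exists>t s'. exec (While b c) s t s' \<and> P n s' \<and> t \<le> j * (T + 1) + 1"
    if "P (n - j) s" "j \<le> n" for j s
    using that
  proof (induction j arbitrary: s)
    case 0
    then have "P n s" by simp
    moreover from this stop have "exec (While b c) s 1 s" by (intro exec.WhileFalse)
    ultimately show ?case by auto
  next
    case (Suc j)
    then have "n - Suc j < n" "Suc (n - Suc j) = n - j" by auto
    with step[of "n - Suc j" s] Suc.prems obtain t s' where
      1: "aval b s \<noteq> 0" "exec c s t s'" "P (n - j) s'" "t \<le> T" by auto
    from Suc.IH[OF 1(3)] Suc.prems(2) obtain t' s'' where
      2: "exec (While b c) s' t' s''" "P n s''" "t' \<le> j * (T + 1) + 1" by auto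
    have "exec (While b c) s (Suc (t + t')) s''" using 1 2 exec.WhileTrue by blast
    moreover have "Suc (t + t') \<le> Suc j * (T + 1) + 1" using 1(4) 2(3) by simp
    ultimately show ?case using 2(2) by blast
  qed
  from this[of n s] assms(3) show ?thesis by simp
qed

section \<open>Frame and size conditions on stores\<close>

definition env_of :: "store \<Rightarrow> nat \<Rightarrow> nat" where
  "env_of s y = s (var y) 0"

text \<open>The frame condition of compiled code. Whole arrays are compared, so variables bound by
  \<open>Sum\<close> and \<open>Bind\<close> have to be restored exactly.\<close>

definition same :: "nat \<Rightarrow> store \<Rightarrow> store \<Rightarrow> bool" where
  "same r s s' \<longleftrightarrow> (\<forall>a. (\<forall>j\<ge>r. a \<noteq> tmp j) \<longrightarrow> s' a = s a)"

definition small :: "nat \<Rightarrow> store \<Rightarrow> bool" where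
  "small B s \<longleftrightarrow> (\<forall>y. env_of s y \<le> B) \<and> (\<forall>i. s 0 i \<le> 2)"

lemma same_refl: "same r s s" by (simp add: same_def)

lemma same_trans: "same r s s' \<Longrightarrow> same r' s' s'' \<Longrightarrow> r \<le> r' \<Longrightarrow> same r s s''"
  by (auto simp: same_def)

lemma same_tmp: "same r s s' \<Longrightarrow> j < r \<Longrightarrow> s' (tmp j) = s (tmp j)"
  by (auto simp: same_def)

lemma same_var: "same r s s' \<Longrightarrow> s' (var y) = s (var y)"
  by (auto simp: same_def)

lemma same_01: "same r s s' \<Longrightarrow> s' 0 = s 0" "same r s s' \<Longrightarrow> s' (Suc 0) = s (Suc 0)"
  by (auto simp: same_def)

lemma same_env: "same r s s' \<Longrightarrow> env_of s' = env_of s"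
  by (auto simp: env_of_def fun_eq_iff same_var)

lemma same_small: "same r s s' \<Longrightarrow> small B s' = small B s"
  by (simp add: small_def same_env same_01)

lemma same_upd: "same r s s' \<Longrightarrow> r \<le> j \<Longrightarrow> same r s (upd s' (tmp j) k)"
  by (auto simp: same_def)

lemma env_upd_var: "env_of (upd s (var y) k) = (env_of s)(y := k)"
  by (auto simp: env_of_def fun_eq_iff)

text \<open>The exponent depends on the expression alone. All bases are treated at once because the
  body of a \<open>Sum\<close> or \<open>Bind\<close> is evaluated in an environment bounded only by
  a power of the original base; the induction hypothesis is applied with that power as its
  base.\<close>

lemma eval_le:
  "\<exists>k. \<forall>B g env. B \<ge> 2 \<longrightarrow> (\<forall>y. env y \<le> B) \<longrightarrow> (\<forall>i. g i \<le> 2) \<longrightarrow> eval e g env \<le> B ^ k"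
proof (induction e)
  case (Cst c)
  have "c \<le> B ^ c" if "B \<ge> 2" for B
    using power_mono[of 2 B c] that less_exp[of c] by linarith
  then show ?case by (intro exI[of _ c]) auto
next
  case (Var y)
  show ?case by (intro exI[of _ 1]) auto
next
  case (Inp e)
  show ?case using le_trans by (intro exI[of _ 1]) fastforce
next
  case (Add e e')
  then obtain k k' where
    k: "\<forall>B g env. B \<ge> 2 \<longrightarrow> (\<forall>y. env y \<le> B) \<longrightarrow> (\<forall>i. g i \<le> 2) \<longrightarrow> eval e g env \<le> B ^ k"
    and k': "\<forall>B g env. B \<ge> 2 \<longrightarrow> (\<forall>y. env y \<le> B) \<longrightarrow> (\<forall>i. g i \<le> 2) \<longrightarrow> eval e' g env \<le> B ^ k'"
    by blast
  have "B ^ k + B ^ k' \<le> B ^ Suc (k + k')" if "B \<ge> 2" for B :: nat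
  proof -
    have "B ^ k \<le> B ^ (k + k')" "B ^ k' \<le> B ^ (k + k')"
      using that by (auto intro!: power_increasing)
    then have "B ^ k + B ^ k' \<le> 2 * B ^ (k + k')" by simp
    also have "\<dots> \<le> B * B ^ (k + k')" using that by (intro mult_right_mono) auto
    finally show ?thesis by simp
  qed
  note le = this
  show ?case
  proof (intro exI[of _ "Suc (k + k')"] allI impI)
    fix B and g env :: "nat \<Rightarrow> nat"
    assume B: "B \<ge> 2" "\<forall>y. env y \<le> B" "\<forall>i. g i \<le> 2"
    have "eval e g env \<le> B ^ k" using k B by blast
    moreover have "eval e' g env \<le> B ^ k'" using k' B by blast
    ultimately show "eval (Add e e') g env \<le> B ^ Suc (k + k')"
      using le[OF B(1)] unfolding eval.simps by linarith
  qed
next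
  case (Sub e e')
  then obtain k where
    "\<forall>B g env. B \<ge> 2 \<longrightarrow> (\<forall>y. env y \<le> B) \<longrightarrow> (\<forall>i. g i \<le> 2) \<longrightarrow> eval e g env \<le> B ^ k" by blast
  note k = this
  show ?case
  proof (intro exI[of _ k] allI impI)
    fix B and g env :: "nat \<Rightarrow> nat"
    assume B: "B \<ge> 2" "\<forall>y. env y \<le> B" "\<forall>i. g i \<le> 2"
    have "eval e g env \<le> B ^ k" using k B by blast
    then show "eval (Sub e e') g env \<le> B ^ k" by simp
  qed
next
  case (Sum y e e')
  then obtain k k' where
    k: "\<forall>B g env. B \<ge> 2 \<longrightarrow> (\<forall>y. env y \<le> B) \<longrightarrow> (\<forall>i. g i \<le> 2) \<longrightarrow> eval e g env \<le> B ^ k"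
    and k': "\<forall>B g env. B \<ge> 2 \<longrightarrow> (\<forall>y. env y \<le> B) \<longrightarrow> (\<forall>i. g i \<le> 2) \<longrightarrow> eval e' g env \<le> B ^ k'"
    by blast
  show ?case
  proof (intro exI[of _ "k + Suc k * k'"] allI impI)
    fix B and g env :: "nat \<Rightarrow> nat"
    assume B: "B \<ge> 2" "\<forall>y. env y \<le> B" "\<forall>i. g i \<le> 2"
    have 1: "eval e g env \<le> B ^ k" using k B by blast
    \<comment> \<open>The new base \<open>B ^ Suc k\<close> dominates both the old base and the
      values of the bound variable, even for \<open>k = 0\<close>.\<close>
    have B': "B ^ k \<le> B ^ Suc k" "B \<le> B ^ Suc k" using B(1) by auto
    have "eval e' g (env(y := i)) \<le> (B ^ Suc k) ^ k'" if "i < eval e g env" for i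
    proof -
      have "i \<le> B ^ Suc k" using that 1 B' by linarith
      then have "\<forall>z. (env(y := i)) z \<le> B ^ Suc k" using B(2) B'(2) by (metis fun_upd_apply order_trans)
      moreover have "2 \<le> B ^ Suc k" using B(1) B'(2) by linarith
      ultimately show ?thesis using k' B(3) by blast
    qed
    then have "eval (Sum y e e') g env \<le> eval e g env * (B ^ Suc k) ^ k'"
      using sum_bounded_above[of "{..<eval e g env}" "\<lambda>i. eval e' g (env(y := i))"] by simp
    also have "\<dots> \<le> B ^ k * (B ^ Suc k) ^ k'" using 1 by (rule mult_right_mono) simp
    finally show "eval (Sum y e e') g env \<le> B ^ (k + Suc k * k')"
      by (simp only: power_add power_mult)
  qed
next
  case (Bind y e e')
  then obtain k k' where
    k: "\<forall>B g env. B \<ge> 2 \<longrightarrow> (\<forall>y. env y \<le> B) \<longrightarrow> (\<forall>i. g i \<le> 2) \<longrightarrow> eval e g env \<le> B ^ k"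
    and k': "\<forall>B g env. B \<ge> 2 \<longrightarrow> (\<forall>y. env y \<le> B) \<longrightarrow> (\<forall>i. g i \<le> 2) \<longrightarrow> eval e' g env \<le> B ^ k'"
    by blast
  show ?case
  proof (intro exI[of _ "Suc k * k'"] allI impI)
    fix B and g env :: "nat \<Rightarrow> nat"
    assume B: "B \<ge> 2" "\<forall>y. env y \<le> B" "\<forall>i. g i \<le> 2"
    have 1: "eval e g env \<le> B ^ k" using k B by blast
    have B': "B ^ k \<le> B ^ Suc k" "B \<le> B ^ Suc k" using B(1) by auto
    then have "eval e g env \<le> B ^ Suc k" using 1 by linarith
    then have "\<forall>z. (env(y := eval e g env)) z \<le> B ^ Suc k"
      using B(2) B'(2) by (metis fun_upd_apply order_trans)
    moreover have "2 \<le> B ^ Suc k" using B(1) B'(2) by linarith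
    ultimately have "eval e' g (env(y := eval e g env)) \<le> (B ^ Suc k) ^ k'"
      using k' B(3) by blast
    then show "eval (Bind y e e') g env \<le> B ^ (Suc k * k')"
      by (simp only: eval.simps power_mult)
  qed
qed

definition computes :: "ex \<Rightarrow> nat \<Rightarrow> nat \<Rightarrow> store \<Rightarrow> nat \<Rightarrow> bool" where
  "computes e r T s v \<longleftrightarrow> (\<exists>t s'. exec (compile e r) s t s' \<and> t \<le> T \<and> same r s s' \<and>
     s' (tmp r) 0 = v)"

text \<open>As in \<open>eval_le\<close>, the exponent is uniform in the base, the level and the
  store. The time for a sum is the number of rounds, which \<open>eval_le\<close> bounds, times the
  time of the body over the enlarged base.\<close>

lemma compile_correct:
  "\<exists>k. \<forall>B r s. B \<ge> 2 \<longrightarrow> small B s \<longrightarrow> computes e r (B ^ k) s (eval e (s 0) (env_of s))"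
proof (induction e)
  case (Cst c)
  show ?case
    by (intro exI[of _ 0])
      (auto simp: computes_def intro!: exI exec_put[simplified] same_upd same_refl)
next
  case (Var y)
  show ?case
    by (intro exI[of _ 0])
      (auto simp: computes_def env_of_def intro!: exI exec_put[simplified] same_upd same_refl)
next
  case (Inp e)
  then obtain k where k: "\<And>B r s. B \<ge> 2 \<Longrightarrow> small B s \<Longrightarrow>
      computes e r (B ^ k) s (eval e (s 0) (env_of s))" by blast
  show ?case
  proof (intro exI[of _ "Suc k"] allI impI)
    fix B r s assume B: "B \<ge> 2" "small B s"
    from k[OF this, of r] obtain t s' where
      1: "exec (compile e r) s t s'" "t \<le> B ^ k" "same r s s'" "s' (tmp r) 0 = eval e (s 0) (env_of s)"
      by (auto simp: computes_def)
    have "1 \<le> B ^ k" using B by simp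
    then have "B ^ k + 1 \<le> 2 * B ^ k" by simp
    also have "\<dots> \<le> B ^ Suc k" using B by simp
    finally have "t + 1 \<le> B ^ Suc k" using 1 by linarith
    then show "computes (Inp e) r (B ^ Suc k) s (eval (Inp e) (s 0) (env_of s))"
      unfolding computes_def compile.simps
      using exec.Seq[OF 1(1) exec_put[of "tmp r" "Get 0 (get (tmp r))" s']] 1(4)
        same_upd[OF 1(3) order_refl] same_01[OF 1(3)] by force
  qed
next
  case (Add e e')
  then obtain k k' where
    k: "\<And>B r s. B \<ge> 2 \<Longrightarrow> small B s \<Longrightarrow> computes e r (B ^ k) s (eval e (s 0) (env_of s))"
    and k': "\<And>B r s. B \<ge> 2 \<Longrightarrow> small B s \<Longrightarrow> computes e' r (B ^ k') s (eval e' (s 0) (env_of s))"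
    by blast
  show ?case
  proof (intro exI[of _ "k + k' + 2"] allI impI)
    fix B r s assume B: "B \<ge> 2" "small B s"
    from k[OF this, of r] obtain t s' where
      1: "exec (compile e r) s t s'" "t \<le> B ^ k" "same r s s'" "s' (tmp r) 0 = eval e (s 0) (env_of s)"
      by (auto simp: computes_def)
    from k'[of B s' "Suc r"] B 1 obtain t' s'' where
      2: "exec (compile e' (Suc r)) s' t' s''" "t' \<le> B ^ k'" "same (Suc r) s' s''"
        "s'' (tmp (Suc r)) 0 = eval e' (s 0) (env_of s)"
      by (auto simp: computes_def same_small same_env same_01)
    have 3: "s'' (tmp r) = s' (tmp r)" using same_tmp[OF 2(3)] by simp
    have 4: "same r s s''" using same_trans[OF 1(3) 2(3)] by simp
    have "B ^ k \<le> B ^ (k + k')" "B ^ k' \<le> B ^ (k + k')" "1 \<le> B ^ (k + k')"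
      using B by (auto intro!: power_increasing)
    moreover have "4 * B ^ (k + k') \<le> B ^ (k + k' + 2)"
      using mult_mono[of 2 B 2 B] B(1) by (simp add: power_add power2_eq_square)
    ultimately have "t + (t' + 1) \<le> B ^ (k + k' + 2)" using 1(2) 2(2) by linarith
    then show "computes (Add e e') r (B ^ (k + k' + 2)) s (eval (Add e e') (s 0) (env_of s))"
      unfolding computes_def compile.simps
      using exec.Seq[OF 1(1) exec.Seq[OF 2(1)
          exec_put[of "tmp r" "Plus (get (tmp r)) (get (tmp (Suc r)))" s'']]]
        1(4) 2(4) 3 same_upd[OF 4 order_refl] by force
  qed
next
  case (Sub e e')
  then obtain k k' where
    k: "\<And>B r s. B \<ge> 2 \<Longrightarrow> small B s \<Longrightarrow> computes e r (B ^ k) s (eval e (s 0) (env_of s))"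
    and k': "\<And>B r s. B \<ge> 2 \<Longrightarrow> small B s \<Longrightarrow> computes e' r (B ^ k') s (eval e' (s 0) (env_of s))"
    by blast
  show ?case
  proof (intro exI[of _ "k + k' + 2"] allI impI)
    fix B r s assume B: "B \<ge> 2" "small B s"
    from k[OF this, of r] obtain t s' where
      1: "exec (compile e r) s t s'" "t \<le> B ^ k" "same r s s'" "s' (tmp r) 0 = eval e (s 0) (env_of s)"
      by (auto simp: computes_def)
    from k'[of B s' "Suc r"] B 1 obtain t' s'' where
      2: "exec (compile e' (Suc r)) s' t' s''" "t' \<le> B ^ k'" "same (Suc r) s' s''"
        "s'' (tmp (Suc r)) 0 = eval e' (s 0) (env_of s)"
      by (auto simp: computes_def same_small same_env same_01)
    have 3: "s'' (tmp r) = s' (tmp r)" using same_tmp[OF 2(3)] by simp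
    have 4: "same r s s''" using same_trans[OF 1(3) 2(3)] by simp
    have "B ^ k \<le> B ^ (k + k')" "B ^ k' \<le> B ^ (k + k')" "1 \<le> B ^ (k + k')"
      using B by (auto intro!: power_increasing)
    moreover have "4 * B ^ (k + k') \<le> B ^ (k + k' + 2)"
      using mult_mono[of 2 B 2 B] B(1) by (simp add: power_add power2_eq_square)
    ultimately have "t + (t' + 1) \<le> B ^ (k + k' + 2)" using 1(2) 2(2) by linarith
    then show "computes (Sub e e') r (B ^ (k + k' + 2)) s (eval (Sub e e') (s 0) (env_of s))"
      unfolding computes_def compile.simps
      using exec.Seq[OF 1(1) exec.Seq[OF 2(1)
          exec_put[of "tmp r" "Minus (get (tmp r)) (get (tmp (Suc r)))" s'']]]
        1(4) 2(4) 3 same_upd[OF 4 order_refl] by force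
  qed
next
  case (Bind y e e')
  then obtain k k' where
    k: "\<And>B r s. B \<ge> 2 \<Longrightarrow> small B s \<Longrightarrow> computes e r (B ^ k) s (eval e (s 0) (env_of s))"
    and k': "\<And>B r s. B \<ge> 2 \<Longrightarrow> small B s \<Longrightarrow> computes e' r (B ^ k') s (eval e' (s 0) (env_of s))"
    by blast
  obtain j where j: "\<And>B g env. B \<ge> 2 \<Longrightarrow> (\<forall>y. env y \<le> B) \<Longrightarrow> (\<forall>i. g i \<le> 2) \<Longrightarrow>
    eval e g env \<le> B ^ j" using eval_le[of e] by blast
  show ?case
  proof (intro exI[of _ "k + Suc j * k' + 3"] allI impI)
    fix B r s assume B: "B \<ge> 2" "small B s"
    from k[OF this, of r] obtain t s' where
      1: "exec (compile e r) s t s'" "t \<le> B ^ k" "same r s s'" "s' (tmp r) 0 = eval e (s 0) (env_of s)"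
      by (auto simp: computes_def)
    let ?v = "eval e (s 0) (env_of s)" and ?B = "B ^ Suc j"
    define s1 where "s1 = upd s' (tmp (Suc r)) (s' (var y) 0)"
    define s2 where "s2 = upd s1 (var y) ?v"
    have r1: "same r s s1" unfolding s1_def using 1(3) by (rule same_upd) simp
    have e1: "exec (put (tmp (Suc r)) (get (var y))) s' 1 s1"
      using exec_put[of "tmp (Suc r)" "get (var y)" s'] by (simp add: s1_def)
    have "s1 (tmp r) = s' (tmp r)" by (auto simp: s1_def)
    then have e2: "exec (put (var y) (get (tmp r))) s1 1 s2"
      using exec_put[of "var y" "get (tmp r)" s1] 1(4) by (simp add: s2_def)
    have env2: "env_of s2 = (env_of s)(y := ?v)" "s2 0 = s 0"
      unfolding s2_def env_upd_var same_env[OF r1] using same_01[OF r1] by auto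
    have "?v \<le> B ^ j" using B j[of B "env_of s" "s 0"] by (auto simp: small_def)
    moreover have B': "B ^ j \<le> ?B" "B \<le> ?B" using B(1) by auto
    ultimately have "small ?B s2" using B(2) by (auto simp: small_def env2 intro: order_trans)
    moreover have "2 \<le> ?B" using B' B(1) by linarith
    ultimately obtain t' s3 where
      2: "exec (compile e' (Suc (Suc r))) s2 t' s3" "t' \<le> ?B ^ k'" "same (Suc (Suc r)) s2 s3"
        "s3 (tmp (Suc (Suc r))) 0 = eval (Bind y e e') (s 0) (env_of s)"
      using k'[of ?B s2 "Suc (Suc r)"] by (auto simp: computes_def env2)
    define s4 where "s4 = upd s3 (tmp r) (eval (Bind y e e') (s 0) (env_of s))"
    define s5 where "s5 = upd s4 (var y) (s (var y) 0)"
    have e4: "exec (put (tmp r) (get (tmp (Suc (Suc r))))) s3 1 s4"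
      using exec_put[of "tmp r" "get (tmp (Suc (Suc r)))" s3] 2(4) by (simp add: s4_def)
    have "s4 (tmp (Suc r)) 0 = s3 (tmp (Suc r)) 0" by (auto simp: s4_def)
    also have "\<dots> = s2 (tmp (Suc r)) 0" using same_tmp[OF 2(3), of "Suc r"] by simp
    also have "\<dots> = s1 (tmp (Suc r)) 0"
      by (simp add: s2_def)
    also have "\<dots> = s (var y) 0" by (simp add: s1_def same_var[OF 1(3)])
    finally have e5: "exec (put (var y) (get (tmp (Suc r)))) s4 1 s5"
      using exec_put[of "var y" "get (tmp (Suc r))" s4] by (simp add: s5_def)
    have "s5 a = s a" if a: "\<forall>j\<ge>r. a \<noteq> tmp j" for a
    proof (cases "a = var y")
      case True
      have "s3 a = s2 a" using 2(3) a by (auto simp: same_def)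
      with True a show ?thesis using same_var[OF r1, of y] by (auto simp: s5_def s4_def s2_def)
    next
      case False
      have "s3 a = s2 a" using 2(3) a by (auto simp: same_def)
      moreover have "s1 a = s a" using r1 a by (auto simp: same_def)
      ultimately show ?thesis using False a by (auto simp: s5_def s4_def s2_def)
    qed
    then have r5: "same r s s5" by (auto simp: same_def)
    have v5: "s5 (tmp r) 0 = eval (Bind y e e') (s 0) (env_of s)"
      by (auto simp: s5_def s4_def)
    have kk: "?B ^ k' = B ^ (Suc j * k')" by (rule power_mult[symmetric])
    have "B ^ k \<le> B ^ (k + Suc j * k')" "B ^ (Suc j * k') \<le> B ^ (k + Suc j * k')"
      "1 \<le> B ^ (k + Suc j * k')"
      using B by (auto intro!: power_increasing)
    \<comment> \<open>As \<open>B\<close> is at least 2, raising the exponent by 3 absorbs both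
      running times and the constant overhead.\<close>
    moreover have "8 * B ^ (k + Suc j * k') \<le> B ^ (k + Suc j * k' + 3)"
      using power_mono[of 2 B 3] B(1) by (simp add: power_add)
    ultimately have "t + (1 + (1 + (t' + (1 + 1)))) \<le> B ^ (k + Suc j * k' + 3)"
      using 1(2) 2(2) unfolding kk by linarith
    then show "computes (Bind y e e') r (B ^ (k + Suc j * k' + 3)) s
        (eval (Bind y e e') (s 0) (env_of s))"
      unfolding computes_def compile.simps
      using exec.Seq[OF 1(1) exec.Seq[OF e1 exec.Seq[OF e2 exec.Seq[OF 2(1) exec.Seq[OF e4 e5]]]]]
        r5 v5 by blast
  qed
next
  case (Sum y e e')
  then obtain k k' where
    k: "\<And>B r s. B \<ge> 2 \<Longrightarrow> small B s \<Longrightarrow> computes e r (B ^ k) s (eval e (s 0) (env_of s))"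
    and k': "\<And>B r s. B \<ge> 2 \<Longrightarrow> small B s \<Longrightarrow> computes e' r (B ^ k') s (eval e' (s 0) (env_of s))"
    by blast
  obtain j where j: "\<And>B g env. B \<ge> 2 \<Longrightarrow> (\<forall>y. env y \<le> B) \<Longrightarrow> (\<forall>i. g i \<le> 2) \<Longrightarrow>
    eval e g env \<le> B ^ j" using eval_le[of e] by blast
  show ?case
  proof (intro exI[of _ "k + j + Suc j * k' + 5"] allI impI)
    fix B r s assume B: "B \<ge> 2" "small B s"
    from k[OF this, of "Suc r"] obtain t s' where
      1: "exec (compile e (Suc r)) s t s'" "t \<le> B ^ k" "same (Suc r) s s'"
        "s' (tmp (Suc r)) 0 = eval e (s 0) (env_of s)"
      by (auto simp: computes_def)
    let ?v = "eval e (s 0) (env_of s)" and ?B = "B ^ Suc j"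
    define s1 where "s1 = upd s' (tmp r) 0"
    define s2 where "s2 = upd s1 (tmp (Suc (Suc r))) (s (var y) 0)"
    define s3 where "s3 = upd s2 (var y) 0"
    have e1: "exec (put (tmp r) (Const 0)) s' 1 s1"
      using exec_put[of "tmp r" "Const 0" s'] by (simp add: s1_def)
    have "s1 (var y) = s (var y)" using same_var[OF 1(3)] by (simp add: s1_def)
    then have e2: "exec (put (tmp (Suc (Suc r))) (get (var y))) s1 1 s2"
      using exec_put[of "tmp (Suc (Suc r))" "get (var y)" s1] by (simp add: s2_def)
    have e3: "exec (put (var y) (Const 0)) s2 1 s3"
      using exec_put[of "var y" "Const 0" s2] by (simp add: s3_def)
    \<comment> \<open>Invariant after \<open>i\<close> rounds. The array of \<open>y\<close> is
      specified in full and not only in cell 0, so that resetting cell 0 recovers the whole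
      array.\<close>
    define P where "P i s'' \<longleftrightarrow> s'' (tmp (Suc r)) 0 = ?v \<and>
        s'' (tmp r) 0 = (\<Sum>l<i. eval e' (s 0) ((env_of s)(y := l))) \<and>
        s'' (tmp (Suc (Suc r))) 0 = s (var y) 0 \<and>
        s'' (var y) = (s (var y))(0 := i) \<and>
        (\<forall>a. a \<noteq> var y \<longrightarrow> (\<forall>j\<ge>r. a \<noteq> tmp j) \<longrightarrow> s'' a = s a)" for i s''
    have s': "s' a = s a" if "\<forall>j\<ge>r. a \<noteq> tmp j" for a
      using 1(3) that by (auto simp: same_def)
    have P0: "P 0 s3"
      unfolding P_def s3_def s2_def s1_def
      using 1(4) same_var[OF 1(3), of y] s' by auto
    have vj: "?v \<le> B ^ j" using B j[of B "env_of s" "s 0"] by (auto simp: small_def)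
    have B': "B ^ j \<le> ?B" "B \<le> ?B" "2 \<le> ?B"
    proof -
      show "B ^ j \<le> ?B" "B \<le> ?B" using B(1) by auto
      then show "2 \<le> ?B" using B(1) by linarith
    qed
    let ?b = "Minus (get (tmp (Suc r))) (get (var y))"
    let ?c = "Seq (compile e' (Suc (Suc (Suc r))))
        (Seq (put (tmp r) (Plus (get (tmp r)) (get (tmp (Suc (Suc (Suc r)))))))
             (put (var y) (Plus (get (var y)) (Const 1))))"
    have "\<exists>t s''. exec (While ?b ?c) s3 t s'' \<and> P ?v s'' \<and> t \<le> ?v * ((?B ^ k' + 2) + 1) + 1"
    proof (rule exec_for[where P = P])
      fix i s0 assume i: "i < ?v" and P: "P i s0"
      have env: "env_of s0 = (env_of s)(y := i)"
        using P unfolding P_def env_of_def fun_eq_iff by auto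
      have inp: "s0 0 = s 0" using P unfolding P_def by auto
      have "i \<le> ?B" using B'(1) vj i by linarith
      then have "small ?B s0" using B(2) B'(2)
        by (auto simp: small_def env inp simp del: power_Suc intro: order_trans)
      from k'[OF B'(3) this, of "Suc (Suc (Suc r))"] obtain t' s4 where
        2: "exec (compile e' (Suc (Suc (Suc r)))) s0 t' s4" "t' \<le> ?B ^ k'"
          "same (Suc (Suc (Suc r))) s0 s4"
          "s4 (tmp (Suc (Suc (Suc r)))) 0 = eval e' (s 0) ((env_of s)(y := i))"
        by (auto simp: computes_def env inp)
      define s5 where
        "s5 = upd s4 (tmp r) (s4 (tmp r) 0 + s4 (tmp (Suc (Suc (Suc r)))) 0)"
      define s6 where "s6 = upd s5 (var y) (Suc (s5 (var y) 0))"
      have e5: "exec (put (tmp r) (Plus (get (tmp r)) (get (tmp (Suc (Suc (Suc r))))))) s4 1 s5"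
        using exec_put[of "tmp r" "Plus (get (tmp r)) (get (tmp (Suc (Suc (Suc r)))))" s4]
        by (simp add: s5_def)
      have e6: "exec (put (var y) (Plus (get (var y)) (Const 1))) s5 1 s6"
        using exec_put[of "var y" "Plus (get (var y)) (Const 1)" s5] by (simp add: s6_def)
      have t4: "s4 (tmp l) = s0 (tmp l)" if "l < Suc (Suc (Suc r))" for l
        using same_tmp[OF 2(3)] that .
      have v4: "s4 (var y) = s0 (var y)" using same_var[OF 2(3)] .
      have o4: "s4 a = s0 a" if "\<forall>j\<ge>r. a \<noteq> tmp j" for a
        using 2(3) that by (auto simp: same_def)
      have "P (Suc i) s6"
        unfolding P_def
      proof (intro conjI allI impI)
        show "s6 (tmp (Suc r)) 0 = ?v"
          using P t4[of "Suc r"] unfolding P_def s6_def s5_def by simp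
        show "s6 (tmp (Suc (Suc r))) 0 = s (var y) 0"
          using P t4[of "Suc (Suc r)"] unfolding P_def s6_def s5_def by simp
        show "s6 (tmp r) 0 = (\<Sum>l<Suc i. eval e' (s 0) ((env_of s)(y := l)))"
          using P t4[of r] 2(4) unfolding P_def s6_def s5_def by simp
        show "s6 (var y) = (s (var y))(0 := Suc i)"
          using P v4 unfolding P_def s6_def s5_def by simp
        fix a assume "a \<noteq> var y" "\<forall>j\<ge>r. a \<noteq> tmp j"
        then show "s6 a = s a"
          using P o4[of a] unfolding P_def s6_def s5_def by auto
      qed
      moreover have "aval ?b s0 \<noteq> 0" using P i unfolding P_def by simp
      moreover have "t' + (1 + 1) \<le> ?B ^ k' + 2" using 2(2) by simp
      ultimately show "aval ?b s0 \<noteq> 0 \<and> (\<exists>t s'. exec ?c s0 t s' \<and> P (Suc i) s' \<and> t \<le> ?B ^ k' + 2)"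
        using exec.Seq[OF 2(1) exec.Seq[OF e5 e6]] by blast
    next
      fix s0 assume "P ?v s0"
      then show "aval ?b s0 = 0" unfolding P_def by simp
    qed (rule P0)
    then obtain t4 s4 where
      4: "exec (While ?b ?c) s3 t4 s4" "P ?v s4" "t4 \<le> ?v * ((?B ^ k' + 2) + 1) + 1" by blast
    define s5 where "s5 = upd s4 (var y) (s (var y) 0)"
    have e5: "exec (put (var y) (get (tmp (Suc (Suc r))))) s4 1 s5"
      using exec_put[of "var y" "get (tmp (Suc (Suc r)))" s4] 4(2) by (simp add: s5_def P_def)
    have r5: "same r s s5"
      using 4(2) unfolding same_def P_def s5_def by auto
    have v5: "s5 (tmp r) 0 = eval (Sum y e e') (s 0) (env_of s)"
      using 4(2) unfolding P_def s5_def by simp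
    let ?X = "B ^ (k + j + Suc j * k')"
    have kk: "?B ^ k' = B ^ (Suc j * k')" by (rule power_mult[symmetric])
    have "t4 \<le> B ^ j * ((?B ^ k' + 2) + 1) + 1" using 4(3) vj
      by (meson add_le_mono1 le_trans mult_le_mono1)
    also have "\<dots> = B ^ (j + Suc j * k') + 3 * B ^ j + 1"
      unfolding kk by (simp add: power_add algebra_simps)
    finally have "t4 \<le> B ^ (j + Suc j * k') + 3 * B ^ j + 1" .
    moreover have "B ^ k \<le> ?X" "B ^ (j + Suc j * k') \<le> ?X" "B ^ j \<le> ?X" "1 \<le> ?X"
      using B by (auto intro!: power_increasing)
    moreover have "32 * ?X \<le> B ^ (k + j + Suc j * k' + 5)"
      using power_mono[of 2 B 5] B(1) unfolding power_add[of B "k + j + Suc j * k'" 5] by simp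
    ultimately have "t + (1 + (1 + (1 + (t4 + 1)))) \<le> B ^ (k + j + Suc j * k' + 5)"
      using 1(2) by linarith
    then show "computes (Sum y e e') r (B ^ (k + j + Suc j * k' + 5)) s
        (eval (Sum y e e') (s 0) (env_of s))"
      unfolding computes_def compile.simps
      using exec.Seq[OF 1(1) exec.Seq[OF e1 exec.Seq[OF e2 exec.Seq[OF e3 exec.Seq[OF 4(1) e5]]]]]
        r5 v5 by blast
  qed
qed


text \<open>The program finds the input length by scanning for the first empty cell, evaluates
  \<open>eL\<close>, and then evaluates \<open>eB\<close> once for every output position. Variable 0
  holds the input length, variable 1 the position, and all other variables are 0.\<close>

lemma polytimeI:
  assumes len: "\<And>xs. length (f xs) = eval eL (cells xs) ((\<lambda>_. 0)(0 := length xs))"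
    and bit: "\<And>xs p. p < length (f xs) \<Longrightarrow>
      f xs ! p \<longleftrightarrow> eval eB (cells xs) ((\<lambda>_. 0)(0 := length xs, 1 := p)) \<noteq> 0"
  shows "polytime f"
proof -
  obtain k1 where k1: "\<And>B r s. B \<ge> 2 \<Longrightarrow> small B s \<Longrightarrow>
      computes eL r (B ^ k1) s (eval eL (s 0) (env_of s))"
    using compile_correct[of eL] by blast
  obtain k2 where k2: "\<And>B r s. B \<ge> 2 \<Longrightarrow> small B s \<Longrightarrow>
      computes eB r (B ^ k2) s (eval eB (s 0) (env_of s))"
    using compile_correct[of eB] by blast
  obtain j where j: "\<And>B g env. B \<ge> 2 \<Longrightarrow> (\<forall>y. env y \<le> B) \<Longrightarrow> (\<forall>i. g i \<le> 2) \<Longrightarrow>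
      eval eL g env \<le> B ^ j" using eval_le[of eL] by blast
  let ?bl = "Get 0 (get (var 0))" and ?cl = "put (var 0) (Plus (get (var 0)) (Const 1))"
  let ?bw = "Minus (get (tmp 0)) (get (var 1))"
  let ?cw = "Seq (compile eB 1) (Seq (Cond (get (tmp 1))
      (Put 1 (get (var 1)) (Const 2)) (Put 1 (get (var 1)) (Const 1)))
      (put (var 1) (Plus (get (var 1)) (Const 1))))"
  let ?prog = "Seq (While ?bl ?cl) (Seq (compile eL 0) (While ?bw ?cw))"
  let ?k = "j + k1 + Suc j * k2 + 5"
  \<comment> \<open>The time bound is a power of the input length plus 2, the base \<open>B\<close>
    used below.\<close>
  have "\<exists>t s. exec ?prog ((\<lambda>_ _. 0)(0 := cells xs)) t s \<and> s 1 = cells (f xs) \<and>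
      t \<le> poly ([:2, 1:] ^ ?k) (length xs)" for xs
  proof -
    let ?s = "(\<lambda>_ _. 0)(0 := cells xs) :: store" and ?n = "length xs"
    define B where "B = ?n + 2"
    have B: "B \<ge> 2" by (simp add: B_def)
    define P0 where "P0 i s \<longleftrightarrow> s = upd ?s (var 0) i" for i s
    \<comment> \<open>The scan stops exactly at the end of the input, since bits are stored as 1 or
      2 and the cells behind them as 0.\<close>
    have "\<exists>t s'. exec (While ?bl ?cl) ?s t s' \<and> P0 ?n s' \<and> t \<le> ?n * (1 + 1) + 1"
    proof (rule exec_for[where P = P0])
      fix i s assume i: "i < ?n" and P: "P0 i s"
      have "upd s (var 0) (aval (Plus (get (var 0)) (Const 1)) s) = upd ?s (var 0) (Suc i)"
        using P by (auto simp: P0_def)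
      then have "exec ?cl s 1 (upd ?s (var 0) (Suc i))"
        using exec_put[of "var 0" "Plus (get (var 0)) (Const 1)" s] by metis
      moreover have "aval ?bl s \<noteq> 0" using P i by (simp add: P0_def cells_def)
      ultimately show "aval ?bl s \<noteq> 0 \<and> (\<exists>t s'. exec ?cl s t s' \<and> P0 (Suc i) s' \<and> t \<le> 1)"
        unfolding P0_def by blast
    next
      show "P0 0 ?s" by (auto simp: P0_def fun_eq_iff)
    qed (auto simp: P0_def cells_def)
    then obtain t0 s0 where 0: "exec (While ?bl ?cl) ?s t0 s0" "s0 = upd ?s (var 0) ?n"
      "t0 \<le> 2 * ?n + 1" by (auto simp: P0_def)
    have env0: "env_of s0 = (\<lambda>_. 0)(0 := ?n)" "s0 0 = cells xs" "s0 (Suc 0) = (\<lambda>_. 0)"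
      by (auto simp: 0(2) env_of_def)
    have cells: "cells xs i \<le> 2" for i by (simp add: cells_def)
    have small0: "small B s0" by (auto simp: small_def env0 cells B_def)
    from k1[OF B this, of 0] obtain t1 s1 where 1: "exec (compile eL 0) s0 t1 s1" "t1 \<le> B ^ k1"
      "same 0 s0 s1" "s1 (tmp 0) 0 = length (f xs)"
      by (auto simp: computes_def env0 len)
    let ?B = "B ^ Suc j"
    have B': "B \<le> ?B" "2 \<le> ?B" using B self_le_power[of B "Suc j"] by (auto simp del: power_Suc)
    have lenB: "length (f xs) \<le> B ^ j"
      using j[OF B, of "env_of s0" "s0 0"] small0 by (simp add: small_def len env0)
    also have "B ^ j \<le> ?B" using B by simp
    finally have lenB': "length (f xs) \<le> ?B" .
    define P1 where "P1 i s \<longleftrightarrow> env_of s = (\<lambda>_. 0)(0 := ?n, 1 := i) \<and> s 0 = cells xs \<and>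
        s 1 = cells (take i (f xs)) \<and> s (tmp 0) 0 = length (f xs)" for i s
    have "\<exists>t s'. exec (While ?bw ?cw) s1 t s' \<and> P1 (length (f xs)) s' \<and>
        t \<le> length (f xs) * ((?B ^ k2 + 3) + 1) + 1"
    proof (rule exec_for[where P = P1])
      fix i s assume i: "i < length (f xs)" and P: "P1 i s"
      have "env_of s 1 = i" using P by (simp add: P1_def)
      then have vi: "s (var 1) 0 = i" by (simp add: env_of_def)
      have "i \<le> ?B" using i lenB' by linarith
      then have "small ?B s" using P cells B' by (auto simp: small_def P1_def B_def simp del: power_Suc)
      from k2[OF B'(2) this, of 1] obtain t2 s2 where 2: "exec (compile eB 1) s t2 s2"
        "t2 \<le> ?B ^ k2" "same 1 s s2"
        "s2 (tmp 1) 0 = eval eB (cells xs) ((\<lambda>_. 0)(0 := length xs, 1 := i))"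
        using P by (auto simp: computes_def P1_def)
      have b: "f xs ! i \<longleftrightarrow> s2 (tmp 1) 0 \<noteq> 0" using bit[OF i] 2(4) by simp
      have env2: "env_of s2 = (\<lambda>_. 0)(0 := ?n, 1 := i)" "s2 0 = cells xs"
        "s2 1 = cells (take i (f xs))" "s2 (tmp 0) 0 = length (f xs)"
        using P same_env[OF 2(3)] same_01[OF 2(3)] same_tmp[OF 2(3), of 0] by (auto simp: P1_def)
      have v1: "s2 (var 1) 0 = i" using fun_cong[OF env2(1), of 1] by (simp add: env_of_def)
      define s3 where "s3 = s2(1 := (s2 1)(i := if f xs ! i then 2 else 1))"
      have e3: "exec (Cond (get (tmp 1)) (Put 1 (get (var 1)) (Const 2)) (Put 1 (get (var 1)) (Const 1)))
          s2 (Suc 1) s3"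
      proof (cases "f xs ! i")
        case True
        then show ?thesis
          using exec.CondTrue[of "get (tmp 1)" s2, OF _ exec.Put[of 1 "get (var 1)" "Const 2" s2]] b v1
          by (simp add: s3_def)
      next
        case False
        then show ?thesis
          using exec.CondFalse[of "get (tmp 1)" s2, OF _ exec.Put[of 1 "get (var 1)" "Const 1" s2]] b v1
          by (simp add: s3_def)
      qed
      define s4 where "s4 = upd s3 (var 1) (Suc i)"
      have e4: "exec (put (var 1) (Plus (get (var 1)) (Const 1))) s3 1 s4"
        using exec_put[of "var 1" "Plus (get (var 1)) (Const 1)" s3] v1
        by (simp add: s3_def s4_def)
      have "env_of s3 = env_of s2" by (auto simp: s3_def env_of_def)
      then have "env_of s4 = (\<lambda>_. 0)(0 := ?n, 1 := Suc i)"
        unfolding s4_def env_upd_var env2(1) by (auto simp: fun_eq_iff env2)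
      moreover have "(cells (take i (f xs)))(i := if f xs ! i then 2 else 1) = cells (take (Suc i) (f xs))"
        using i by (auto simp: cells_def fun_eq_iff less_Suc_eq)
      ultimately have "P1 (Suc i) s4"
        using env2 by (simp add: P1_def s4_def s3_def)
      moreover have "aval ?bw s \<noteq> 0"
        using P i vi by (simp add: P1_def)
      moreover have "t2 + (Suc 1 + 1) \<le> ?B ^ k2 + 3" using 2(2) by simp
      ultimately show "aval ?bw s \<noteq> 0 \<and> (\<exists>t s'. exec ?cw s t s' \<and> P1 (Suc i) s' \<and> t \<le> ?B ^ k2 + 3)"
        using exec.Seq[OF 2(1) exec.Seq[OF e3 e4]] by blast
    next
      fix s assume P: "P1 (length (f xs)) s"
      then have "env_of s 1 = length (f xs)" by (simp add: P1_def)
      then have "s (var 1) 0 = length (f xs)" by (simp add: env_of_def)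
      with P show "aval ?bw s = 0" by (simp add: P1_def)
    next
      show "P1 0 s1"
        using 1(4) same_env[OF 1(3)] same_01[OF 1(3)]
        by (auto simp: P1_def env0 cells_def fun_eq_iff)
    qed
    then obtain t2 s2 where 2: "exec (While ?bw ?cw) s1 t2 s2" "s2 1 = cells (f xs)"
      "t2 \<le> length (f xs) * (?B ^ k2 + 3 + 1) + 1" by (auto simp: P1_def)
    let ?X = "B ^ (j + k1 + Suc j * k2)"
    have kk: "?B ^ k2 = B ^ (Suc j * k2)" by (rule power_mult[symmetric])
    have "t2 \<le> B ^ j * (?B ^ k2 + 3 + 1) + 1" using 2(3) lenB
      by (meson add_le_mono1 le_trans mult_le_mono1)
    also have "\<dots> = B ^ (j + Suc j * k2) + 4 * B ^ j + 1"
      unfolding kk by (simp add: power_add algebra_simps)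
    finally have "t2 \<le> B ^ (j + Suc j * k2) + 4 * B ^ j + 1" .
    moreover have "B ^ k1 \<le> ?X" "B ^ (j + Suc j * k2) \<le> ?X" "B ^ j \<le> ?X" "1 \<le> ?X"
      using B by (auto intro!: power_increasing)
    moreover have "2 * (B * ?X) + 10 * ?X \<le> B ^ ?k"
    proof -
      have "16 * B \<le> B ^ 4 * B" using power_mono[of 2 B 4] B by (intro mult_right_mono) auto
      then have "2 * B + 10 \<le> B ^ 5" using B by (simp add: eval_nat_numeral)
      then have "(2 * B + 10) * ?X \<le> B ^ 5 * ?X" by (rule mult_right_mono) simp
      then show ?thesis by (simp add: power_add algebra_simps)
    qed
    moreover have "2 * B \<le> 2 * (B * ?X)" using \<open>1 \<le> ?X\<close> by simp
    moreover have "t0 \<le> 2 * B" using 0(3) by (simp add: B_def)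
    ultimately have "t0 + (t1 + t2) \<le> B ^ ?k"
      using 1(2) by linarith
    also have "\<dots> = poly ([:2, 1:] ^ ?k) ?n" by (simp add: B_def add.commute)
    finally show ?thesis
      using exec.Seq[OF 0(1) exec.Seq[OF 1(1) 2(1)]] 2(2) by blast
  qed
  then show ?thesis unfolding polytime_def by blast
qed

section \<open>Expansion of the torus\<close>

lemma sum_periodic_window:
  fixes p :: "int \<Rightarrow> 'a::ab_group_add"
  assumes per: "\<And>x. p (x + m) = p x" and m: "m > 0"
  shows "sum p {c..<c + m} = sum p {0..<m}"
proof -
  \<comment> \<open>Sliding the window by one trades the term at \<open>c\<close> for the equal term
    at \<open>c + m\<close>.\<close>
  have step: "sum p {c + 1..<c + 1 + m} = sum p {c..<c + m}" for c
  proof -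
    have "{c..<c + 1 + m} = insert c {c + 1..<c + 1 + m}" using m by auto
    moreover have "{c..<c + 1 + m} = insert (c + m) {c..<c + m}" using m by auto
    ultimately have "p c + sum p {c + 1..<c + 1 + m} = p (c + m) + sum p {c..<c + m}"
      by (metis atLeastLessThan_iff finite_atLeastLessThan_int less_irrefl not_less_iff_gr_or_eq
          sum.insert zle_add1_eq_le add.commute)
    then show ?thesis using per by simp
  qed
  show ?thesis
  proof (induction c rule: int_induct[of _ 0])
    case (step2 i)
    then show ?case using step[of "i - 1"] by simp
  qed (use step in auto)
qed

lemma sum_periodic_shift:
  fixes p :: "int \<Rightarrow> 'a::ab_group_add"
  assumes per: "\<And>x. p (x + m) = p x" and m: "m > 0"
  shows "(\<Sum>x\<in>{0..<m}. p (x + c)) = sum p {0..<m}"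
proof -
  have "(\<Sum>x\<in>{0..<m}. p (x + c)) = sum p {c..<c + m}"
    by (rule sum.reindex_bij_witness[of _ "\<lambda>x. x - c" "\<lambda>x. x + c"]) auto
  then show ?thesis using sum_periodic_window[of p m, OF per m] by simp
qed

lemma periodic_mult:
  fixes p :: "int \<Rightarrow> 'a"
  assumes per: "\<And>x. p (x + m) = p x"
  shows "p (x + m * c) = p x"
proof (induction c arbitrary: x rule: int_induct[of _ 0])
  case (step1 i)
  then show ?case using per[of "x + m * i"] by (simp add: algebra_simps)
next
  case (step2 i)
  then show ?case using per[of "x + m * (i - 1)"] by (simp add: algebra_simps)
qed simp

section \<open>Additive characters of the integers modulo m and Parseval's identity\<close>

definition chi :: "int \<Rightarrow> int \<Rightarrow> complex" where
  "chi m t = cis (2 * pi * of_int t / of_int m)"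

lemma chi_add: "chi m (s + t) = chi m s * chi m t"
  by (simp add: chi_def cis_mult add_divide_distrib distrib_left)

lemma chi_0 [simp]: "chi m 0 = 1" by (simp add: chi_def)

lemma norm_chi [simp]: "norm (chi m t) = 1" by (simp add: chi_def)

lemma cnj_chi: "cnj (chi m t) = chi m (- t)" by (simp add: chi_def cis_cnj)

lemma chi_eq_1_iff:
  assumes "m > 0"
  shows "chi m t = 1 \<longleftrightarrow> m dvd t"
proof
  assume "chi m t = 1"
  then have "cos (2 * pi * of_int t / of_int m) = 1" unfolding chi_def by (metis cis.sel(1) one_complex.sel(1))
  then obtain n :: int where n: "2 * pi * of_int t / of_int m = of_int n * 2 * pi"
    using cos_one_2pi_int by blast
  then have "of_int t = (of_int (n * m) :: real)" using assms by (simp add: field_simps)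
  then have "t = n * m" by linarith
  then show "m dvd t" by simp
next
  assume "m dvd t"
  then obtain n where "t = m * n" ..
  then have "2 * pi * of_int t / of_int m = 2 * pi * of_int n" using assms by simp
  then show "chi m t = 1" by (simp add: chi_def)
qed

lemma chi_period:
  assumes "m > 0" "m dvd c"
  shows "chi m (t + c) = chi m t"
  using assms chi_eq_1_iff[of m c] by (simp add: chi_add)

text \<open>If \<open>m\<close> does not divide \<open>z\<close>, shifting the index by one
  multiplies the sum by \<open>chi m z\<close>, which is different from 1; hence the sum
  vanishes.\<close>

lemma chi_orthogonal:
  assumes m: "m > 0"
  shows "(\<Sum>k\<in>{0..<m}. chi m (k * z)) = (if m dvd z then of_int m else 0)"
proof (cases "m dvd z")
  case True
  then have "chi m (k * z) = 1" for k using chi_eq_1_iff[OF m] by simp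
  then show ?thesis using True m by simp
next
  case False
  let ?S = "\<Sum>k\<in>{0..<m}. chi m (k * z)"
  have "chi m ((k + m) * z) = chi m (k * z)" for k
    using chi_period[OF m, of "m * z" "k * z"] by (simp add: algebra_simps)
  from sum_periodic_shift[of "\<lambda>k. chi m (k * z)", OF this m, of 1]
  have "?S = (\<Sum>k\<in>{0..<m}. chi m ((k + 1) * z))" by simp
  also have "\<dots> = chi m z * ?S" 
    unfolding distrib_right chi_add sum_distrib_left by (simp add: mult.commute)
  finally have "(chi m z - 1) * ?S = 0" by (simp add: algebra_simps)
  moreover have "chi m z \<noteq> 1" using False chi_eq_1_iff[OF m] by simp
  ultimately show ?thesis using False by simp
qed

text \<open>Expanding the squared modulus gives a double sum over two positions, and summing over
  the frequencies first kills the off-diagonal terms by orthogonality.\<close>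

lemma parseval:
  fixes g :: "int \<Rightarrow> complex"
  assumes m: "m > 0"
  shows "(\<Sum>k\<in>{0..<m}. (cmod (\<Sum>x\<in>{0..<m}. g x * chi m (k * x)))\<^sup>2) =
    of_int m * (\<Sum>x\<in>{0..<m}. (cmod (g x))\<^sup>2)"
proof -
  let ?W = "{0..<m}"
  have dvd: "m dvd x - y \<longleftrightarrow> x = y" if "x \<in> ?W" "y \<in> ?W" for x y
  proof
    assume "m dvd x - y"
    then show "x = y" using that zdvd_not_zless[of "x - y" m] zdvd_not_zless[of "y - x" m]
      by (metis atLeastLessThan_iff diff_ge_0_iff_ge dvd_diff_commute eq_iff_diff_eq_0 int_one_le_iff_zero_less
          less_le linorder_le_cases diff_less_eq le_add_same_cancel1 less_le_trans order.trans not_less)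
  qed simp
  have "complex_of_real (\<Sum>k\<in>?W. (cmod (\<Sum>x\<in>?W. g x * chi m (k * x)))\<^sup>2) =
      (\<Sum>k\<in>?W. (\<Sum>x\<in>?W. g x * chi m (k * x)) * cnj (\<Sum>y\<in>?W. g y * chi m (k * y)))"
    by (simp only: of_real_sum complex_norm_square)
  also have "\<dots> = (\<Sum>k\<in>?W. \<Sum>x\<in>?W. \<Sum>y\<in>?W. g x * cnj (g y) * chi m (k * (x - y)))"
  proof (rule sum.cong[OF refl])
    fix k
    have c: "chi m (k * (x - y)) = chi m (k * x) * cnj (chi m (k * y))" for x y
      by (simp add: cnj_chi flip: chi_add) (simp add: right_diff_distrib)
    show "(\<Sum>x\<in>?W. g x * chi m (k * x)) * cnj (\<Sum>y\<in>?W. g y * chi m (k * y)) =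
      (\<Sum>x\<in>?W. \<Sum>y\<in>?W. g x * cnj (g y) * chi m (k * (x - y)))"
      unfolding c by (simp add: sum_product algebra_simps)
  qed
  also have "\<dots> = (\<Sum>x\<in>?W. \<Sum>y\<in>?W. \<Sum>k\<in>?W. g x * cnj (g y) * chi m (k * (x - y)))"
    by (subst sum.swap) (rule sum.cong[OF refl], rule sum.swap)
  also have "\<dots> = (\<Sum>x\<in>?W. \<Sum>y\<in>?W. if y = x then g x * cnj (g x) * of_int m else 0)"
    by (intro sum.cong refl) (auto simp: chi_orthogonal[OF m] dvd simp flip: sum_distrib_left)
  also have "\<dots> = complex_of_real (of_int m * (\<Sum>x\<in>?W. (cmod (g x))\<^sup>2))"
    unfolding of_real_mult of_real_sum complex_norm_square
    by (simp add: sum_distrib_left mult.commute)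
  finally show ?thesis by (simp only: of_real_eq_iff)
qed

section \<open>The unnormalised two-dimensional Fourier transform\<close>

definition fourier :: "int \<Rightarrow> (int \<Rightarrow> int \<Rightarrow> complex) \<Rightarrow> int \<Rightarrow> int \<Rightarrow> complex" where
  "fourier m f k l = (\<Sum>x\<in>{0..<m}. \<Sum>y\<in>{0..<m}. f x y * chi m (k * x + l * y))"

text \<open>The one-dimensional identity is applied in the first coordinate for each
  \<open>l\<close> and then in the second coordinate for each \<open>x\<close>.\<close>

lemma fourier_parseval:
  assumes m: "m > 0"
  shows "(\<Sum>k\<in>{0..<m}. \<Sum>l\<in>{0..<m}. (cmod (fourier m f k l))\<^sup>2) =
    (of_int m)\<^sup>2 * (\<Sum>x\<in>{0..<m}. \<Sum>y\<in>{0..<m}. (cmod (f x y))\<^sup>2)"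
proof -
  let ?W = "{0..<m}"
  have "(\<Sum>k\<in>?W. (cmod (fourier m f k l))\<^sup>2) =
      of_int m * (\<Sum>x\<in>?W. (cmod (\<Sum>y\<in>?W. f x y * chi m (l * y)))\<^sup>2)" for l
  proof -
    have "fourier m f k l = (\<Sum>x\<in>?W. (\<Sum>y\<in>?W. f x y * chi m (l * y)) * chi m (k * x))" for k
      unfolding fourier_def chi_add sum_distrib_right by (simp add: mult_ac)
    then show ?thesis using parseval[OF m, of "\<lambda>x. \<Sum>y\<in>?W. f x y * chi m (l * y)"] by simp
  qed
  then have "(\<Sum>l\<in>?W. \<Sum>k\<in>?W. (cmod (fourier m f k l))\<^sup>2) =
      (\<Sum>l\<in>?W. of_int m * (\<Sum>x\<in>?W. (cmod (\<Sum>y\<in>?W. f x y * chi m (l * y)))\<^sup>2))" by simp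
  also have "\<dots> = of_int m * (\<Sum>x\<in>?W. \<Sum>l\<in>?W. (cmod (\<Sum>y\<in>?W. f x y * chi m (l * y)))\<^sup>2)"
    by (subst sum.swap) (simp add: sum_distrib_left)
  also have "\<dots> = of_int m * (\<Sum>x\<in>?W. of_int m * (\<Sum>y\<in>?W. (cmod (f x y))\<^sup>2))"
    by (simp add: parseval[OF m])
  finally show ?thesis
    by (subst sum.swap) (simp add: sum_distrib_left power2_eq_square mult_ac)
qed

lemma fourier_diff: "fourier m (\<lambda>x y. f x y - g x y) k l = fourier m f k l - fourier m g k l"
  by (simp add: fourier_def sum_subtractf left_diff_distrib)

lemma fourier_periodic:
  assumes "m > 0"
  shows "fourier m f (k + m) l = fourier m f k l" "fourier m f k (l + m) = fourier m f k l"
proof -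
  have "chi m ((k + m) * x + l * y) = chi m (k * x + l * y)" for x y
    using chi_period[OF assms, of "m * x" "k * x + l * y"] by (simp add: algebra_simps)
  moreover have "chi m (k * x + (l + m) * y) = chi m (k * x + l * y)" for x y
    using chi_period[OF assms, of "m * y" "k * x + l * y"] by (simp add: algebra_simps)
  ultimately show "fourier m f (k + m) l = fourier m f k l" "fourier m f k (l + m) = fourier m f k l"
    by (simp_all add: fourier_def)
qed

context
  fixes m :: int and f :: "int \<Rightarrow> int \<Rightarrow> complex"
  assumes m: "m > 0" and per: "\<And>x y. f (x + m) y = f x y" "\<And>x y. f x (y + m) = f x y"
begin

text \<open>Substituting \<open>x + (c * y + d)\<close> for \<open>x\<close> turns the shear into
  the transposed shear of the frequencies and the translation into a phase. One statement thus
  covers a shear (\<open>c = 1\<close>, \<open>d = 0\<close>) and a unit translation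
  (\<open>c = 0\<close>, \<open>d = 1\<close>); \<open>fourier_shift2\<close> treats the other
  coordinate.\<close>

lemma fourier_shift1:
  "fourier m (\<lambda>x y. f (x - c * y - d) y) k l = chi m (k * d) * fourier m f k (l + c * k)"
proof -
  let ?W = "{0..<m}"
  have "(\<Sum>x\<in>?W. f (x - c * y - d) y * chi m (k * x + l * y)) =
      chi m (k * d) * (\<Sum>x\<in>?W. f x y * chi m (k * x + (l + c * k) * y))" for y
  proof -
    let ?p = "\<lambda>x. f (x - c * y - d) y * chi m (k * x + l * y)"
    have "?p (x + m) = ?p x" for x
    proof -
      have "f (x + m - c * y - d) y = f (x - c * y - d) y"
        using per(1)[of "x - c * y - d" y] by (simp add: algebra_simps)
      moreover have "chi m (k * (x + m) + l * y) = chi m (k * x + l * y)"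
        using chi_period[OF m, of "k * m" "k * x + l * y"] by (simp add: algebra_simps)
      ultimately show ?thesis by simp
    qed
    from sum_periodic_shift[of ?p, OF this m, of "c * y + d"]
    have "sum ?p ?W = (\<Sum>x\<in>?W. ?p (x + (c * y + d)))" by (rule sym)
    also have "\<dots> = (\<Sum>x\<in>?W. chi m (k * d) * (f x y * chi m (k * x + (l + c * k) * y)))"
    proof (rule sum.cong[OF refl])
      fix x
      have "k * (x + (c * y + d)) + l * y = k * d + (k * x + (l + c * k) * y)"
        by (simp add: algebra_simps)
      then show "?p (x + (c * y + d)) = chi m (k * d) * (f x y * chi m (k * x + (l + c * k) * y))"
        by (simp add: chi_add)
    qed
    finally show ?thesis by (simp add: sum_distrib_left)
  qed
  then have "(\<Sum>y\<in>?W. \<Sum>x\<in>?W. f (x - c * y - d) y * chi m (k * x + l * y)) =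
     (\<Sum>y\<in>?W. chi m (k * d) * (\<Sum>x\<in>?W. f x y * chi m (k * x + (l + c * k) * y)))" by simp
  then show ?thesis
    unfolding fourier_def by (subst (1 2) sum.swap) (simp add: sum_distrib_left)
qed

lemma fourier_shift2:
  "fourier m (\<lambda>x y. f x (y - c * x - d)) k l = chi m (l * d) * fourier m f (k + c * l) l"
proof -
  let ?W = "{0..<m}"
  have "(\<Sum>y\<in>?W. f x (y - c * x - d) * chi m (k * x + l * y)) =
      chi m (l * d) * (\<Sum>y\<in>?W. f x y * chi m ((k + c * l) * x + l * y))" for x
  proof -
    let ?p = "\<lambda>y. f x (y - c * x - d) * chi m (k * x + l * y)"
    have "?p (y + m) = ?p y" for y
    proof -
      have "f x (y + m - c * x - d) = f x (y - c * x - d)"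
        using per(2)[of x "y - c * x - d"] by (simp add: algebra_simps)
      moreover have "chi m (k * x + l * (y + m)) = chi m (k * x + l * y)"
        using chi_period[OF m, of "l * m" "k * x + l * y"] by (simp add: algebra_simps)
      ultimately show ?thesis by simp
    qed
    from sum_periodic_shift[of ?p, OF this m, of "c * x + d"]
    have "sum ?p ?W = (\<Sum>y\<in>?W. ?p (y + (c * x + d)))" by (rule sym)
    also have "\<dots> = (\<Sum>y\<in>?W. chi m (l * d) * (f x y * chi m ((k + c * l) * x + l * y)))"
    proof (rule sum.cong[OF refl])
      fix y
      have "k * x + l * (y + (c * x + d)) = l * d + ((k + c * l) * x + l * y)"
        by (simp add: algebra_simps)
      then show "?p (y + (c * x + d)) = chi m (l * d) * (f x y * chi m ((k + c * l) * x + l * y))"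
        by (simp add: chi_add)
    qed
    finally show ?thesis by (simp add: sum_distrib_left)
  qed
  then show ?thesis
    unfolding fourier_def by (simp add: sum_distrib_left)
qed

end

text \<open>Let \<open>P\<close> and \<open>Q\<close> be the points with
  \<open>s * k * l > 0\<close> in the large and in the small square. The two shears map
  \<open>Q\<close> into disjoint parts of \<open>P\<close>, one where the second coordinate is
  larger in absolute value and one where the first is, so twice the mass of \<open>Q\<close> is at
  most the mass of \<open>P\<close> plus \<open>2 * e\<close>. As \<open>P\<close> exceeds
  \<open>Q\<close> by mass at most \<open>t\<close>, both masses are small. Coordinates in
  \<open>L\<close> are below m/4 in absolute value, so the images stay in the large square without
  wrapping around.\<close>

lemma ping_pong:
  fixes w :: "int \<Rightarrow> int \<Rightarrow> real" and m s :: int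
  defines "L \<equiv> {k. 4 * \<bar>k\<bar> < m}" and "R \<equiv> {k. 2 * \<bar>k\<bar> < m}"
  assumes s: "s = 1 \<or> s = - 1" and w: "\<And>k l. w k l \<ge> 0"
    and a: "(\<Sum>(k, l)\<in>L \<times> L. \<bar>w k (l + s * k) - w k l\<bar>) \<le> e"
    and b: "(\<Sum>(k, l)\<in>L \<times> L. \<bar>w (k + s * l) l - w k l\<bar>) \<le> e"
    and high: "(\<Sum>(k, l)\<in>R \<times> R - L \<times> L. w k l) \<le> t"
  shows "(\<Sum>(k, l)\<in>{(k, l) \<in> R \<times> R. s * k * l > 0}. w k l) \<le> 2 * e + 2 * t"
    "(\<Sum>(k, l)\<in>{(k, l) \<in> L \<times> L. s * k * l > 0}. w k l) \<le> 2 * e + t"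
proof -
  let ?w = "\<lambda>(k, l). w k l"
  have "R \<subseteq> {-m..m}" by (auto simp: R_def)
  then have finR: "finite R" by (rule finite_subset) simp
  have LR: "L \<subseteq> R" by (auto simp: L_def R_def)
  then have finL: "finite L" using finR by (rule finite_subset)
  let ?P = "{(k, l) \<in> R \<times> R. s * k * l > 0}" and ?Q = "{(k, l) \<in> L \<times> L. s * k * l > 0}"
  have fin: "finite ?P" "finite ?Q"
    by (rule finite_subset[of _ "R \<times> R"]; use finR in auto)
       (rule finite_subset[of _ "L \<times> L"]; use finL in auto)
  let ?a = "\<lambda>(k, l). (k, l + s * k)" and ?b = "\<lambda>(k, l). (k + s * l, l)"
  have ss: "s * s = 1" using s by auto
  have aP: "?a ` ?Q \<subseteq> {(k, l) \<in> ?P. \<bar>k\<bar> < \<bar>l\<bar>}"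
  proof clarify
    fix k l assume "k \<in> L" "l \<in> L" and pos: "s * k * l > 0"
    then have kl: "4 * \<bar>k\<bar> < m" "4 * \<bar>l\<bar> < m" by (auto simp: L_def)
    have "k \<noteq> 0" "l \<noteq> 0" using pos by auto
    have "s * k * (l + s * k) = s * k * l + k * k" using ss by (simp add: algebra_simps)
    moreover have "k * k \<ge> 0" by simp
    ultimately have 1: "s * k * (l + s * k) > 0" using pos by linarith
    have "\<bar>k\<bar> < \<bar>l + s * k\<bar>"
      using s pos \<open>k \<noteq> 0\<close> \<open>l \<noteq> 0\<close> by (auto simp: zero_less_mult_iff abs_if mult_less_0_iff)
    moreover have "2 * \<bar>k\<bar> < m" "2 * \<bar>l + s * k\<bar> < m"
      using s kl abs_triangle_ineq[of l k] abs_triangle_ineq4[of l k] by auto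
    ultimately show "(k, l + s * k) \<in> ?P \<and> \<bar>k\<bar> < \<bar>l + s * k\<bar>" using 1 by (auto simp: R_def)
  qed
  have bP: "?b ` ?Q \<subseteq> {(k, l) \<in> ?P. \<bar>l\<bar> < \<bar>k\<bar>}"
  proof clarify
    fix k l assume "k \<in> L" "l \<in> L" and pos: "s * k * l > 0"
    then have kl: "4 * \<bar>k\<bar> < m" "4 * \<bar>l\<bar> < m" by (auto simp: L_def)
    have "k \<noteq> 0" "l \<noteq> 0" using pos by auto
    have "s * (k + s * l) * l = s * k * l + l * l" using ss by (simp add: algebra_simps)
    moreover have "l * l \<ge> 0" by simp
    ultimately have 1: "s * (k + s * l) * l > 0" using pos by linarith
    have "\<bar>l\<bar> < \<bar>k + s * l\<bar>"
      using s pos \<open>k \<noteq> 0\<close> \<open>l \<noteq> 0\<close> by (auto simp: zero_less_mult_iff abs_if mult_less_0_iff)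
    moreover have "2 * \<bar>l\<bar> < m" "2 * \<bar>k + s * l\<bar> < m"
      using s kl abs_triangle_ineq[of k l] abs_triangle_ineq4[of k l] by auto
    ultimately show "(k + s * l, l) \<in> ?P \<and> \<bar>l\<bar> < \<bar>k + s * l\<bar>" using 1 by (auto simp: R_def)
  qed
  have "sum ?w ?Q - sum ?w (?a ` ?Q) \<le> e"
  proof -
    have inj: "inj_on ?a ?Q" by (auto simp: inj_on_def)
    have "sum ?w ?Q - sum ?w (?a ` ?Q) = (\<Sum>(k, l)\<in>?Q. w k l - w k (l + s * k))"
      unfolding sum.reindex[OF inj] by (simp add: sum_subtractf case_prod_beta)
    also have "\<dots> \<le> (\<Sum>(k, l)\<in>?Q. \<bar>w k (l + s * k) - w k l\<bar>)" by (intro sum_mono) auto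
    also have "\<dots> \<le> (\<Sum>(k, l)\<in>L \<times> L. \<bar>w k (l + s * k) - w k l\<bar>)"
      using finL by (intro sum_mono2) auto
    finally show ?thesis using a by simp
  qed
  moreover have "sum ?w ?Q - sum ?w (?b ` ?Q) \<le> e"
  proof -
    have inj: "inj_on ?b ?Q" by (auto simp: inj_on_def)
    have "sum ?w ?Q - sum ?w (?b ` ?Q) = (\<Sum>(k, l)\<in>?Q. w k l - w (k + s * l) l)"
      unfolding sum.reindex[OF inj] by (simp add: sum_subtractf case_prod_beta)
    also have "\<dots> \<le> (\<Sum>(k, l)\<in>?Q. \<bar>w (k + s * l) l - w k l\<bar>)" by (intro sum_mono) auto
    also have "\<dots> \<le> (\<Sum>(k, l)\<in>L \<times> L. \<bar>w (k + s * l) l - w k l\<bar>)"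
      using finL by (intro sum_mono2) auto
    finally show ?thesis using b by simp
  qed
  moreover have "sum ?w (?a ` ?Q) + sum ?w (?b ` ?Q) \<le> sum ?w ?P"
  proof -
    have "?a ` ?Q \<inter> ?b ` ?Q = {}" using aP bP by fastforce
    then have "sum ?w (?a ` ?Q) + sum ?w (?b ` ?Q) = sum ?w (?a ` ?Q \<union> ?b ` ?Q)"
      using fin by (subst sum.union_disjoint) auto
    also have "\<dots> \<le> sum ?w ?P" using aP bP fin w by (intro sum_mono2) auto
    finally show ?thesis .
  qed
  moreover have "sum ?w ?P \<le> sum ?w ?Q + t"
  proof -
    have "sum ?w ?P \<le> sum ?w (?Q \<union> (R \<times> R - L \<times> L))"
      using fin finR w by (intro sum_mono2) auto
    also have "\<dots> = sum ?w ?Q + sum ?w (R \<times> R - L \<times> L)"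
      using fin finR by (intro sum.union_disjoint) auto
    finally show ?thesis using high by simp
  qed
  ultimately show "sum ?w ?P \<le> 2 * e + 2 * t" "sum ?w ?Q \<le> 2 * e + t" by linarith+
qed


text \<open>Here \<open>f\<close> is the indicator of a nonempty set of density at most 1/2 that two
  shears and two unit translations hardly move. Its normalised power spectrum \<open>w\<close> has
  total mass 1. Near invariance under the translations leaves little mass at high frequencies, and
  near invariance under the shears leaves little in the quadrants and on the axes. Together with the
  mass at the origin this does not add up to 1.\<close>

lemma torus_expansion:
  fixes m :: int and f :: "int \<Rightarrow> int \<Rightarrow> real"
  assumes m: "m > 0"
    and per: "\<And>x y. f (x + m) y = f x y" "\<And>x y. f x (y + m) = f x y"
    and f01: "\<And>x y. f x y = 0 \<or> f x y = 1"
  defines "S \<equiv> \<Sum>x\<in>{0..<m}. \<Sum>y\<in>{0..<m}. f x y"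
  assumes S: "0 < S" "2 * S \<le> (of_int m)\<^sup>2"
    and T: "(\<Sum>x\<in>{0..<m}. \<Sum>y\<in>{0..<m}. (f (x - y) y - f x y)\<^sup>2) \<le> S / 2500"
      "(\<Sum>x\<in>{0..<m}. \<Sum>y\<in>{0..<m}. (f x (y - x) - f x y)\<^sup>2) \<le> S / 2500"
      "(\<Sum>x\<in>{0..<m}. \<Sum>y\<in>{0..<m}. (f (x - 1) y - f x y)\<^sup>2) \<le> S / 2500"
      "(\<Sum>x\<in>{0..<m}. \<Sum>y\<in>{0..<m}. (f x (y - 1) - f x y)\<^sup>2) \<le> S / 2500"
  shows False
proof -
  let ?W = "{0..<m}"
  define M where "M = (of_int m :: real)\<^sup>2 * S"
  have M: "M > 0" using m S by (simp add: M_def)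
  define F where "F = fourier m (\<lambda>x y. complex_of_real (f x y))"
  define w where "w k l = (cmod (F k l))\<^sup>2 / M" for k l
  have w0: "w k l \<ge> 0" for k l using M by (simp add: w_def)
  have Fper: "F (k + m) l = F k l" "F k (l + m) = F k l" for k l
    using fourier_periodic[OF m] by (simp_all add: F_def)
  then have wper: "w (k + m) l = w k l" "w k (l + m) = w k l" for k l
    by (simp_all add: w_def)
  have bound: "(\<Sum>k\<in>?W. \<Sum>l\<in>?W. (cmod (fourier m (\<lambda>x y. complex_of_real (g x y)) k l - F k l))\<^sup>2) \<le> M / 2500"
    if "(\<Sum>x\<in>?W. \<Sum>y\<in>?W. (g x y - f x y)\<^sup>2) \<le> S / 2500" for g
  proof -
    have "(\<Sum>k\<in>?W. \<Sum>l\<in>?W. (cmod (fourier m (\<lambda>x y. complex_of_real (g x y)) k l - F k l))\<^sup>2) =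
        (of_int m)\<^sup>2 * (\<Sum>x\<in>?W. \<Sum>y\<in>?W. (g x y - f x y)\<^sup>2)"
      unfolding F_def fourier_diff[symmetric] fourier_parseval[OF m]
      by (simp flip: of_real_diff)
    also have "\<dots> \<le> (of_int m)\<^sup>2 * (S / 2500)" using that by (rule mult_left_mono) simp
    finally show ?thesis by (simp add: M_def)
  qed
  have pc: "complex_of_real (f (x + m) y) = complex_of_real (f x y)"
    "complex_of_real (f x (y + m)) = complex_of_real (f x y)" for x y
    using per by simp_all
  have "(\<Sum>x\<in>?W. \<Sum>y\<in>?W. (f x y)\<^sup>2) = S"
    unfolding S_def by (intro sum.cong refl) (use f01 in \<open>force simp: power2_eq_square\<close>)
  then have "(\<Sum>k\<in>?W. \<Sum>l\<in>?W. (cmod (F k l))\<^sup>2) = M"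
    unfolding F_def fourier_parseval[OF m] by (simp add: M_def)
  then have w1: "(\<Sum>k\<in>?W. \<Sum>l\<in>?W. w k l) = 1"
    using M by (simp add: w_def flip: sum_divide_distrib)
  have F00: "F 0 0 = complex_of_real S" by (simp add: F_def fourier_def S_def)
  \<comment> \<open>The mass at the origin is the density of the set, \<open>S\<close> divided by
    the square of \<open>m\<close>.\<close>
  have "w 0 0 \<le> 1 / 2"
    using S m by (simp add: w_def F00 M_def power2_eq_square field_simps)
  define near where "near h \<longleftrightarrow> (\<Sum>k\<in>?W. \<Sum>l\<in>?W. \<bar>h k l - w k l\<bar>) \<le> 1 / 25" for h
  have near: "near (\<lambda>k l. (cmod (G k l))\<^sup>2 / M)"
    if G: "(\<Sum>k\<in>?W. \<Sum>l\<in>?W. (cmod (G k l - F k l))\<^sup>2) \<le> M / 2500"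
      and GM: "(\<Sum>k\<in>?W. \<Sum>l\<in>?W. (cmod (G k l))\<^sup>2) = M" for G
  proof -
    \<comment> \<open>A weighted inequality between products and squares. With these weights both
      terms sum to at most \<open>M / 50\<close>, which yields the distance 1/25 in
      \<open>near\<close>.\<close>
    have pt: "\<bar>(cmod u)\<^sup>2 - (cmod v)\<^sup>2\<bar> \<le> 50 * (cmod (u - v))\<^sup>2 + ((cmod u)\<^sup>2 + (cmod v)\<^sup>2) / 100" for u v
    proof -
      have "\<bar>(cmod u)\<^sup>2 - (cmod v)\<^sup>2\<bar> = \<bar>cmod u - cmod v\<bar> * (cmod u + cmod v)"
        by (simp add: power2_eq_square square_diff_square_factored abs_mult)
      also have "\<dots> \<le> cmod (u - v) * (cmod u + cmod v)"
        by (intro mult_right_mono norm_triangle_ineq3) simp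
      also have "\<dots> \<le> 50 * (cmod (u - v))\<^sup>2 + (cmod u + cmod v)\<^sup>2 / 200"
      proof -
        have "x * y \<le> 50 * x\<^sup>2 + y\<^sup>2 / 200" for x y :: real
          using zero_le_power2[of "100 * x - y"] by (simp add: power2_diff power_mult_distrib)
        then show ?thesis .
      qed
      also have "(cmod u + cmod v)\<^sup>2 / 200 \<le> ((cmod u)\<^sup>2 + (cmod v)\<^sup>2) / 100"
        using zero_le_power2[of "cmod u - cmod v"] by (simp add: power2_diff power2_sum)
      finally show ?thesis by simp
    qed
    have "(\<Sum>k\<in>?W. \<Sum>l\<in>?W. \<bar>(cmod (G k l))\<^sup>2 - (cmod (F k l))\<^sup>2\<bar>) \<le>
        (\<Sum>k\<in>?W. \<Sum>l\<in>?W. 50 * (cmod (G k l - F k l))\<^sup>2 +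
          ((cmod (G k l))\<^sup>2 + (cmod (F k l))\<^sup>2) / 100)"
      by (intro sum_mono pt)
    also have "\<dots> = 50 * (\<Sum>k\<in>?W. \<Sum>l\<in>?W. (cmod (G k l - F k l))\<^sup>2) +
        ((\<Sum>k\<in>?W. \<Sum>l\<in>?W. (cmod (G k l))\<^sup>2) + (\<Sum>k\<in>?W. \<Sum>l\<in>?W. (cmod (F k l))\<^sup>2)) / 100"
      by (simp add: sum.distrib flip: sum_distrib_left sum_divide_distrib)
    also have "\<dots> \<le> M / 25"
      using G GM \<open>(\<Sum>k\<in>?W. \<Sum>l\<in>?W. (cmod (F k l))\<^sup>2) = M\<close> by simp
    finally have "(\<Sum>k\<in>?W. \<Sum>l\<in>?W. \<bar>(cmod (G k l))\<^sup>2 - (cmod (F k l))\<^sup>2\<bar>) / M \<le> 1 / 25"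
      using M by (simp add: field_simps)
    moreover have "\<bar>(cmod (G k l))\<^sup>2 / M - w k l\<bar> = \<bar>(cmod (G k l))\<^sup>2 - (cmod (F k l))\<^sup>2\<bar> / M" for k l
      using M by (simp add: w_def flip: diff_divide_distrib)
    ultimately show ?thesis by (simp add: near_def sum_divide_distrib)
  qed
  have shift_l: "(\<Sum>k\<in>?W. \<Sum>l\<in>?W. h k (l + c k)) = (\<Sum>k\<in>?W. \<Sum>l\<in>?W. h k l)"
    if "\<And>k l. h k (l + m) = h k l" for h :: "int \<Rightarrow> int \<Rightarrow> real" and c
    by (intro sum.cong refl sum_periodic_shift[of "\<lambda>l. h k l" m for k, OF that m])
  have shift_k: "(\<Sum>k\<in>?W. \<Sum>l\<in>?W. h (k + c l) l) = (\<Sum>k\<in>?W. \<Sum>l\<in>?W. h k l)"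
    if "\<And>k l. h (k + m) l = h k l" for h :: "int \<Rightarrow> int \<Rightarrow> real" and c
  proof -
    have "(\<Sum>l\<in>?W. \<Sum>k\<in>?W. h (k + c l) l) = (\<Sum>l\<in>?W. \<Sum>k\<in>?W. h k l)"
      by (intro sum.cong refl sum_periodic_shift[of "\<lambda>k. h k l" m for l, OF that m])
    then show ?thesis by (subst (1 2) sum.swap)
  qed
  have a1: "near (\<lambda>k l. w k (l + 1 * k))"
  proof -
    have "fourier m (\<lambda>x y. complex_of_real (f (x - y) y)) k l = F k (l + k)" for k l
      using fourier_shift1[of m "\<lambda>x y. complex_of_real (f x y)" 1 0, OF m pc] by (simp add: F_def)
    with bound[OF T(1)] have "(\<Sum>k\<in>?W. \<Sum>l\<in>?W. (cmod (F k (l + k) - F k l))\<^sup>2) \<le> M / 2500" by simp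
    moreover have "(\<Sum>k\<in>?W. \<Sum>l\<in>?W. (cmod (F k (l + k)))\<^sup>2) = M"
      using shift_l[of "\<lambda>k l. (cmod (F k l))\<^sup>2" "\<lambda>k. k"] Fper
        \<open>(\<Sum>k\<in>?W. \<Sum>l\<in>?W. (cmod (F k l))\<^sup>2) = M\<close> by simp
    ultimately show ?thesis using near[of "\<lambda>k l. F k (l + k)"] by (simp add: w_def)
  qed
  have b1: "near (\<lambda>k l. w (k + 1 * l) l)"
  proof -
    have "fourier m (\<lambda>x y. complex_of_real (f x (y - x))) k l = F (k + l) l" for k l
      using fourier_shift2[of m "\<lambda>x y. complex_of_real (f x y)" 1 0, OF m pc] by (simp add: F_def)
    with bound[OF T(2)] have "(\<Sum>k\<in>?W. \<Sum>l\<in>?W. (cmod (F (k + l) l - F k l))\<^sup>2) \<le> M / 2500" by simp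
    moreover have "(\<Sum>k\<in>?W. \<Sum>l\<in>?W. (cmod (F (k + l) l))\<^sup>2) = M"
      using shift_k[of "\<lambda>k l. (cmod (F k l))\<^sup>2" "\<lambda>k. k"] Fper
        \<open>(\<Sum>k\<in>?W. \<Sum>l\<in>?W. (cmod (F k l))\<^sup>2) = M\<close> by simp
    ultimately show ?thesis using near[of "\<lambda>k l. F (k + l) l"] by (simp add: w_def)
  qed
  \<comment> \<open>After reindexing, the inverse shear moves \<open>w\<close> by the same amount as
    the shear. It serves the quadrants with \<open>s = - 1\<close>.\<close>
  have a2: "near (\<lambda>k l. w k (l + - 1 * k))"
  proof -
    have "w k (l + m + k) = w k (l + k)" for k l using wper(2)[of k "l + k"] by (simp add: algebra_simps)
    then show ?thesis
      using a1 shift_l[of "\<lambda>k l. \<bar>w k (l + k) - w k l\<bar>" "\<lambda>k. - k"] wper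
      by (simp add: near_def abs_minus_commute)
  qed
  have b2: "near (\<lambda>k l. w (k + - 1 * l) l)"
  proof -
    have "w (k + m + l) l = w (k + l) l" for k l using wper(1)[of "k + l" l] by (simp add: algebra_simps)
    then show ?thesis
      using b1 shift_k[of "\<lambda>k l. \<bar>w (k + l) l - w k l\<bar>" "\<lambda>k. - k"] wper
      by (simp add: near_def abs_minus_commute)
  qed
  \<comment> \<open>A full period centred at 0: every frequency is represented by a residue of least
    absolute value, so that signs and quadrants make sense.\<close>
  define V where "V = {- (m div 2)..<- (m div 2) + m}"
  have window: "(\<Sum>k\<in>?W. \<Sum>l\<in>?W. h k l) = (\<Sum>(k, l)\<in>V \<times> V. h k l)"
    if "\<And>k l. h (k + m) l = h k l" "\<And>k l. h k (l + m) = h k l" for h :: "int \<Rightarrow> int \<Rightarrow> real"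
  proof -
    have "(\<Sum>k\<in>?W. \<Sum>l\<in>?W. h k l) = (\<Sum>k\<in>?W. \<Sum>l\<in>V. h k l)"
      unfolding V_def by (intro sum.cong refl sum_periodic_window[of "\<lambda>l. h k l" m for k, OF that(2) m, symmetric])
    also have "\<dots> = (\<Sum>l\<in>V. \<Sum>k\<in>?W. h k l)" by (rule sum.swap)
    also have "\<dots> = (\<Sum>l\<in>V. \<Sum>k\<in>V. h k l)"
      unfolding V_def
      by (intro sum.cong refl sum_periodic_window[of "\<lambda>k. h k l" m for l, OF that(1) m, symmetric])
    also have "\<dots> = (\<Sum>k\<in>V. \<Sum>l\<in>V. h k l)" by (rule sum.swap)
    finally show ?thesis by (simp add: sum.cartesian_product)
  qed
  define L where "L = {k. 4 * \<bar>k\<bar> < m}"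
  define R where "R = {k. 2 * \<bar>k\<bar> < m}"
  have finV: "finite V" by (simp add: V_def)
  have LV: "L \<subseteq> R" "R \<subseteq> V"
  proof -
    show "L \<subseteq> R" by (auto simp: L_def R_def)
    show "R \<subseteq> V" unfolding R_def V_def by clarsimp presburger
  qed
  have finL: "finite L" using LV finV by (meson finite_subset)
  have nearL: "(\<Sum>(k, l)\<in>L \<times> L. \<bar>h k l - w k l\<bar>) \<le> 1 / 25"
    if "near h" "\<And>k l. h (k + m) l = h k l" "\<And>k l. h k (l + m) = h k l" for h
  proof -
    have "(\<Sum>(k, l)\<in>L \<times> L. \<bar>h k l - w k l\<bar>) \<le> (\<Sum>(k, l)\<in>V \<times> V. \<bar>h k l - w k l\<bar>)"
      using LV finV by (intro sum_mono2) auto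
    also have "\<dots> = (\<Sum>k\<in>?W. \<Sum>l\<in>?W. \<bar>h k l - w k l\<bar>)"
      by (rule window[symmetric]) (simp_all add: that wper)
    finally show ?thesis using that(1) by (simp add: near_def)
  qed
  have wa: "w (k + m) (l + c * (k + m)) = w k (l + c * k)"
    "w k (l + m + c * k) = w k (l + c * k)" for k l c
    using wper periodic_mult[of "\<lambda>l. w k l" m "l + c * k" c, OF wper(2)] wper(2)[of k "l + c * k"]
    by (simp_all add: algebra_simps)
  have wb: "w (k + c * (l + m)) (l + m) = w (k + c * l) l"
    "w (k + m + c * l) l = w (k + c * l) l" for k l c
    using wper periodic_mult[of "\<lambda>k. w k l" m "k + c * l" c, OF wper(1)] wper(1)[of "k + c * l" l]
    by (simp_all add: algebra_simps)
  have a: "(\<Sum>(k, l)\<in>L \<times> L. \<bar>w k (l + s * k) - w k l\<bar>) \<le> 1 / 25"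
    "(\<Sum>(k, l)\<in>L \<times> L. \<bar>w (k + s * l) l - w k l\<bar>) \<le> 1 / 25" if "s = 1 \<or> s = - 1" for s
    using that nearL[OF a1 wa] nearL[OF a2 wa] nearL[OF b1 wb(2) wb(1)] nearL[OF b2 wb(2) wb(1)]
    by auto
  \<comment> \<open>The angle of \<open>chi m k\<close> lies between pi/2 and pi in absolute value,
    so its cosine is not positive.\<close>
  have dist: "(cmod (chi m k - 1))\<^sup>2 \<ge> 2" if "k \<in> V" "k \<notin> L" for k
  proof -
    let ?t = "2 * pi * of_int \<bar>k\<bar> / of_int m"
    have k: "m \<le> 4 * \<bar>k\<bar>" "2 * \<bar>k\<bar> \<le> m" using that by (auto simp: V_def L_def)
    then have "of_int m \<le> 4 * (of_int \<bar>k\<bar> :: real)" "2 * (of_int \<bar>k\<bar> :: real) \<le> of_int m" by linarith+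
    then have "pi / 2 \<le> ?t" "?t \<le> pi"
      using m pi_gt_zero by (simp_all add: field_simps)
    then have "cos ?t \<le> 0" using cos_monotone_0_pi_le[of "pi / 2" ?t] by simp
    moreover have "cos (2 * pi * of_int k / of_int m) = cos ?t"
      by (cases "k \<ge> 0") (simp_all add: abs_if)
    moreover have "(cmod (cis u - 1))\<^sup>2 = 2 - 2 * cos u" for u
    proof -
      have "(cmod (cis u - 1))\<^sup>2 = (cos u - 1)\<^sup>2 + (sin u)\<^sup>2"
        unfolding cmod_power2 by simp
      then show ?thesis using sin_cos_squared_add[of u] by (simp add: power2_diff)
    qed
    ultimately show ?thesis by (simp add: chi_def)
  qed
  have chiper: "chi m (k + m) = chi m k" for k using chi_period[OF m, of m k] by simp
  have h1: "(\<Sum>(k, l)\<in>V \<times> V. (cmod (chi m k - 1))\<^sup>2 * w k l) \<le> 1 / 2500"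
  proof -
    have "fourier m (\<lambda>x y. complex_of_real (f (x - 1) y)) k l = chi m k * F k l" for k l
      using fourier_shift1[of m "\<lambda>x y. complex_of_real (f x y)" 0 1, OF m pc] by (simp add: F_def)
    moreover have "chi m k * F k l - F k l = (chi m k - 1) * F k l" for k l by (simp add: algebra_simps)
    ultimately have "(\<Sum>k\<in>?W. \<Sum>l\<in>?W. (cmod (chi m k - 1))\<^sup>2 * (cmod (F k l))\<^sup>2) \<le> M / 2500"
      using bound[OF T(3)] by (simp add: norm_mult power_mult_distrib)
    then have "(\<Sum>k\<in>?W. \<Sum>l\<in>?W. (cmod (chi m k - 1))\<^sup>2 * (cmod (F k l))\<^sup>2) / M \<le> 1 / 2500"
      using M by (simp add: field_simps)
    then have "(\<Sum>k\<in>?W. \<Sum>l\<in>?W. (cmod (chi m k - 1))\<^sup>2 * w k l) \<le> 1 / 2500"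
      by (simp add: w_def sum_divide_distrib)
    then show ?thesis using window[of "\<lambda>k l. (cmod (chi m k - 1))\<^sup>2 * w k l"] wper chiper by simp
  qed
  have h2: "(\<Sum>(k, l)\<in>V \<times> V. (cmod (chi m l - 1))\<^sup>2 * w k l) \<le> 1 / 2500"
  proof -
    have "fourier m (\<lambda>x y. complex_of_real (f x (y - 1))) k l = chi m l * F k l" for k l
      using fourier_shift2[of m "\<lambda>x y. complex_of_real (f x y)" 0 1, OF m pc] by (simp add: F_def)
    moreover have "chi m l * F k l - F k l = (chi m l - 1) * F k l" for k l by (simp add: algebra_simps)
    ultimately have "(\<Sum>k\<in>?W. \<Sum>l\<in>?W. (cmod (chi m l - 1))\<^sup>2 * (cmod (F k l))\<^sup>2) \<le> M / 2500"
      using bound[OF T(4)] by (simp add: norm_mult power_mult_distrib)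
    then have "(\<Sum>k\<in>?W. \<Sum>l\<in>?W. (cmod (chi m l - 1))\<^sup>2 * (cmod (F k l))\<^sup>2) / M \<le> 1 / 2500"
      using M by (simp add: field_simps)
    then have "(\<Sum>k\<in>?W. \<Sum>l\<in>?W. (cmod (chi m l - 1))\<^sup>2 * w k l) \<le> 1 / 2500"
      by (simp add: w_def sum_divide_distrib)
    then show ?thesis using window[of "\<lambda>k l. (cmod (chi m l - 1))\<^sup>2 * w k l"] wper chiper by simp
  qed
  \<comment> \<open>A point outside \<open>L \<times> L\<close> has a high coordinate, so by
    \<open>dist\<close> the two translation defects together give it weight at least 2.\<close>
  have highV: "(\<Sum>(k, l)\<in>V \<times> V - L \<times> L. w k l) \<le> 1 / 2500"
  proof -
    have "2 * (\<Sum>(k, l)\<in>V \<times> V - L \<times> L. w k l) = (\<Sum>(k, l)\<in>V \<times> V - L \<times> L. 2 * w k l)"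
      by (simp add: sum_distrib_left case_prod_beta)
    also have "\<dots> \<le> (\<Sum>(k, l)\<in>V \<times> V - L \<times> L.
        (cmod (chi m k - 1))\<^sup>2 * w k l + (cmod (chi m l - 1))\<^sup>2 * w k l)"
    proof (rule sum_mono)
      fix z assume "z \<in> V \<times> V - L \<times> L"
      then obtain k l where kl: "z = (k, l)" "k \<in> V" "l \<in> V" "(k, l) \<notin> L \<times> L" by auto
      then have "2 \<le> (cmod (chi m k - 1))\<^sup>2 + (cmod (chi m l - 1))\<^sup>2"
        using dist[of k] dist[of l] by (cases "k \<in> L") (auto intro: add_increasing add_increasing2)
      then have "2 * w k l \<le> ((cmod (chi m k - 1))\<^sup>2 + (cmod (chi m l - 1))\<^sup>2) * w k l"
        using w0 by (intro mult_right_mono) auto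
      then show "(case z of (k, l) \<Rightarrow> 2 * w k l) \<le>
          (case z of (k, l) \<Rightarrow> (cmod (chi m k - 1))\<^sup>2 * w k l + (cmod (chi m l - 1))\<^sup>2 * w k l)"
        by (simp add: distrib_right kl)
    qed
    also have "\<dots> \<le> (\<Sum>(k, l)\<in>V \<times> V.
        (cmod (chi m k - 1))\<^sup>2 * w k l + (cmod (chi m l - 1))\<^sup>2 * w k l)"
      using finV w0 by (intro sum_mono2) auto
    also have "\<dots> \<le> 1 / 1250" using h1 h2 by (simp add: sum.distrib case_prod_beta)
    finally show ?thesis by simp
  qed
  have high: "(\<Sum>(k, l)\<in>R \<times> R - L \<times> L. w k l) \<le> 1 / 2500"
    by (rule order_trans[OF sum_mono2 highV]) (use LV finV w0 in auto)
  note pp = ping_pong[of _ w m "1 / 25" "1 / 2500", folded L_def R_def, OF _ w0 a high]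
  let ?w = "\<lambda>(k, l). w k l"
  define P where "P s = {(k, l) \<in> R \<times> R. s * k * l > 0}" for s :: int
  define Q where "Q s = {(k, l) \<in> L \<times> L. s * k * l > 0}" for s :: int
  \<comment> \<open>The two axes without the origin lie in no quadrant. One shear carries each of
    them to the diagonal, which is inside \<open>P 1\<close>.\<close>
  define X where "X = (L - {0}) \<times> {0 :: int}"
  define Y where "Y = {0 :: int} \<times> (L - {0})"
  have PQ: "sum ?w (P 1) \<le> 2 / 25 + 2 / 2500" "sum ?w (Q 1) \<le> 2 / 25 + 1 / 2500"
    "sum ?w (Q (- 1)) \<le> 2 / 25 + 1 / 2500"
    using pp[of 1] pp[of "- 1"] unfolding P_def Q_def by auto
  have finR: "finite R" using LV finV by (meson finite_subset)
  have finP: "finite (P 1)" "finite (Q s)" for s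
    by (rule finite_subset[of _ "R \<times> R"]; use finR LV in \<open>auto simp: P_def Q_def\<close>)+
  have X: "sum ?w X \<le> sum ?w (P 1) + 1 / 25"
  proof -
    let ?g = "\<lambda>(k, l). (k, l + 1 * k) :: int \<times> int"
    have inj: "inj_on ?g X" by (auto simp: inj_on_def)
    have "sum ?w X = sum ?w (?g ` X) + (\<Sum>(k, l)\<in>X. w k l - w k (l + 1 * k))"
      unfolding sum.reindex[OF inj] by (simp add: case_prod_beta sum_subtractf)
    moreover have "(\<Sum>(k, l)\<in>X. w k l - w k (l + 1 * k)) \<le> (\<Sum>(k, l)\<in>X. \<bar>w k (l + 1 * k) - w k l\<bar>)"
      by (intro sum_mono) auto
    moreover have "\<dots> \<le> (\<Sum>(k, l)\<in>L \<times> L. \<bar>w k (l + 1 * k) - w k l\<bar>)"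
      using finL m by (intro sum_mono2) (auto simp: X_def L_def)
    moreover have "sum ?w (?g ` X) \<le> sum ?w (P 1)"
      using finP w0 LV by (intro sum_mono2) (auto simp: X_def P_def zero_less_mult_iff)
    ultimately show ?thesis using a(1)[of 1] by linarith
  qed
  have Y: "sum ?w Y \<le> sum ?w (P 1) + 1 / 25"
  proof -
    let ?g = "\<lambda>(k, l). (k + 1 * l, l) :: int \<times> int"
    have inj: "inj_on ?g Y" by (auto simp: inj_on_def)
    have "sum ?w Y = sum ?w (?g ` Y) + (\<Sum>(k, l)\<in>Y. w k l - w (k + 1 * l) l)"
      unfolding sum.reindex[OF inj] by (simp add: case_prod_beta sum_subtractf)
    moreover have "(\<Sum>(k, l)\<in>Y. w k l - w (k + 1 * l) l) \<le> (\<Sum>(k, l)\<in>Y. \<bar>w (k + 1 * l) l - w k l\<bar>)"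
      by (intro sum_mono) auto
    moreover have "\<dots> \<le> (\<Sum>(k, l)\<in>L \<times> L. \<bar>w (k + 1 * l) l - w k l\<bar>)"
      using finL m by (intro sum_mono2) (auto simp: Y_def L_def)
    moreover have "sum ?w (?g ` Y) \<le> sum ?w (P 1)"
      using finP w0 LV by (intro sum_mono2) (auto simp: Y_def P_def zero_less_mult_iff)
    ultimately show ?thesis using a(2)[of 1] by linarith
  qed
  have "(\<Sum>(k, l)\<in>V \<times> V. w k l) = sum ?w (V \<times> V - L \<times> L) + sum ?w (L \<times> L)"
    using LV finV by (intro sum.subset_diff) auto
  then have "1 \<le> 1 / 2500 + sum ?w (L \<times> L)"
    using highV w1 window[of w, OF wper] by simp
  moreover have "sum ?w (L \<times> L) \<le> w 0 0 + sum ?w X + sum ?w Y + sum ?w (Q 1) + sum ?w (Q (- 1))"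
  proof -
    have fin: "finite X" "finite Y" using finL by (auto simp: X_def Y_def)
    have un: "sum ?w (A \<union> B) \<le> sum ?w A + sum ?w B" if "finite A" "finite B" for A B
      using sum.union_inter[OF that, of ?w] w0 by (simp add: sum_nonneg case_prod_beta)
        (smt (verit, best) sum_nonneg w0)
    have "L \<times> L \<subseteq> {(0, 0)} \<union> X \<union> Y \<union> Q 1 \<union> Q (- 1)"
    proof
      fix z assume "z \<in> L \<times> L"
      then obtain k l where kl: "z = (k, l)" "k \<in> L" "l \<in> L" by auto
      then show "z \<in> {(0, 0)} \<union> X \<union> Y \<union> Q 1 \<union> Q (- 1)"
        by (cases "k = 0"; cases "l = 0")
          (auto simp: X_def Y_def Q_def zero_less_mult_iff mult_less_0_iff)
    qed
    then have "sum ?w (L \<times> L) \<le> sum ?w ({(0, 0)} \<union> X \<union> Y \<union> Q 1 \<union> Q (- 1))"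
      using fin finP w0 by (intro sum_mono2) auto
    also have "\<dots> \<le> sum ?w {(0, 0)} + sum ?w X + sum ?w Y + sum ?w (Q 1) + sum ?w (Q (- 1))"
      using fin finP by (intro order_trans[OF un] add_mono) auto
    finally show ?thesis by simp
  qed
  \<comment> \<open>The bounds add up to 1/2 + 10/25 + 7/2500, which is less than 1.\<close>
  ultimately show False using X Y PQ \<open>w 0 0 \<le> 1 / 2\<close> by linarith
qed

section \<open>The expander on natural numbers\<close>

text \<open>The number \<open>z\<close> encodes the point \<open>(z div m, z mod m)\<close> of the
  torus. Its successors are itself and its images under two shears and two unit translations, all in
  the forward direction only.\<close>

definition step :: "nat \<Rightarrow> nat \<Rightarrow> nat set" where
  "step m z = {z,
     (z div m + z mod m) mod m * m + z mod m,
     z div m * m + (z div m + z mod m) mod m,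
     (z div m + 1) mod m * m + z mod m,
     z div m * m + (z mod m + 1) mod m}"

fun reach :: "nat \<Rightarrow> nat \<Rightarrow> nat \<Rightarrow> nat set" where
  "reach m 0 x = {x}"
| "reach m (Suc k) x = (\<Union>z\<in>step m x. reach m k z)"

lemma code_less: "a < m \<Longrightarrow> b < k \<Longrightarrow> a * k + b < m * (k::nat)"
  using mult_le_mono1[of "Suc a" m k] by simp

lemma step_bounded:
  assumes "z < m * m" shows "step m z \<subseteq> {..<m * m}"
proof -
  have m: "m > 0" using assms by (cases m) auto
  have z: "z div m < m" "z mod m < m" using assms m by (auto simp: less_mult_imp_div_less)
  show ?thesis unfolding step_def using assms z m by (auto intro!: code_less)
qed

lemma reach_bounded: "z < m * m \<Longrightarrow> reach m k z \<subseteq> {..<m * m}"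
proof (induction k arbitrary: z)
  case (Suc k)
  then show ?case using step_bounded[of z m] by fastforce
qed auto

lemma finite_reach: "finite (reach m k z)"
  by (induction k arbitrary: z) (auto simp: step_def)

lemma card_reach: "card (reach m k z) \<le> 5 ^ k"
proof (induction k arbitrary: z)
  case (Suc k)
  have "card (step m z) \<le> 5"
    unfolding step_def by (intro order_trans[OF card_insert_le_m1]) auto
  moreover have "card (reach m (Suc k) z) \<le> (\<Sum>y\<in>step m z. card (reach m k y))"
    unfolding reach.simps by (rule card_UN_le) (simp add: step_def)
  moreover have "\<dots> \<le> card (step m z) * 5 ^ k"
    using sum_bounded_above[of "step m z" "\<lambda>y. card (reach m k y)" "5 ^ k"] Suc by simp
  ultimately show ?case by (metis (no_types) mult_le_mono1 order_trans power_Suc)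
qed simp

lemma reach_self: "z \<in> reach m k z"
  by (induction k) (auto simp: step_def)

text \<open>Otherwise \<open>A\<close> and its image under each generator, which has equally many
  points, would both lie in a set of fewer than (1 + 1/5000) |A| points. They would differ in at
  most |A|/2500 points, contradicting \<open>torus_expansion\<close>.\<close>

lemma step_expansion:
  assumes A: "A \<subseteq> {..<m * m}" "2 * card A \<le> m * m"
  shows "(1 + 1 / 5000) * real (card A) \<le> card (\<Union> (step m ` A))"
proof (rule ccontr)
  assume neg: "\<not> ?thesis"
  let ?B = "\<Union> (step m ` A)" and ?W = "{0..<int m}"
  have finA: "finite A" using A(1) by (rule finite_subset) simp
  have "A \<noteq> {}" using neg by auto
  then have "m > 0" using A(1) by (cases m) auto
  have finB: "finite ?B" using finA by (auto simp: step_def)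
  \<comment> \<open>Both coordinates are reduced before encoding, so that the indicator
    \<open>f\<close> is periodic on the whole integer plane.\<close>
  define c where "c x y = nat (x mod int m) * m + nat (y mod int m)" for x y
  define f :: "int \<Rightarrow> int \<Rightarrow> real" where "f x y = of_bool (c x y \<in> A)" for x y
  have cW: "c x y = nat x * m + nat y" if "x \<in> ?W" "y \<in> ?W" for x y
    using that by (simp add: c_def)
  have cdm: "c x y div m = nat (x mod int m)" "c x y mod m = nat (y mod int m)" for x y
  proof -
    have "nat (y mod int m) < m" using \<open>m > 0\<close> by (simp add: nat_less_iff)
    then show "c x y div m = nat (x mod int m)" "c x y mod m = nat (y mod int m)"
      by (simp_all add: c_def)
  qed
  have inj: "inj_on (\<lambda>(x, y). c x y) (?W \<times> ?W)"
  proof (rule inj_onI, clarify)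
    fix x y x' y' assume "x \<in> ?W" "y \<in> ?W" "x' \<in> ?W" "y' \<in> ?W" "c x y = c x' y'"
    then show "x = x' \<and> y = y'" using cdm[of x y] cdm[of x' y'] by auto
  qed
  have card: "(\<Sum>x\<in>?W. \<Sum>y\<in>?W. of_bool (c x y \<in> X)) = real (card {(x, y) \<in> ?W \<times> ?W. c x y \<in> X})" for X
  proof -
    have "(\<Sum>x\<in>?W. \<Sum>y\<in>?W. of_bool (c x y \<in> X)) = (\<Sum>(x, y)\<in>?W \<times> ?W. of_bool (c x y \<in> X) :: real)"
      by (rule sum.cartesian_product)
    also have "\<dots> = real (card {p \<in> ?W \<times> ?W. case p of (x, y) \<Rightarrow> c x y \<in> X})"
      by (simp add: case_prod_beta sum.inter_filter[symmetric] of_bool_def)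
    also have "{p \<in> ?W \<times> ?W. case p of (x, y) \<Rightarrow> c x y \<in> X} = {(x, y) \<in> ?W \<times> ?W. c x y \<in> X}" by auto
    finally show ?thesis .
  qed
  have le: "(\<Sum>x\<in>?W. \<Sum>y\<in>?W. of_bool (c x y \<in> X)) \<le> real (card X)" if "finite X" for X
    unfolding card of_nat_le_iff
    by (rule card_inj_on_le[OF inj_on_subset[OF inj]]) (use that in auto)
  have S: "(\<Sum>x\<in>?W. \<Sum>y\<in>?W. f x y) = card A"
  proof -
    have "bij_betw (\<lambda>(x, y). c x y) {(x, y) \<in> ?W \<times> ?W. c x y \<in> A} A"
      unfolding bij_betw_def
    proof
      show "inj_on (\<lambda>(x, y). c x y) {(x, y) \<in> ?W \<times> ?W. c x y \<in> A}"
        by (rule inj_on_subset[OF inj]) auto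
      show "(\<lambda>(x, y). c x y) ` {(x, y) \<in> ?W \<times> ?W. c x y \<in> A} = A"
      proof (intro equalityI subsetI)
        fix z assume z: "z \<in> A"
        then have "z div m < m" "z mod m < m" using A(1) \<open>m > 0\<close> by (auto simp: less_mult_imp_div_less)
        then have "int (z div m) \<in> ?W" "int (z mod m) \<in> ?W" by auto
        moreover from this have "c (int (z div m)) (int (z mod m)) = z" by (simp only: cW nat_int) simp
        ultimately show "z \<in> (\<lambda>(x, y). c x y) ` {(x, y) \<in> ?W \<times> ?W. c x y \<in> A}"
          using z by (intro image_eqI[of _ _ "(int (z div m), int (z mod m))"]) auto
      qed auto
    qed
    then show ?thesis unfolding f_def card using bij_betw_same_card by fastforce
  qed
  have per: "f (x + int m) y = f x y" "f x (y + int m) = f x y" for x y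
    by (simp_all add: f_def c_def)
  have bound: "(\<Sum>x\<in>?W. \<Sum>y\<in>?W. (g x y - f x y)\<^sup>2) \<le> card A / 2500"
    if g: "\<And>x y. g x y = 0 \<or> g x y = 1" "(\<Sum>x\<in>?W. \<Sum>y\<in>?W. g x y) = card A"
      "\<And>x y. x \<in> ?W \<Longrightarrow> y \<in> ?W \<Longrightarrow> g x y = 1 \<Longrightarrow> c x y \<in> ?B" for g :: "int \<Rightarrow> int \<Rightarrow> real"
  proof -
    \<comment> \<open>Both indicators are dominated by that of \<open>?B\<close>. The right-hand
      side is 0 where both are 1 and 1 where exactly one is.\<close>
    have "(g x y - f x y)\<^sup>2 \<le> 2 * of_bool (c x y \<in> ?B) - f x y - g x y" if "x \<in> ?W" "y \<in> ?W" for x y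
    proof -
      have "A \<subseteq> ?B" by (auto simp: step_def)
      then have "f x y = 1 \<Longrightarrow> c x y \<in> ?B" by (auto simp: f_def)
      moreover have "f x y = 0 \<or> f x y = 1" by (simp add: f_def)
      ultimately show ?thesis using g(1)[of x y] g(3)[OF that] by (elim disjE) (simp_all del: UN_iff)
    qed
    then have "(\<Sum>x\<in>?W. \<Sum>y\<in>?W. (g x y - f x y)\<^sup>2) \<le>
        (\<Sum>x\<in>?W. \<Sum>y\<in>?W. 2 * of_bool (c x y \<in> ?B) - f x y - g x y)"
      by (intro sum_mono)
    also have "\<dots> = 2 * (\<Sum>x\<in>?W. \<Sum>y\<in>?W. of_bool (c x y \<in> ?B)) - real (card A) - real (card A)"
      by (simp only: sum_subtractf S g(2) sum_distrib_left)
    also have "\<dots> \<le> 2 * real (card ?B) - 2 * card A" using le[OF finB] by linarith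
    also have "\<dots> \<le> card A / 2500" using neg by simp
    finally show ?thesis .
  qed
  have f01: "f x y = 0 \<or> f x y = 1" for x y by (simp add: f_def)
  have m0: "int m > 0" using \<open>m > 0\<close> by simp
  have swap: "(\<Sum>x\<in>?W. \<Sum>y\<in>?W. f (x + h y) y) = card A" for h
  proof -
    have "(\<Sum>x\<in>?W. \<Sum>y\<in>?W. f (x + h y) y) = (\<Sum>y\<in>?W. \<Sum>x\<in>?W. f (x + h y) y)" by (rule sum.swap)
    also have "\<dots> = (\<Sum>y\<in>?W. \<Sum>x\<in>?W. f x y)"
      by (intro sum.cong refl sum_periodic_shift[of "\<lambda>x. f x y" "int m" for y, OF per(1) m0])
    also have "\<dots> = card A" by (subst sum.swap) (rule S)
    finally show ?thesis .
  qed
  have shift: "(\<Sum>x\<in>?W. \<Sum>y\<in>?W. f x (y + h x)) = card A" for h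
  proof -
    have "(\<Sum>x\<in>?W. \<Sum>y\<in>?W. f x (y + h x)) = (\<Sum>x\<in>?W. \<Sum>y\<in>?W. f x y)"
      by (intro sum.cong refl sum_periodic_shift[of "\<lambda>y. f x y" "int m" for x, OF per(2) m0])
    then show ?thesis using S by simp
  qed
  \<comment> \<open>Turns the addition of integer residues into the natural number formulas of
    \<open>step\<close>.\<close>
  have res: "nat (x mod int m) = (nat (u mod int m) + v) mod m" if "x = u + int v" for x u v
  proof -
    have "int ((nat (u mod int m) + v) mod m) = (u mod int m + int v) mod int m"
      using m0 by (simp add: zmod_int)
    also have "\<dots> = x mod int m" using that by (simp add: mod_simps)
    finally show ?thesis by (metis nat_int)
  qed
  show False
  proof (rule torus_expansion[of "int m" f])
    show "0 < (\<Sum>x\<in>?W. \<Sum>y\<in>?W. f x y)" using S \<open>A \<noteq> {}\<close> finA by (simp add: card_gt_0_iff)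
    have "2 * card A \<le> m ^ 2" using A(2) by (simp add: power2_eq_square)
    then have "real (2 * card A) \<le> real (m ^ 2)" by (simp only: of_nat_le_iff)
    then show "2 * (\<Sum>x\<in>?W. \<Sum>y\<in>?W. f x y) \<le> (real_of_int (int m))\<^sup>2" using S by simp
    show "(\<Sum>x\<in>?W. \<Sum>y\<in>?W. (f (x - y) y - f x y)\<^sup>2) \<le> (\<Sum>x\<in>?W. \<Sum>y\<in>?W. f x y) / 2500"
      unfolding S
    proof (rule bound)
      show "(\<Sum>x\<in>?W. \<Sum>y\<in>?W. f (x - y) y) = card A" using swap[of "\<lambda>y. - y"] by simp
      fix x y assume xy: "x \<in> ?W" "y \<in> ?W" "f (x - y) y = 1"
      then have A: "c (x - y) y \<in> A" by (simp add: f_def split: if_splits)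
      have "nat (x mod int m) = (nat ((x - y) mod int m) + nat y) mod m" using xy by (intro res) auto
      then have "c x y = (c (x - y) y div m + c (x - y) y mod m) mod m * m + c (x - y) y mod m"
        unfolding cdm using xy by (simp add: c_def)
      then have "c x y \<in> step m (c (x - y) y)" unfolding step_def by blast
      with A show "c x y \<in> ?B" by blast
    qed (rule f01)
    show "(\<Sum>x\<in>?W. \<Sum>y\<in>?W. (f x (y - x) - f x y)\<^sup>2) \<le> (\<Sum>x\<in>?W. \<Sum>y\<in>?W. f x y) / 2500"
      unfolding S
    proof (rule bound)
      show "(\<Sum>x\<in>?W. \<Sum>y\<in>?W. f x (y - x)) = card A" using shift[of "\<lambda>y. - y"] by simp
      fix x y assume xy: "x \<in> ?W" "y \<in> ?W" "f x (y - x) = 1"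
      then have A: "c x (y - x) \<in> A" by (simp add: f_def split: if_splits)
      have "nat (y mod int m) = (nat ((y - x) mod int m) + nat x) mod m" using xy by (intro res) auto
      then have "c x y = c x (y - x) div m * m + (c x (y - x) div m + c x (y - x) mod m) mod m"
        unfolding cdm using xy by (simp add: c_def add.commute)
      then have "c x y \<in> step m (c x (y - x))" unfolding step_def by blast
      with A show "c x y \<in> ?B" by blast
    qed (rule f01)
    show "(\<Sum>x\<in>?W. \<Sum>y\<in>?W. (f (x - 1) y - f x y)\<^sup>2) \<le> (\<Sum>x\<in>?W. \<Sum>y\<in>?W. f x y) / 2500"
      unfolding S
    proof (rule bound)
      show "(\<Sum>x\<in>?W. \<Sum>y\<in>?W. f (x - 1) y) = card A" using swap[of "\<lambda>y. - 1"] by simp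
      fix x y assume xy: "x \<in> ?W" "y \<in> ?W" "f (x - 1) y = 1"
      then have A: "c (x - 1) y \<in> A" by (simp add: f_def split: if_splits)
      have "nat (x mod int m) = (nat ((x - 1) mod int m) + 1) mod m" by (intro res) auto
      then have "c x y = (c (x - 1) y div m + 1) mod m * m + c (x - 1) y mod m"
        unfolding cdm using xy by (simp add: c_def)
      then have "c x y \<in> step m (c (x - 1) y)" unfolding step_def by blast
      with A show "c x y \<in> ?B" by blast
    qed (rule f01)
    show "(\<Sum>x\<in>?W. \<Sum>y\<in>?W. (f x (y - 1) - f x y)\<^sup>2) \<le> (\<Sum>x\<in>?W. \<Sum>y\<in>?W. f x y) / 2500"
      unfolding S
    proof (rule bound)
      show "(\<Sum>x\<in>?W. \<Sum>y\<in>?W. f x (y - 1)) = card A" using shift[of "\<lambda>y. - 1"] by simp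
      fix x y assume xy: "x \<in> ?W" "y \<in> ?W" "f x (y - 1) = 1"
      then have A: "c x (y - 1) \<in> A" by (simp add: f_def split: if_splits)
      have "nat (y mod int m) = (nat ((y - 1) mod int m) + 1) mod m" by (intro res) auto
      then have "c x y = c x (y - 1) div m * m + (c x (y - 1) mod m + 1) mod m"
        unfolding cdm using xy by (simp add: c_def)
      then have "c x y \<in> step m (c x (y - 1))" unfolding step_def by blast
      with A show "c x y \<in> ?B" by blast
    qed (rule f01)
  qed (use m0 per f01 in auto)
qed

text \<open>\<open>step_expansion\<close> is iterated until half of the torus is covered; from then
  on the size cannot fall below half, because every point reaches itself.\<close>

lemma reach_expansion:
  assumes "A \<subseteq> {..<m * m}"
  shows "min ((1 + 1 / 5000) ^ k * real (card A)) (real (m * m) / 2) \<le>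
    card (\<Union>x\<in>A. reach m k x)"
  using assms
proof (induction k arbitrary: A)
  case (Suc k)
  have fin: "finite (\<Union>x\<in>A. reach m j x)" for j
    using finite_subset[OF Suc.prems] finite_reach by auto
  show ?case
  proof (cases "2 * card A \<le> m * m")
    case True
    let ?A = "\<Union> (step m ` A)"
    have "?A \<subseteq> {..<m * m}" using step_bounded Suc.prems by (meson UN_least lessThan_iff subsetD)
    from Suc.IH[OF this] have IH: "min ((1 + 1 / 5000) ^ k * real (card ?A)) (real (m * m) / 2) \<le>
      card (\<Union>x\<in>A. reach m (Suc k) x)" by simp
    have "(1 + 1 / 5000) ^ Suc k * real (card A) \<le> (1 + 1 / 5000) ^ k * real (card ?A)"
      using mult_left_mono[OF step_expansion[OF Suc.prems True], of "(1 + 1 / 5000) ^ k"] by simp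
    with IH show ?thesis by linarith
  next
    case False
    have "card A \<le> card (\<Union>x\<in>A. reach m (Suc k) x)"
      using fin reach_self by (intro card_mono) blast+
    with False have "m * m \<le> 2 * card (\<Union>x\<in>A. reach m (Suc k) x)" by linarith
    then have "real (m * m) \<le> real (2 * card (\<Union>x\<in>A. reach m (Suc k) x))" by (simp only: of_nat_le_iff)
    then show ?thesis by simp
  qed
qed simp

section \<open>Small sets and dense arcs\<close>

text \<open>Neighbours are numbered in increasing order. \<open>rank\<close> and its inverse
  \<open>nbr\<close> are written as bounded sums so that they can be transcribed literally into
  expressions.\<close>

definition rank :: "nat rel \<Rightarrow> nat \<Rightarrow> nat \<Rightarrow> nat" where
  "rank E v b = (\<Sum>a<b. of_bool ((v, a) \<in> E))"

definition nbr :: "nat rel \<Rightarrow> nat \<Rightarrow> nat \<Rightarrow> nat \<Rightarrow> nat" where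
  "nbr E n v i = (\<Sum>b<n. b * of_bool ((v, b) \<in> E \<and> rank E v b = i))"

definition head :: "nat rel \<Rightarrow> nat \<Rightarrow> nat \<Rightarrow> nat \<Rightarrow> nat \<Rightarrow> nat" where
  "head E n w v x = nbr E n v (x div w)"

text \<open>The position of the same copy of the reversed arc: the rank of the tail among the
  neighbours of the head selects the block, and the copy number \<open>x mod w\<close> is
  kept.\<close>

definition twin :: "nat rel \<Rightarrow> nat \<Rightarrow> nat \<Rightarrow> nat \<Rightarrow> nat \<Rightarrow> nat" where
  "twin E n w v x = rank E (head E n w v x) v * w + x mod w"

definition link :: "nat rel \<Rightarrow> nat \<Rightarrow> nat \<Rightarrow> nat \<Rightarrow> nat \<Rightarrow> nat \<Rightarrow> nat \<Rightarrow> bool" where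
  "link E n w m k u j \<longleftrightarrow>
     j div (m * m) = u div (m * m) \<and> j mod (m * m) \<in> reach m k (u mod (m * m)) \<or>
     j div (m * m) = head E n w (u div (m * m)) (u mod (m * m)) \<and>
     j mod (m * m) \<in> reach m k (twin E n w (u div (m * m)) (u mod (m * m)))"

text \<open>Columns from \<open>r\<close> on are dummies shared by all rows. A row with
  \<open>c\<close> proper neighbours takes the first \<open>D - c\<close> of them.\<close>

definition padded :: "nat \<Rightarrow> nat \<Rightarrow> (nat \<Rightarrow> nat \<Rightarrow> bool) \<Rightarrow> nat \<Rightarrow> nat \<Rightarrow> bool" where
  "padded r D P u j \<longleftrightarrow> (if j < r then P u j else j - r + (\<Sum>i<r. of_bool (P u i)) < D)"

lemma sum_of_bool_card: "(\<Sum>a<b. of_bool (P a)) = card {a. a < b \<and> P a}" for b :: nat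
proof -
  have "{..<b} \<inter> Collect P = {a. a < b \<and> P a}" by auto
  then show ?thesis by simp
qed

lemma card_padded:
  assumes "card {j. j < r \<and> P u j} \<le> D"
  shows "card {j. j < r + D \<and> padded r D P u j} = D"
proof -
  let ?c = "card {j. j < r \<and> P u j}"
  have "{j. j < r + D \<and> padded r D P u j} = {j. j < r \<and> P u j} \<union> {r..<r + (D - ?c)}"
    unfolding padded_def sum_of_bool_card by (auto split: if_splits)
  also have "card \<dots> = ?c + (D - ?c)" by (subst card_Un_disjoint) auto
  finally show ?thesis using assms by simp
qed

section \<open>Arcs spanned by sets of vertices\<close>

lemma arcs_from:
  assumes "finite V" "S \<subseteq> V" "E \<subseteq> V \<times> V" "\<And>v. v \<in> V \<Longrightarrow> card (E `` {v}) = d"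
  shows "card (E \<inter> S \<times> S) + card (E \<inter> S \<times> (V - S)) = d * card S"
proof -
  have fin: "finite S" "finite E" using assms finite_subset by (auto intro: finite_subset)
  have "E \<inter> S \<times> V = Sigma S (\<lambda>v. E `` {v})" using assms by auto
  moreover have "finite (E `` {v})" for v using fin by auto
  ultimately have "card (E \<inter> S \<times> V) = (\<Sum>v\<in>S. card (E `` {v}))"
    using fin card_SigmaI[of S "\<lambda>v. E `` {v}"] by auto
  also have "\<dots> = d * card S" using assms by (simp add: subset_iff)
  finally have "card (E \<inter> S \<times> V) = d * card S" .
  moreover have "E \<inter> S \<times> V = (E \<inter> S \<times> S) \<union> (E \<inter> S \<times> (V - S))" using assms by auto
  then have "card (E \<inter> S \<times> V) = card (E \<inter> S \<times> S) + card (E \<inter> S \<times> (V - S))"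
    using fin by (simp add: card_Un_disjoint disjoint_iff)
  ultimately show ?thesis by simp
qed

text \<open>\<open>U\<close> is cut into at most \<open>3 * C + 1\<close> blocks of size at most
  \<open>s div 2\<close>. Any two blocks lie in a set of size exactly \<open>s\<close>, and by the
  expansion hypothesis such a set contains at most \<open>\<eta> * (d * s)\<close> arcs. Arcs are
  ordered pairs, hence the square of the number of blocks.\<close>

lemma arcs_within:
  fixes C \<eta> :: real and d s :: nat
  assumes V: "finite V" "E \<subseteq> V \<times> V" "\<And>v. v \<in> V \<Longrightarrow> card (E `` {v}) = d"
    and s: "2 \<le> s" "s \<le> card V"
    and exp: "\<And>S. S \<subseteq> V \<Longrightarrow> card S = s \<Longrightarrow> (1 - \<eta>) * (d * s) \<le> card (E \<inter> S \<times> (V - S))"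
    and U: "U \<subseteq> V" "card U \<le> C * s" and "\<eta> \<ge> 0"
  shows "card (E \<inter> U \<times> U) \<le> (3 * C + 1)\<^sup>2 * (\<eta> * (d * s))"
proof -
  have fin: "finite U" "finite E" using V U by (auto intro: finite_subset)
  define h where "h = s div 2"
  \<comment> \<open>The last bound is tight for \<open>s = 3\<close>; it is the source of the factor
    3 in the conclusion.\<close>
  have h: "h > 0" "2 * h \<le> s" "s \<le> 3 * h" using s by (auto simp: h_def)
  define q where "q = card U div h + 1"
  obtain f where f: "bij_betw f {0..<card U} U" using ex_bij_betw_nat_finite[OF fin(1)] by blast
  define B where "B i = f ` ({i * h..<i * h + h} \<inter> {0..<card U})" for i
  have BU: "B i \<subseteq> U" for i using f by (auto simp: B_def bij_betw_def)
  have cB: "card (B i) \<le> h" for i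
    unfolding B_def by (rule order_trans[OF card_image_le]) (auto intro: order_trans[OF card_mono[of "{i * h..<i * h + h}"]])
  have cover: "U \<subseteq> (\<Union>i<q. B i)"
  proof
    fix x assume "x \<in> U"
    then have "x \<in> f ` {0..<card U}" using f by (simp add: bij_betw_def)
    then obtain a where a: "a < card U" "x = f a" by auto
    have "a div h < q" using div_le_mono[of a "card U" h] a(1) by (simp add: q_def)
    moreover have "a \<in> {a div h * h..<a div h * h + h}"
      using h(1) by (simp add: div_times_less_eq_dividend dividend_less_div_times add.commute)
    ultimately have "x \<in> B (a div h)" "a div h < q" using a by (auto simp: B_def)
    then show "x \<in> (\<Union>i<q. B i)" by blast
  qed
  have pair: "card (E \<inter> B i \<times> B j) \<le> \<eta> * (d * s)" for i j
  proof -
    have "card (B i \<union> B j) \<le> s" using cB[of i] cB[of j] card_Un_le[of "B i" "B j"] h by linarith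
    moreover have "B i \<union> B j \<subseteq> V" using BU U by blast
    ultimately obtain S where S: "B i \<union> B j \<subseteq> S" "S \<subseteq> V" "card S = s"
      using exists_subset_between[of "B i \<union> B j" s V] s V(1) by blast
    have "card (E \<inter> B i \<times> B j) \<le> card (E \<inter> S \<times> S)" using S fin by (intro card_mono) auto
    moreover have "card (E \<inter> S \<times> S) + card (E \<inter> S \<times> (V - S)) = d * s"
      using arcs_from[OF V(1) S(2) V(2,3)] S(3) by simp
    then have "real (card (E \<inter> S \<times> S)) + card (E \<inter> S \<times> (V - S)) = d * s" by (metis of_nat_add)
    ultimately show ?thesis using exp[OF S(2,3)] by (simp add: algebra_simps)
  qed
  have "E \<inter> U \<times> U \<subseteq> (\<Union>(i, j)\<in>{..<q} \<times> {..<q}. E \<inter> B i \<times> B j)"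
  proof
    fix p assume "p \<in> E \<inter> U \<times> U"
    then obtain a b where p: "p = (a, b)" "(a, b) \<in> E" "a \<in> U" "b \<in> U" by auto
    obtain i j where "i < q" "a \<in> B i" "j < q" "b \<in> B j" using cover p(3,4) by blast
    then show "p \<in> (\<Union>(i, j)\<in>{..<q} \<times> {..<q}. E \<inter> B i \<times> B j)" using p by auto
  qed
  then have "card (E \<inter> U \<times> U) \<le> card (\<Union>(i, j)\<in>{..<q} \<times> {..<q}. E \<inter> B i \<times> B j)"
    using fin by (intro card_mono) auto
  also have "\<dots> \<le> (\<Sum>(i, j)\<in>{..<q} \<times> {..<q}. card (E \<inter> B i \<times> B j))"
    by (rule order_trans[OF card_UN_le]) (auto simp: case_prod_beta)
  finally have "real (card (E \<inter> U \<times> U)) \<le> (\<Sum>(i, j)\<in>{..<q} \<times> {..<q}. real (card (E \<inter> B i \<times> B j)))"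
    by (simp add: case_prod_beta flip: of_nat_sum)
  also have "\<dots> \<le> (\<Sum>(i, j)\<in>{..<q} \<times> {..<q}. \<eta> * (d * s))" using pair by (intro sum_mono) auto
  also have "\<dots> = (real q)\<^sup>2 * (\<eta> * (d * s))" by (simp add: power2_eq_square)
  also have "\<dots> \<le> (3 * C + 1)\<^sup>2 * (\<eta> * (d * s))"
  proof (intro mult_right_mono power_mono)
    have "real (card U div h) \<le> card U / h" 
      using h(1) div_times_less_eq_dividend[of "card U" h] by (simp add: pos_le_divide_eq flip: of_nat_mult)
    also have "\<dots> \<le> 3 * C"
    proof -
      have "C \<ge> 0" using U(2) s by (smt (verit) mult_neg_pos of_nat_0_le_iff of_nat_0_less_iff zero_less_numeral order_less_le_trans)
      then have "C * s \<le> C * (3 * h)" using h(3) by (intro mult_left_mono) (simp_all flip: of_nat_le_iff)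
      then show ?thesis using U(2) h(1) by (simp add: divide_le_eq mult_ac)
    qed
    finally show "real q \<le> 3 * C + 1" by (simp add: q_def)
  qed (use assms(9) in auto)
  finally show ?thesis .
qed

text \<open>The set on the right-hand side splits into the parts over the single vertices.
  \<open>W\<close> collects the vertices whose fibre is so large that the minimum in the expansion
  bound is half of \<open>X\<close>; every other fibre expands by the full factor
  \<open>c\<close>.\<close>

lemma heavy_fibres:
  fixes c :: real
  assumes fin: "finite V" "finite X" "\<And>x. finite (R x)" and c: "c > 0"
    and exp: "\<And>A. A \<subseteq> X \<Longrightarrow> min (c * card A) (real (card X) / 2) \<le> card (\<Union>x\<in>A. R x)"
    and T: "T \<subseteq> V \<times> X"
  obtains W where "W \<subseteq> V"
    "c * card {p \<in> T. fst p \<notin> W} + card W * (real (card X) / 2) \<le>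
      card (\<Union>(v, x)\<in>T. {v} \<times> R x)"
proof
  define a where "a v = {x. (v, x) \<in> T}" for v
  define W where "W = {v \<in> V. card X / 2 \<le> c * card (a v)}"
  show "W \<subseteq> V" by (auto simp: W_def)
  have aX: "a v \<subseteq> X" for v using T by (auto simp: a_def)
  then have fa: "finite (a v)" for v using fin(2) finite_subset by blast
  have "(\<Union>(v, x)\<in>T. {v} \<times> R x) = (SIGMA v:V. \<Union>x\<in>a v. R x)" using T by (auto simp: a_def)
  then have "card (\<Union>(v, x)\<in>T. {v} \<times> R x) = (\<Sum>v\<in>V. card (\<Union>x\<in>a v. R x))"
    using fin fa by simp
  also have "real \<dots> = (\<Sum>v\<in>V. real (card (\<Union>x\<in>a v. R x)))" by simp
  also have "\<dots> \<ge> (\<Sum>v\<in>V. if v \<in> W then card X / 2 else c * card (a v))"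
  proof (rule sum_mono)
    fix v assume "v \<in> V"
    then show "(if v \<in> W then card X / 2 else c * card (a v)) \<le> card (\<Union>x\<in>a v. R x)"
      using exp[OF aX[of v]] by (auto simp: W_def)
  qed
  also have "(\<Sum>v\<in>V. if v \<in> W then card X / 2 else c * card (a v)) =
      card W * (card X / 2) + c * (\<Sum>v\<in>V - W. real (card (a v)))"
  proof -
    have "V \<inter> {x. x \<in> W} = W" "V \<inter> - {x. x \<in> W} = V - W" by (auto simp: W_def)
    then show ?thesis using fin by (simp add: sum.If_cases sum_distrib_left)
  qed
  also have "(\<Sum>v\<in>V - W. real (card (a v))) = card {p \<in> T. fst p \<notin> W}"
  proof -
    have "{p \<in> T. fst p \<notin> W} = (SIGMA v:V - W. a v)" using T by (auto simp: a_def)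
    then show ?thesis using fin fa by simp
  qed
  finally show "c * card {p \<in> T. fst p \<notin> W} + card W * (real (card X) / 2) \<le>
      card (\<Union>(v, x)\<in>T. {v} \<times> R x)" by simp
qed

text \<open>\<open>heavy_fibres\<close> with factor \<open>4 * C\<close> is applied to the tails
  (\<open>T\<close>) and, through \<open>\<phi>\<close>, to the heads. Each time at most a quarter
  of \<open>T\<close> lies outside the heavy vertices, of which there are at most
  \<open>2 * C * s\<close>. So at least half of \<open>T\<close> has both ends in the union
  \<open>U\<close> of the two heavy sets, and each arc in \<open>U\<close> accounts for at most
  \<open>w\<close> elements.\<close>

lemma many_arcs_within:
  fixes C :: real and w d s :: nat
  assumes fin: "finite V" "finite X" "\<And>x. finite (R x)" and C: "C > 0" and pos: "s > 0" "card X > 0"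
    and exp: "\<And>A. A \<subseteq> X \<Longrightarrow> min (4 * C * card A) (real (card X) / 2) \<le> card (\<Union>x\<in>A. R x)"
    and T: "T \<subseteq> V \<times> X" "card T = s * card X"
    and \<phi>: "inj_on \<phi> (V \<times> X)" "\<phi> ` (V \<times> X) \<subseteq> V \<times> X"
    and w: "card X = d * w" "\<And>U. U \<subseteq> V \<Longrightarrow>
      card {p \<in> V \<times> X. fst p \<in> U \<and> fst (\<phi> p) \<in> U} \<le> card (E \<inter> U \<times> U) * w"
    and small: "card (\<Union>(v, x)\<in>T. {v} \<times> R x) < C * card T"
      "card (\<Union>(v, x)\<in>\<phi> ` T. {v} \<times> R x) < C * card T"
  obtains U where "U \<subseteq> V" "card U \<le> 4 * C * s" "d * s / 2 \<le> card (E \<inter> U \<times> U)"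
proof -
  have finT: "finite T" using T(1) fin by (meson finite_SigmaI finite_subset)
  have inj: "inj_on \<phi> T" using \<phi>(1) T(1) by (rule inj_on_subset)
  have c: "card (\<phi> ` T) = card T" using inj by (rule card_image)
  have "\<phi> ` T \<subseteq> V \<times> X" using \<phi>(2) T(1) by blast
  note sub = this
  have c4: "4 * C > 0" using C by simp
  obtain W' where W': "W' \<subseteq> V"
    "4 * C * card {p \<in> \<phi> ` T. fst p \<notin> W'} + card W' * (real (card X) / 2) \<le>
      card (\<Union>(v, x)\<in>\<phi> ` T. {v} \<times> R x)"
    by (rule heavy_fibres[OF fin c4 exp sub])
  obtain W where W: "W \<subseteq> V"
    "4 * C * card {p \<in> T. fst p \<notin> W} + card W * (real (card X) / 2) \<le>
      card (\<Union>(v, x)\<in>T. {v} \<times> R x)"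
    by (rule heavy_fibres[OF fin c4 exp T(1)])
  note lt = order.strict_trans1[OF W(2) small(1)] and lt' = order.strict_trans1[OF W'(2) small(2)]
  \<comment> \<open>The two terms on the left are compared with \<open>C * card T\<close>
    separately: one bounds the heavy vertices, the other the pairs outside them.\<close>
  have half: "card A \<le> 2 * C * s \<and> 4 * real (card B) \<le> card T"
    if "4 * C * card B + card A * (real (card X) / 2) < C * card T" for A :: "'a set" and B :: "('a \<times> 'b) set"
  proof
    have "0 \<le> C * card B" using C by simp
    then have "card A * (real (card X) / 2) \<le> C * (s * card X)" using that T(2) by simp
    then have "real (card A) * card X \<le> 2 * C * s * card X" by simp
    then show "card A \<le> 2 * C * s" using pos(2) by (simp only: mult_le_cancel_right)
    have "0 \<le> card A * (real (card X) / 2)" by simp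
    then have "4 * C * card B \<le> C * card T" using that by linarith
    then have "C * (4 * card B) \<le> C * card T" by (simp add: mult_ac)
    then show "4 * real (card B) \<le> card T" using C by simp
  qed
  define U where "U = W \<union> W'"
  have U: "U \<subseteq> V" using W W' by (auto simp: U_def)
  have "card U \<le> card W + card W'" unfolding U_def by (rule card_Un_le)
  then have "real (card U) \<le> real (card W) + card W'" by linarith
  also have "\<dots> \<le> 4 * C * s" using half[OF lt] half[OF lt'] by linarith
  finally have cU: "card U \<le> 4 * C * s" .
  let ?T = "{p \<in> V \<times> X. fst p \<in> U \<and> fst (\<phi> p) \<in> U}"
  have "T \<subseteq> ?T \<union> {p \<in> T. fst p \<notin> W} \<union> {p \<in> T. fst (\<phi> p) \<notin> W'}" using T(1) by (auto simp: U_def)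
  then have "card T \<le> card (?T \<union> {p \<in> T. fst p \<notin> W} \<union> {p \<in> T. fst (\<phi> p) \<notin> W'})"
    using finT fin by (intro card_mono) auto
  also have "\<dots> \<le> card ?T + card {p \<in> T. fst p \<notin> W} + card {p \<in> T. fst (\<phi> p) \<notin> W'}"
    by (meson add_mono card_Un_le order.trans order_refl)
  also have "card {p \<in> T. fst (\<phi> p) \<notin> W'} = card {p \<in> \<phi> ` T. fst p \<notin> W'}"
  proof -
    have "{p \<in> \<phi> ` T. fst p \<notin> W'} = \<phi> ` {p \<in> T. fst (\<phi> p) \<notin> W'}" by auto
    moreover have "inj_on \<phi> {p \<in> T. fst (\<phi> p) \<notin> W'}" by (rule inj_on_subset[OF inj]) auto
    ultimately show ?thesis by (simp add: card_image)
  qed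
  finally have "real (card T) \<le> real (card ?T) + card {p \<in> T. fst p \<notin> W} + card {p \<in> \<phi> ` T. fst p \<notin> W'}"
    by linarith
  then have "real (card T) \<le> 2 * card ?T" using half[OF lt] half[OF lt'] by linarith
  moreover have "real (card ?T) \<le> real (card (E \<inter> U \<times> U) * w)" using w(2)[OF U] by (simp only: of_nat_le_iff)
  ultimately have "real (card T) \<le> 2 * real (card (E \<inter> U \<times> U) * w)" by linarith
  then have "real (d * s) * w \<le> real (2 * card (E \<inter> U \<times> U)) * w" using T(2) w(1) by (simp add: mult_ac)
  moreover have "w > 0" using w(1) pos(2) by (cases w) auto
  ultimately have "d * s / 2 \<le> card (E \<inter> U \<times> U)" by (simp add: mult_le_cancel_right)
  with U cU show thesis by (rule that)
qed

section \<open>The bipartite graph\<close>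

locale regular_instance =
  fixes n d t k :: nat and E :: "nat rel"
  assumes E: "regular_graph n d E" and d: "d > 0" and t: "t > 0"
begin

text \<open>As \<open>m\<close> is a multiple of \<open>d\<close>, so is the torus size
  \<open>K\<close>. The \<open>K\<close> positions over a vertex thus split into \<open>d\<close>
  blocks of \<open>w\<close> copies, one block for each neighbour.\<close>

definition m :: nat where "m = d * t"
definition w where "w = m * t"
definition K where "K = m * m"

abbreviation hd' where "hd' \<equiv> head E n w"
abbreviation tw where "tw \<equiv> twin E n w"

lemma pos: "m > 0" "w > 0" "K > 0" "K = d * w"
  using d t by (simp_all add: m_def w_def K_def)

lemma EV: "E \<subseteq> {..<n} \<times> {..<n}" "(a, b) \<in> E \<Longrightarrow> (b, a) \<in> E" "(a, b) \<in> E \<Longrightarrow> a < n \<and> b < n"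
  using E unfolding regular_graph_def by (auto dest: symD)

lemma deg: "v < n \<Longrightarrow> card (E `` {v}) = d"
  using E unfolding regular_graph_def by auto

lemma fin_nbrs: "finite (E `` {v})"
  using EV(1) by (auto intro: finite_subset[of _ "{..<n}"])

lemma rank_card: "rank E v b = card {a \<in> E `` {v}. a < b}"
  unfolding rank_def sum_of_bool_card by (rule arg_cong[of _ _ card]) auto

lemma rank_mono: "(v, b) \<in> E \<Longrightarrow> b < b' \<Longrightarrow> rank E v b < rank E v b'"
  unfolding rank_card using fin_nbrs by (intro psubset_card_mono) auto

lemma rank_less: "(v, b) \<in> E \<Longrightarrow> rank E v b < d"
proof -
  assume vb: "(v, b) \<in> E"
  then have "{a \<in> E `` {v}. a < b} \<subset> E `` {v}" by auto
  then show ?thesis unfolding rank_card using psubset_card_mono[OF fin_nbrs] deg EV(3)[OF vb] by metis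
qed

lemma rank_inj: "inj_on (rank E v) (E `` {v})"
proof (rule inj_onI)
  fix a b assume "a \<in> E `` {v}" "b \<in> E `` {v}" "rank E v a = rank E v b"
  then show "a = b" using rank_mono[of v a b] rank_mono[of v b a] by (cases a b rule: linorder_cases) auto
qed

lemma rank_bij: "v < n \<Longrightarrow> rank E v ` (E `` {v}) = {..<d}"
  by (rule card_subset_eq) (use rank_less in \<open>auto simp: card_image[OF rank_inj] deg\<close>)

lemma nbr_rank: "(v, b) \<in> E \<Longrightarrow> nbr E n v (rank E v b) = b"
proof -
  assume vb: "(v, b) \<in> E"
  have "c * of_bool ((v, c) \<in> E \<and> rank E v c = rank E v b) = (if c = b then b else 0)" for c
    using vb rank_inj[of v] by (auto simp: inj_on_def)
  then show ?thesis using EV(3)[OF vb] by (simp add: nbr_def)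
qed

lemma nbr: "v < n \<Longrightarrow> i < d \<Longrightarrow> (v, nbr E n v i) \<in> E \<and> rank E v (nbr E n v i) = i"
proof -
  assume "v < n" "i < d"
  then have "i \<in> rank E v ` (E `` {v})" using rank_bij by simp
  then obtain b where "(v, b) \<in> E" "rank E v b = i" by auto
  then show ?thesis using nbr_rank by auto
qed

lemma div_w: "x < K \<Longrightarrow> x div w < d"
  using pos by (simp add: less_mult_imp_div_less)

lemma hd_edge: "v < n \<Longrightarrow> x < K \<Longrightarrow> (v, hd' v x) \<in> E"
  using nbr div_w by (simp add: head_def)

lemma hd_less: "v < n \<Longrightarrow> x < K \<Longrightarrow> hd' v x < n"
  using hd_edge EV(3) by blast

lemma tw_div_mod: "tw v x div w = rank E (hd' v x) v" "tw v x mod w = x mod w"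
  using pos by (simp_all add: twin_def)

lemma tw_less: "v < n \<Longrightarrow> x < K \<Longrightarrow> tw v x < K"
  using code_less[OF rank_less[OF EV(2)[OF hd_edge]] mod_less_divisor[OF pos(2)]]
  by (simp only: twin_def pos(4))

lemma hd_hd: "v < n \<Longrightarrow> x < K \<Longrightarrow> hd' (hd' v x) (tw v x) = v"
  unfolding head_def[of _ _ _ "hd' v x"] tw_div_mod by (rule nbr_rank[OF EV(2)[OF hd_edge]])

lemma tw_tw: "v < n \<Longrightarrow> x < K \<Longrightarrow> tw (hd' v x) (tw v x) = x"
proof -
  assume v: "v < n" "x < K"
  have "rank E v (hd' v x) = x div w" using nbr[OF v(1) div_w[OF v(2)]] by (simp add: head_def)
  then show ?thesis
    unfolding twin_def[of _ _ _ "hd' v x"] hd_hd[OF v] tw_div_mod(2) by (simp add: div_mult_mod_eq)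
qed

text \<open>Reversal of a copy of an arc. By \<open>hd_hd\<close> and \<open>tw_tw\<close> it is an
  involution, and thus injective.\<close>

definition \<phi> where "\<phi> = (\<lambda>(v, x). (hd' v x, tw v x))"

lemma phi: "inj_on \<phi> ({..<n} \<times> {..<K})" "\<phi> ` ({..<n} \<times> {..<K}) \<subseteq> {..<n} \<times> {..<K}"
proof -
  have "\<phi> (\<phi> p) = p" if "p \<in> {..<n} \<times> {..<K}" for p
    using that hd_hd tw_tw by (auto simp: \<phi>_def)
  then show "inj_on \<phi> ({..<n} \<times> {..<K})" by (rule inj_on_inverseI)
  show "\<phi> ` ({..<n} \<times> {..<K}) \<subseteq> {..<n} \<times> {..<K}" using hd_less tw_less by (auto simp: \<phi>_def)
qed

text \<open>A pair is determined by its arc and its copy number \<open>x mod w\<close>, because the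
  rank of the head is \<open>x div w\<close>.\<close>

lemma card_arc_pairs:
  "card {p \<in> {..<n} \<times> {..<K}. fst p \<in> A \<and> fst (\<phi> p) \<in> B} \<le> card (E \<inter> A \<times> B) * w"
proof -
  let ?P = "{p \<in> {..<n} \<times> {..<K}. fst p \<in> A \<and> fst (\<phi> p) \<in> B}"
  let ?f = "\<lambda>(v, x). ((v, hd' v x), x mod w)"
  have "inj_on ?f ?P"
  proof (rule inj_onI)
    fix p q assume pq: "p \<in> ?P" "q \<in> ?P" "?f p = ?f q"
    obtain v x v' x' where vx: "p = (v, x)" "q = (v', x')" by (cases p, cases q)
    with pq have *: "v' = v" "v < n" "x < K" "x' < K" "hd' v x = hd' v x'" "x mod w = x' mod w" by auto
    have "rank E v (hd' v x) = x div w" "rank E v (hd' v x') = x' div w"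
      using nbr[OF *(2)] div_w *(3,4) by (simp_all add: head_def)
    with * have "x = x'" by (metis div_mult_mod_eq)
    with * vx show "p = q" by simp
  qed
  moreover have "?f ` ?P \<subseteq> (E \<inter> A \<times> B) \<times> {..<w}"
    using hd_edge pos by (auto simp: \<phi>_def)
  moreover have "finite E" using EV(1) by (rule finite_subset) simp
  ultimately have "card ?P \<le> card ((E \<inter> A \<times> B) \<times> {..<w})"
    by (intro card_inj_on_le) auto
  then show ?thesis by (simp add: card_cartesian_product)
qed

text \<open>Room for two \<open>reach\<close> sets of at most \<open>5 ^ k\<close> points, one at
  the tail and one at the head.\<close>

definition D :: nat where "D = 2 * 5 ^ k"
definition G where "G = {(u, j). u < n * K \<and> j < n * K + D \<and> padded (n * K) D (link E n w m k) u j}"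

lemma link_K:
  "link E n w m k u j \<longleftrightarrow> j div K = u div K \<and> j mod K \<in> reach m k (u mod K) \<or>
     j div K = hd' (u div K) (u mod K) \<and> j mod K \<in> reach m k (tw (u div K) (u mod K))"
  by (simp add: link_def K_def)

lemma decode: "u < n * K \<Longrightarrow> u div K < n" "u mod K < K"
  using pos by (simp_all add: less_mult_imp_div_less)

lemma card_link:
  assumes u: "u < n * K"
  shows "card {j. j < n * K \<and> link E n w m k u j} \<le> D"
proof -
  let ?e = "\<lambda>v A. (\<lambda>y. v * K + y) ` A"
  let ?A = "reach m k (u mod K)" and ?B = "reach m k (tw (u div K) (u mod K))"
  have "{j. j < n * K \<and> link E n w m k u j} \<subseteq> ?e (u div K) ?A \<union> ?e (hd' (u div K) (u mod K)) ?B"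
  proof
    fix j assume "j \<in> {j. j < n * K \<and> link E n w m k u j}"
    then have "link E n w m k u j" by simp
    moreover have "j = j div K * K + j mod K" by (rule div_mult_mod_eq[symmetric])
    ultimately show "j \<in> ?e (u div K) ?A \<union> ?e (hd' (u div K) (u mod K)) ?B"
      unfolding link_K by (metis UnI1 UnI2 image_eqI)
  qed
  then have "card {j. j < n * K \<and> link E n w m k u j} \<le> card (?e (u div K) ?A \<union> ?e (hd' (u div K) (u mod K)) ?B)"
    using finite_reach by (intro card_mono) auto
  also have "\<dots> \<le> card (?e (u div K) ?A) + card (?e (hd' (u div K) (u mod K)) ?B)" by (rule card_Un_le)
  also have "\<dots> \<le> card ?A + card ?B" by (intro add_mono card_image_le finite_reach)
  also have "\<dots> \<le> D" using card_reach[of m k] by (simp add: D_def add_mono mult_2)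
  finally show ?thesis .
qed

lemma G_regular: "left_regular (n * K) (n * K + D) D G"
proof -
  have "G `` {u} = {j. j < n * K + D \<and> padded (n * K) D (link E n w m k) u j}" if "u < n * K" for u
    using that by (auto simp: G_def)
  then show ?thesis
    unfolding left_regular_def using card_padded[of "n * K" "link E n w m k" u D for u, OF card_link] by (auto simp: G_def)
qed

lemma G_link: "u < n * K \<Longrightarrow> j < n * K \<Longrightarrow> link E n w m k u j \<Longrightarrow> (u, j) \<in> G"
  by (simp add: G_def padded_def)

lemma fin_G: "finite (G `` S)"
  by (rule finite_subset[of _ "{..<n * K + D}"]) (auto simp: G_def)

text \<open>\<open>T\<close> consists of all pairs over \<open>S\<close>. Proper neighbours stay
  over \<open>S\<close> except at the heads of arcs leaving \<open>S\<close>. There are at most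
  \<open>\<eta> * card T\<close> copies of such arcs, each contributing at most \<open>5 ^ k\<close>
  neighbours, and the dummies add at most \<open>D\<close>.\<close>

lemma completeness:
  fixes \<eta> :: real
  assumes S: "S \<subseteq> {..<n}" "card (E \<inter> S \<times> ({..<n} - S)) \<le> \<eta> * (d * card S)"
  shows "\<exists>T\<subseteq>{..<n * K}. card T = card S * K \<and>
    card (G `` T) \<le> (1 + 5 ^ k * \<eta>) * card T + D"
proof (intro exI conjI)
  define T where "T = (\<lambda>(v, x). v * K + x) ` (S \<times> {..<K})"
  show "T \<subseteq> {..<n * K}" using S(1) by (auto simp: T_def intro!: code_less)
  have inj: "inj_on (\<lambda>(v, x). v * K + x) (A \<times> {..<K})" for A
    by (rule inj_on_inverseI[where g = "\<lambda>u. (u div K, u mod K)"]) auto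
  show cT: "card T = card S * K"
    unfolding T_def by (simp add: card_image[OF inj] card_cartesian_product)
  have finS: "finite S" using S(1) by (rule finite_subset) simp
  define B where "B = {p \<in> {..<n} \<times> {..<K}. fst p \<in> S \<and> fst (\<phi> p) \<in> {..<n} - S}"
  have finB: "finite B" by (simp add: B_def)
  let ?L = "\<Union>(v, x)\<in>B. (\<lambda>y. hd' v x * K + y) ` reach m k (tw v x)"
  \<comment> \<open>Left and right vertices are encoded in the same way, so \<open>T\<close> on the
    right-hand side stands for the right vertices over \<open>S\<close>.\<close>
  have "G `` T \<subseteq> T \<union> ?L \<union> {n * K..<n * K + D}"
  proof
    fix j assume "j \<in> G `` T"
    then obtain v x where vx: "v \<in> S" "x < K" and G: "(v * K + x, j) \<in> G" by (auto simp: T_def)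
    then have v: "v < n" using S by auto
    show "j \<in> T \<union> ?L \<union> {n * K..<n * K + D}"
    proof (cases "j < n * K")
      case True
      then have "link E n w m k (v * K + x) j" using G by (simp add: G_def padded_def)
      then consider "j div K = v" | "j div K = hd' v x" "j mod K \<in> reach m k (tw v x)"
        using vx by (auto simp: link_K)
      then show ?thesis
      proof cases
        case 1
        then have "j = (\<lambda>(v, x). v * K + x) (v, j mod K)" using div_mult_mod_eq[of j K] by simp
        moreover have "(v, j mod K) \<in> S \<times> {..<K}" using vx pos by simp
        ultimately have "j \<in> T" unfolding T_def by (rule image_eqI)
        then show ?thesis by simp
      next
        case 2
        then have j: "j = hd' v x * K + j mod K" by (metis div_mult_mod_eq)
        show ?thesis
        proof (cases "hd' v x \<in> S")
          case True
          have "j = (\<lambda>(v, x). v * K + x) (hd' v x, j mod K)" using j by simp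
          moreover have "(hd' v x, j mod K) \<in> S \<times> {..<K}" using True pos by simp
          ultimately have "j \<in> T" unfolding T_def by (rule image_eqI)
          then show ?thesis by simp
        next
          case False
          then have "(v, x) \<in> B" using vx v hd_less by (simp add: B_def \<phi>_def)
          then show ?thesis using 2 j by blast
        qed
      qed
    next
      case False
      then show ?thesis using G by (simp add: G_def)
    qed
  qed
  moreover have fT: "finite T" using finS by (simp add: T_def)
  moreover have "finite ?L" using finB finite_reach by auto
  ultimately have "card (G `` T) \<le> card (T \<union> ?L \<union> {n * K..<n * K + D})" by (intro card_mono) auto
  also have "\<dots> \<le> card T + card ?L + D"
    by (rule order_trans[OF card_Un_le]) (simp add: card_Un_le)
  finally have "real (card (G `` T)) \<le> real (card T + card ?L + D)" by (simp only: of_nat_le_iff)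
  then have 1: "real (card (G `` T)) \<le> real (card T) + real (card ?L) + real D" by (simp only: of_nat_add)
  have "card ?L \<le> (\<Sum>p\<in>B. card (case p of (v, x) \<Rightarrow> (\<lambda>y. hd' v x * K + y) ` reach m k (tw v x)))"
    by (rule card_UN_le[OF finB])
  also have "\<dots> \<le> (\<Sum>p\<in>B. 5 ^ k)"
    by (intro sum_mono) (auto intro!: order_trans[OF card_image_le card_reach] finite_reach)
  finally have "card ?L \<le> card B * 5 ^ k" by simp
  moreover have "card B \<le> card (E \<inter> S \<times> ({..<n} - S)) * w"
    unfolding B_def by (rule card_arc_pairs)
  ultimately have "card ?L \<le> card (E \<inter> S \<times> ({..<n} - S)) * w * 5 ^ k"
    by (meson mult_le_mono1 order_trans)
  then have "real (card ?L) \<le> real (card (E \<inter> S \<times> ({..<n} - S)) * w * 5 ^ k)" by (simp only: of_nat_le_iff)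
  also have "\<dots> = real (card (E \<inter> S \<times> ({..<n} - S))) * (w * 5 ^ k)" by simp
  also have "\<dots> \<le> \<eta> * (d * card S) * (w * 5 ^ k)" using S(2) by (rule mult_right_mono) simp
  also have "\<dots> = 5 ^ k * \<eta> * card T" by (simp add: cT pos(4))
  finally show "real (card (G `` T)) \<le> (1 + 5 ^ k * \<eta>) * card T + D"
    using 1 unfolding distrib_right by linarith
qed

text \<open>If \<open>T\<close> had too few neighbours, \<open>many_arcs_within\<close> would give
  at most \<open>4 * C * s\<close> vertices spanning at least half of \<open>d * s\<close> arcs. By
  \<open>arcs_within\<close> they span at most
  \<open>(12 * C + 1)\<^sup>2 * \<eta> * (d * s)\<close> arcs, which is less by the choice of
  \<open>\<eta>\<close>.\<close>

lemma soundness: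
  fixes C \<eta> :: real
  assumes C: "C > 0" "4 * C \<le> (1 + 1 / 5000) ^ k" and s: "2 \<le> s" "s \<le> n"
    and exp: "\<And>S. S \<subseteq> {..<n} \<Longrightarrow> card S = s \<Longrightarrow>
      (1 - \<eta>) * (d * s) \<le> card (E \<inter> S \<times> ({..<n} - S))"
    and \<eta>: "0 \<le> \<eta>" "2 * (12 * C + 1)\<^sup>2 * \<eta> < 1"
    and T: "T \<subseteq> {..<n * K}" "card T = s * K"
  shows "C * card T \<le> card (G `` T)"
proof (rule ccontr)
  assume "\<not> ?thesis"
  then have neg: "card (G `` T) < C * card T" by simp
  let ?X = "{..<K}" and ?V = "{..<n}"
  let ?dec = "\<lambda>u. (u div K, u mod K)" and ?enc = "\<lambda>(v, y). v * K + y"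
  define P where "P = ?dec ` T"
  have "inj ?dec" by (rule inj_on_inverseI[where g = ?enc]) (simp add: div_mult_mod_eq)
  then have cP: "card P = card T" unfolding P_def by (metis card_image inj_on_subset subset_UNIV)
  have P: "P \<subseteq> ?V \<times> ?X" using T(1) pos decode by (auto simp: P_def)
  have PT: "v * K + x \<in> T" if "(v, x) \<in> P" for v x using that by (auto simp: P_def div_mult_mod_eq)
  have reachX: "reach m k x \<subseteq> ?X" if "x < K" for x using that reach_bounded[of x m k] by (simp add: K_def)
  \<comment> \<open>Taking \<open>P\<close> itself gives the neighbours at the tails, taking its
    image under \<open>\<phi>\<close> those at the heads. Both sets are encoded injectively into the
    neighbour set of \<open>T\<close>.\<close>
  have small: "card (\<Union>(v, x)\<in>Q. {v} \<times> reach m k x) < C * card P"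
    if Q: "Q = P \<or> Q = \<phi> ` P" for Q
  proof -
    let ?N = "\<Union>(v, x)\<in>Q. {v} \<times> reach m k x"
    have QV: "Q \<subseteq> ?V \<times> ?X" using Q P phi(2) by blast
    have N: "?N \<subseteq> ?V \<times> ?X" using QV reachX by fastforce
    have "inj_on ?enc (?V \<times> ?X)" by (rule inj_on_inverseI[where g = ?dec]) auto
    then have "inj_on ?enc ?N" using N by (rule inj_on_subset)
    moreover have "?enc ` ?N \<subseteq> G `` T"
    proof
      fix j assume "j \<in> ?enc ` ?N"
      then obtain v x y where vx: "(v, x) \<in> Q" and y: "y \<in> reach m k x" and jy: "j = v * K + y" by auto
      then have "v < n" "x < K" using QV by auto
      then have "y < K" using reachX y by auto
      have j: "v * K + y < n * K" using \<open>v < n\<close> \<open>y < K\<close> by (rule code_less)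
      from Q show "j \<in> G `` T"
      proof
        assume "Q = P"
        then have "link E n w m k (v * K + x) (v * K + y)" "v * K + x \<in> T"
          using y \<open>x < K\<close> \<open>y < K\<close> PT vx by (auto simp: link_K)
        then show ?thesis using G_link[OF _ j] T(1) unfolding jy by auto
      next
        assume "Q = \<phi> ` P"
        then obtain a b where ab: "(a, b) \<in> P" "v = hd' a b" "x = tw a b" using vx by (auto simp: \<phi>_def)
        then have "b < K" using P by auto
        then have "link E n w m k (a * K + b) (v * K + y)" "a * K + b \<in> T"
          using y \<open>y < K\<close> PT ab by (auto simp: link_K)
        then show ?thesis using G_link[OF _ j] T(1) unfolding jy by auto
      qed
    qed
    ultimately have "card ?N \<le> card (G `` T)" using fin_G by (rule card_inj_on_le)
    then show ?thesis using neg cP by simp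
  qed
  have exp': "min (4 * C * card A) (real (card ?X) / 2) \<le> card (\<Union>x\<in>A. reach m k x)" if "A \<subseteq> ?X" for A
  proof -
    have "4 * C * card A \<le> (1 + 1 / 5000) ^ k * card A" using C(2) by (rule mult_right_mono) simp
    then show ?thesis using reach_expansion[of A m k] that by (simp add: K_def)
  qed
  obtain U where U: "U \<subseteq> ?V" "card U \<le> 4 * C * s" "d * s / 2 \<le> card (E \<inter> U \<times> U)"
  proof (rule many_arcs_within[of ?V ?X "reach m k" C s P \<phi> d w E])
    show "card P = s * card ?X" using T(2) cP by simp
    show "card {p \<in> ?V \<times> ?X. fst p \<in> U \<and> fst (\<phi> p) \<in> U} \<le> card (E \<inter> U \<times> U) * w" for U
      by (rule card_arc_pairs)
    show "card ?X = d * w" using pos by simp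
    show "card (\<Union>(v, x)\<in>P. {v} \<times> reach m k x) < C * card P" by (rule small) simp
    show "card (\<Union>(v, x)\<in>\<phi> ` P. {v} \<times> reach m k x) < C * card P" by (rule small) simp
    show "min (4 * C * card A) (real (card ?X) / 2) \<le> card (\<Union>x\<in>A. reach m k x)" if "A \<subseteq> ?X" for A
      using that by (rule exp')
  qed (use C(1) s pos(3) finite_reach P phi that in auto)
  have "card (E \<inter> U \<times> U) \<le> (3 * (4 * C) + 1)\<^sup>2 * (\<eta> * (d * s))"
    using EV(1) deg s exp U \<eta> by (intro arcs_within[of ?V]) auto
  with U(3) have "d * s \<le> (2 * (12 * C + 1)\<^sup>2 * \<eta>) * (d * s)" by (simp add: mult_ac)
  moreover have "real (d * s) > 0" using d s by simp
  ultimately show False using \<eta>(2) mult_strict_right_mono[of "2 * (12 * C + 1)\<^sup>2 * \<eta>" 1 "real (d * s)"] by simp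
qed

end

section \<open>The reduction as an expression\<close>

text \<open>A strict upper bound for the variables that occur as terms, used to choose summation
  variables that are not mentioned in the summand.\<close>

fun fresh :: "ex \<Rightarrow> nat" where
  "fresh (Cst k) = 0"
| "fresh (Var y) = Suc y"
| "fresh (Inp e) = fresh e"
| "fresh (Add e e') = max (fresh e) (fresh e')"
| "fresh (Sub e e') = max (fresh e) (fresh e')"
| "fresh (Sum y e e') = max (fresh e) (fresh e')"
| "fresh (Bind y e e') = max (fresh e) (fresh e')"

lemma eval_fresh: "fresh e \<le> y \<Longrightarrow> eval e g (env(y := i)) = eval e g env"
proof (induction e arbitrary: env)
  case (Sum z e e')
  have "eval e' g (env(y := i, z := j)) = eval e' g (env(z := j))" for j
  proof (cases "y = z")
    case False
    then show ?thesis unfolding fun_upd_twist[OF False] by (intro Sum.IH(2)) (use Sum.prems in simp)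
  qed simp
  moreover have "eval e g (env(y := i)) = eval e g env" by (rule Sum.IH(1)) (use Sum.prems in simp)
  ultimately show ?case by (simp only: eval.simps)
next
  case (Bind z e e')
  have "eval e' g (env(y := i, z := j)) = eval e' g (env(z := j))" for j
  proof (cases "y = z")
    case False
    then show ?thesis unfolding fun_upd_twist[OF False] by (intro Bind.IH(2)) (use Bind.prems in simp)
  qed simp
  moreover have "eval e g (env(y := i)) = eval e g env" by (rule Bind.IH(1)) (use Bind.prems in simp)
  ultimately show ?case by (simp only: eval.simps)
qed auto

definition Mul :: "ex \<Rightarrow> ex \<Rightarrow> ex" where
  "Mul e e' = Sum (fresh e') e e'"

text \<open>By truncated subtraction the comparisons evaluate to the numbers 0 and 1, so
  \<open>Mul\<close> serves as conjunction and \<open>Sum\<close> as counting.\<close>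

definition leE :: "ex \<Rightarrow> ex \<Rightarrow> ex" where
  "leE e e' = Sub (Cst 1) (Sub e e')"

definition ltE :: "ex \<Rightarrow> ex \<Rightarrow> ex" where
  "ltE e e' = leE (Add e (Cst 1)) e'"

definition eqE :: "ex \<Rightarrow> ex \<Rightarrow> ex" where
  "eqE e e' = Mul (leE e e') (leE e' e)"

definition orE :: "ex \<Rightarrow> ex \<Rightarrow> ex" where
  "orE e e' = leE (Cst 1) (Add e e')"

definition ifE :: "ex \<Rightarrow> ex \<Rightarrow> ex \<Rightarrow> ex" where
  "ifE c e e' = Add (Mul c e) (Mul (Sub (Cst 1) c) e')"

text \<open>Counts the positive multiples of the divisor that do not exceed the dividend.\<close>

definition Div :: "ex \<Rightarrow> ex \<Rightarrow> ex" where
  "Div e e' = (let y = max (fresh e) (fresh e') in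
     Sum y e (leE (Mul (Add (Var y) (Cst 1)) e') e))"

definition Mod :: "ex \<Rightarrow> ex \<Rightarrow> ex" where
  "Mod e e' = Sub e (Mul (Div e e') e')"

lemma eval_arith [simp]:
  "eval (Mul e e') g env = eval e g env * eval e' g env"
  "eval (leE e e') g env = of_bool (eval e g env \<le> eval e' g env)"
  "eval (ltE e e') g env = of_bool (eval e g env < eval e' g env)"
  "eval (eqE e e') g env = of_bool (eval e g env = eval e' g env)"
  "eval (orE e e') g env = of_bool (eval e g env \<noteq> 0 \<or> eval e' g env \<noteq> 0)"
  by (auto simp: Mul_def leE_def ltE_def eqE_def orE_def eval_fresh)

lemma eval_ifE [simp]:
  "eval c g env \<le> 1 \<Longrightarrow>
    eval (ifE c e e') g env = (if eval c g env = 0 then eval e' g env else eval e g env)"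
  by (cases "eval c g env") (simp_all add: ifE_def)

lemma eval_Div [simp]:
  assumes "eval e' g env > 0"
  shows "eval (Div e e') g env = eval e g env div eval e' g env"
proof -
  let ?a = "eval e g env" and ?b = "eval e' g env"
  have "Suc i * ?b \<le> ?a \<longleftrightarrow> i < ?a div ?b" for i
    using assms by (simp add: less_eq_div_iff_mult_less_eq Suc_le_eq[symmetric])
  then have "{i. i < ?a \<and> Suc i * ?b \<le> ?a} = {i. i < ?a \<and> i < ?a div ?b}" by (simp only:)
  also have "\<dots> = {..<?a div ?b}"
    using div_le_dividend[of ?a ?b] by (auto simp del: div_le_dividend intro: order_less_le_trans)
  finally have "{i. i < ?a \<and> Suc i * ?b \<le> ?a} = {..<?a div ?b}" .
  moreover have "eval (Div e e') g env = (\<Sum>i<?a. of_bool (Suc i * ?b \<le> ?a))"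
    by (simp add: Div_def Let_def eval_fresh del: mult_Suc)
  ultimately show ?thesis unfolding sum_of_bool_card by (metis card_lessThan)
qed

lemma eval_Mod [simp]:
  "eval e' g env > 0 \<Longrightarrow> eval (Mod e e') g env = eval e g env mod eval e' g env"
  by (simp add: Mod_def minus_div_mult_eq_mod)

text \<open>
  Variables: 0 is the length of the input, 1 the position in the output, 2 to 6 are \<open>n, d, m, K, w\<close>,
  7 is the candidate for \<open>\<delta>\<^sub>0 n\<close>, 8 is \<open>n K\<close>, 9 and 22 are the two sizes of the output graph, 23 tells
  whether the candidate is correct, 10 and 11 are row and column of the output matrix.
\<close>

definition edgeE :: "ex \<Rightarrow> ex \<Rightarrow> ex" where
  "edgeE a b = Mul (ltE a (Var 2)) (Mul (ltE b (Var 2))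
     (eqE (Inp (Add (Add (Add (Var 2) (Var 2)) (Cst 2)) (Add (Mul a (Var 2)) b))) (Cst 2)))"

definition rankE :: "nat \<Rightarrow> nat \<Rightarrow> ex" where
  "rankE v b = Sum 20 (Var b) (edgeE (Var v) (Var 20))"

definition nbrE :: "nat \<Rightarrow> nat \<Rightarrow> ex" where
  "nbrE v i = Sum 21 (Var 2) (Mul (Var 21)
     (Mul (edgeE (Var v) (Var 21)) (eqE (rankE v 21) (Var i))))"

definition stepE :: "nat \<Rightarrow> nat \<Rightarrow> ex" where
  "stepE x z = (let q = Div (Var x) (Var 4); r = Mod (Var x) (Var 4); m = Var 4 in
     orE (eqE (Var z) (Var x)) (orE
       (eqE (Var z) (Add (Mul (Mod (Add q r) m) m) r)) (orE
       (eqE (Var z) (Add (Mul q m) (Mod (Add q r) m))) (orE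
       (eqE (Var z) (Add (Mul (Mod (Add q (Cst 1)) m) m) r))
       (eqE (Var z) (Add (Mul q m) (Mod (Add r (Cst 1)) m)))))))"

text \<open>The existential quantifier over the intermediate point becomes a sum tested for being
  positive. The equation for \<open>Suc k\<close> binds variable \<open>30 + k\<close>, so nested
  levels use different variables. As \<open>k\<close> is a constant of the reduction, this is one
  fixed expression.\<close>

fun reachE :: "nat \<Rightarrow> nat \<Rightarrow> nat \<Rightarrow> ex" where
  "reachE 0 x y = eqE (Var y) (Var x)"
| "reachE (Suc k) x y =
     leE (Cst 1) (Sum (30 + k) (Var 5) (Mul (stepE x (30 + k)) (reachE k (30 + k) y)))"

text \<open>Variables 12 and 13 decode the left vertex, 14 and 15 the right one; 16 is the number of
  the arc, 17 its head and 18 the twin position.\<close>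

definition linkE :: "nat \<Rightarrow> ex" where
  "linkE k =
     Bind 12 (Div (Var 10) (Var 5)) (Bind 13 (Mod (Var 10) (Var 5))
     (Bind 14 (Div (Var 11) (Var 5)) (Bind 15 (Mod (Var 11) (Var 5))
     (Bind 16 (Div (Var 13) (Var 6)) (Bind 17 (nbrE 12 16)
     (Bind 18 (Add (Mul (rankE 17 12) (Var 6)) (Mod (Var 13) (Var 6)))
     (orE (Mul (eqE (Var 14) (Var 12)) (reachE k 13 15))
          (Mul (eqE (Var 14) (Var 17)) (reachE k 18 15)))))))))"

text \<open>In a dummy column the inner sum rebinds variable 11 and counts the proper neighbours, as
  in \<open>padded\<close>. If the candidate size is rejected, all entries are 1.\<close>

definition entryE :: "nat \<Rightarrow> nat \<Rightarrow> ex" where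
  "entryE k D = ifE (Var 23)
     (ifE (ltE (Var 11) (Var 8)) (linkE k)
        (ltE (Add (Sub (Var 11) (Var 8)) (Sum 11 (Var 8) (linkE k))) (Cst D)))
     (Cst 1)"

text \<open>The code of a graph on n vertices has length n * n + 2 * n + 2, and n is recovered by
  counting the positive sizes whose codes would fit.\<close>

definition sizeE :: ex where
  "sizeE = Sum 20 (Var 0) (leE (Add (Mul (Add (Var 20) (Cst 1)) (Add (Var 20) (Cst 1)))
     (Add (Mul (Cst 2) (Add (Var 20) (Cst 1))) (Cst 2))) (Var 0))"

definition degreeE :: ex where
  "degreeE = Sum 20 (Var 2) (edgeE (Cst 0) (Var 20))"

text \<open>For positive \<open>q\<close> this is p n / q rounded down and capped at n.\<close>

definition candE :: "nat \<Rightarrow> nat \<Rightarrow> ex" where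
  "candE p q = Sum 20 (Var 2) (leE (Mul (Cst q) (Add (Var 20) (Cst 1))) (Mul (Cst p) (Var 2)))"

text \<open>The equation rejects rounded candidates. Candidates below 2 are rejected because
  \<open>soundness\<close> has to halve the size.\<close>

definition okE :: "nat \<Rightarrow> nat \<Rightarrow> ex" where
  "okE p q = Mul (eqE (Mul (Cst q) (Var 7)) (Mul (Cst p) (Var 2))) (leE (Cst 2) (Var 7))"

definition ctxE :: "nat \<Rightarrow> nat \<Rightarrow> nat \<Rightarrow> nat \<Rightarrow> ex \<Rightarrow> ex" where
  "ctxE p q t D e =
     Bind 2 sizeE (Bind 3 degreeE (Bind 4 (Mul (Var 3) (Cst t)) (Bind 5 (Mul (Var 4) (Var 4))
     (Bind 6 (Mul (Var 4) (Cst t)) (Bind 7 (candE p q) (Bind 8 (Mul (Var 2) (Var 5))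
     (Bind 23 (okE p q) (Bind 9 (ifE (Var 23) (Var 8) (Cst 1))
     (Bind 22 (ifE (Var 23) (Add (Var 8) (Cst D)) (Cst D)) e)))))))))"

definition lengthE :: "nat \<Rightarrow> nat \<Rightarrow> nat \<Rightarrow> nat \<Rightarrow> ex" where
  "lengthE p q t D = ctxE p q t D
     (Add (Var 9) (Add (Var 22) (Add (Cst 2) (Mul (Var 9) (Var 22)))))"

definition bitE :: "nat \<Rightarrow> nat \<Rightarrow> nat \<Rightarrow> nat \<Rightarrow> nat \<Rightarrow> ex" where
  "bitE p q t k D = ctxE p q t D
     (ifE (ltE (Var 1) (Var 9)) (Cst 1) (ifE (eqE (Var 1) (Var 9)) (Cst 0)
     (ifE (leE (Var 1) (Add (Var 9) (Var 22))) (Cst 1)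
     (ifE (eqE (Var 1) (Add (Add (Var 9) (Var 22)) (Cst 1))) (Cst 0)
     (Bind 24 (Sub (Var 1) (Add (Add (Var 9) (Var 22)) (Cst 2)))
     (Bind 10 (Div (Var 24) (Var 22)) (Bind 11 (Mod (Var 24) (Var 22)) (entryE k D))))))))"

definition transform :: "nat \<Rightarrow> nat \<Rightarrow> nat \<Rightarrow> nat \<Rightarrow> nat \<Rightarrow> bool list \<Rightarrow> bool list" where
  "transform p q t k D xs =
     map (\<lambda>i. eval (bitE p q t k D) (cells xs) ((\<lambda>_. 0)(0 := length xs, 1 := i)) \<noteq> 0)
       [0..<eval (lengthE p q t D) (cells xs) ((\<lambda>_. 0)(0 := length xs))]"

lemma polytime_transform: "polytime (transform p q t k D)"
  by (rule polytimeI[of _ "lengthE p q t D" "bitE p q t k D"]) (simp_all add: transform_def)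

section \<open>Positions in the code of a graph\<close>

lemma length_matrix: "length (concat (map (\<lambda>i. map (h i) [0..<M]) [0..<N])) = N * M"
  by (induction N) auto

lemma nth_matrix:
  "x < N * M \<Longrightarrow> concat (map (\<lambda>i. map (h i) [0..<M]) [0..<N]) ! x = h (x div M) (x mod M)"
proof (induction N)
  case (Suc N)
  show ?case
  proof (cases "x < N * M")
    case True
    then show ?thesis using Suc.IH by (simp add: nth_append length_matrix)
  next
    case False
    then obtain y where y: "x = N * M + y" by (metis le_add_diff_inverse linorder_not_less)
    with Suc.prems have "y < M" by simp
    then have "x div M = N" "x mod M = y" using y by auto
    then show ?thesis using y \<open>y < M\<close> by (simp add: nth_append length_matrix)
  qed
qed simp

lemma length_graph_code: "length (graph_code N M E) = N + (M + (2 + N * M))"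
  by (simp add: graph_code_def length_matrix)

lemma nth_graph_code:
  assumes "x < length (graph_code N M E)"
  shows "graph_code N M E ! x \<longleftrightarrow> (if x < N then True else if x = N then False
    else if x \<le> N + M then True else if x = N + M + 1 then False
    else ((x - (N + M + 2)) div M, (x - (N + M + 2)) mod M) \<in> E)"
proof -
  have "x < N \<or> x = N \<or> (N < x \<and> x \<le> N + M) \<or> x = N + M + 1 \<or>
    x = N + M + 2 + (x - (N + M + 2)) \<and> x - (N + M + 2) < N * M"
    using assms unfolding length_graph_code by linarith
  then consider "x < N" | "x = N" | "N < x" "x \<le> N + M" | "x = N + M + 1"
    | y where "x = N + M + 2 + y" "y < N * M"
    by blast
  then show ?thesis
    by cases (auto simp: graph_code_def nth_append nth_Cons length_matrix nth_matrix split: nat.split)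
qed

section \<open>Correctness of the expressions on codes of regular graphs\<close>

context regular_instance
begin

abbreviation "xs \<equiv> graph_code n n E"

lemma cells_edge: "a < n \<Longrightarrow> b < n \<Longrightarrow> cells xs (n + n + 2 + (a * n + b)) = 2 \<longleftrightarrow> (a, b) \<in> E"
proof -
  assume ab: "a < n" "b < n"
  then have "a * n + b < n * n" by (rule code_less)
  with ab show ?thesis by (simp add: cells_def length_graph_code nth_graph_code)
qed

lemma eval_edgeE [simp]:
  assumes "env 2 = n"
  shows "eval (edgeE a b) (cells xs) env = of_bool ((eval a (cells xs) env, eval b (cells xs) env) \<in> E)"
  using cells_edge EV(3) assms by (auto simp: edgeE_def)

lemma eval_rankE [simp]:
  assumes "env 2 = n" "v \<noteq> 20"
  shows "eval (rankE v b) (cells xs) env = rank E (env v) (env b)"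
  using assms by (simp add: rankE_def rank_def)

lemma eval_nbrE [simp]:
  assumes "env 2 = n" "v < 20" "i < 20"
  shows "eval (nbrE v i) (cells xs) env = nbr E n (env v) (env i)"
  using assms
  by (simp add: nbrE_def nbr_def of_bool_conj del: sum_mult_of_bool_eq sum_of_bool_mult_eq)

lemma eval_stepE [simp]:
  assumes "env 4 = m"
  shows "eval (stepE x z) (cells xs) env = of_bool (env z \<in> step m (env x))"
  unfolding stepE_def step_def Let_def
  by (simp only: eval.simps eval_arith eval_Div eval_Mod assms pos(1) of_bool_eq_0_iff
      insert_iff empty_iff simp_thms)

text \<open>The conditions on \<open>x\<close> and \<open>y\<close> keep both apart from the
  variables 30 to \<open>30 + k - 1\<close> that are bound inside.\<close>

lemma eval_reachE:
  assumes "env 4 = m" "env 5 = K" "env x < K" "x < 30 \<or> 30 + k \<le> x" "y < 30"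
  shows "eval (reachE k x y) (cells xs) env = of_bool (env y \<in> reach m k (env x))"
  using assms
proof (induction k arbitrary: x env)
  case (Suc k)
  have "eval (reachE k (30 + k) y) (cells xs) (env(30 + k := z)) = of_bool (env y \<in> reach m k z)"
    if "z < K" for z
    using that Suc.prems by (subst Suc.IH) auto
  moreover have "step m (env x) \<subseteq> {..<K}" using Suc.prems step_bounded by (simp add: K_def)
  ultimately show ?case using Suc.prems
    by (auto simp: Suc_le_eq)
qed simp

lemma eval_linkE [simp]:
  assumes "env 2 = n" "env 4 = m" "env 5 = K" "env 6 = w" "env 10 < n * K"
  shows "eval (linkE k) (cells xs) env = of_bool (link E n w m k (env 10) (env 11))"
proof -
  have u: "env 10 div K < n" "env 10 mod K < K" using decode(1)[OF assms(5)] decode(2) by auto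
  note tw = tw_less[OF u, unfolded twin_def head_def]
  show ?thesis
    unfolding linkE_def link_K twin_def head_def
    using assms pos(1-3) u(2) tw
    by (simp add: eval_reachE)
qed

lemma eval_entryE:
  assumes "env 2 = n" "env 4 = m" "env 5 = K" "env 6 = w" "env 8 = n * K" "env 23 = 1" "env 10 < n * K"
  shows "eval (entryE k D) (cells xs) env =
    of_bool (padded (n * K) D (link E n w m k) (env 10) (env 11))"
proof -
  have "eval (linkE k) (cells xs) (env(11 := i)) = of_bool (link E n w m k (env 10) i)" for i
    using assms by (subst eval_linkE) auto
  then show ?thesis
    unfolding entryE_def padded_def using assms by simp
qed

definition cand :: "nat \<Rightarrow> nat \<Rightarrow> nat" where
  "cand p q = (\<Sum>i<n. of_bool (q * (i + 1) \<le> p * n))"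

definition ok :: "nat \<Rightarrow> nat \<Rightarrow> bool" where
  "ok p q \<longleftrightarrow> q * cand p q = p * n \<and> 2 \<le> cand p q"

definition ctx :: "nat \<Rightarrow> nat \<Rightarrow> (nat \<Rightarrow> nat) \<Rightarrow> nat \<Rightarrow> nat" where
  "ctx p q env = env(2 := n, 3 := d, 4 := m, 5 := K, 6 := w, 7 := cand p q, 8 := n * K,
     23 := of_bool (ok p q), 9 := (if ok p q then n * K else 1),
     22 := (if ok p q then n * K + D else D))"

lemma cand_eq: "q > 0 \<Longrightarrow> q * s = p * n \<Longrightarrow> s \<le> n \<Longrightarrow> cand p q = s"
proof -
  assume *: "q > 0" "q * s = p * n" "s \<le> n"
  then have "q * (i + 1) \<le> p * n \<longleftrightarrow> i < s" for i
    unfolding *(2)[symmetric] by (simp only: nat_mult_le_cancel_disj) auto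
  then have "cand p q = card {i. i < n \<and> i < s}" unfolding cand_def sum_of_bool_card by simp
  also have "{i. i < n \<and> i < s} = {..<s}" using * by auto
  finally show ?thesis by simp
qed

text \<open>The code length is strictly increasing in the number of vertices, so exactly the
  positive sizes up to \<open>n\<close> are counted.\<close>

lemma size_formula:
  "(\<Sum>i<n + (n + (2 + n * n)).
     of_bool ((i + 1) * (i + 1) + (2 * (i + 1) + 2) \<le> n + (n + (2 + n * n)))) = n"
proof -
  let ?l = "n + (n + (2 + n * n))"
  have "(i + 1) * (i + 1) + (2 * (i + 1) + 2) \<le> ?l \<longleftrightarrow> i < n" for i
  proof
    assume "i < n"
    then have "i + 1 \<le> n" by simp
    then have le: "i + 1 \<le> n" "2 * (i + 1) + 2 \<le> n + (n + 2)" by simp_all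
    have "(i + 1) * (i + 1) + (2 * (i + 1) + 2) \<le> n * n + (n + (n + 2))"
      by (rule add_mono[OF mult_le_mono[OF le(1) le(1)] le(2)])
    then show "(i + 1) * (i + 1) + (2 * (i + 1) + 2) \<le> ?l" by (simp only: ac_simps)
  next
    assume le: "(i + 1) * (i + 1) + (2 * (i + 1) + 2) \<le> ?l"
    show "i < n"
    proof (rule ccontr)
      assume "\<not> i < n"
      then have lt: "n \<le> i + 1" "n + (n + 2) < 2 * (i + 1) + 2" by simp_all
      have "n * n + (n + (n + 2)) < (i + 1) * (i + 1) + (2 * (i + 1) + 2)"
        by (rule add_le_less_mono[OF mult_le_mono[OF lt(1) lt(1)] lt(2)])
      moreover have "(i + 1) * (i + 1) + (2 * (i + 1) + 2) \<le> n * n + (n + (n + 2))"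
        using le by (simp only: ac_simps)
      ultimately show False by simp
    qed
  qed
  then have "(\<Sum>i<?l. of_bool ((i + 1) * (i + 1) + (2 * (i + 1) + 2) \<le> ?l)) = card {i. i < ?l \<and> i < n}"
    unfolding sum_of_bool_card by simp
  also have "{i. i < ?l \<and> i < n} = {..<n}" by auto
  finally show ?thesis by simp
qed

lemma degree_formula: "n > 0 \<Longrightarrow> (\<Sum>b<n. of_bool ((0, b) \<in> E)) = d"
proof -
  assume "n > 0"
  have "{b. b < n \<and> (0, b) \<in> E} = E `` {0}" using EV(3) by auto
  then show ?thesis unfolding sum_of_bool_card using deg[OF \<open>n > 0\<close>] by simp
qed

lemma eval_ctxE:
  assumes "n > 0" "env 0 = length xs"
  shows "eval (ctxE p q t D e) (cells xs) env = eval e (cells xs) (ctx p q env)"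
proof -
  have 2: "eval sizeE (cells xs) env = n"
    using size_formula assms(2) unfolding length_graph_code by (simp add: sizeE_def)
  have 3: "eval degreeE (cells xs) e = d" if "e 2 = n" for e
    using degree_formula[OF assms(1)] that by (simp add: degreeE_def)
  have 7: "eval (candE p q) (cells xs) e = cand p q" if "e 2 = n" for e
    using that by (simp add: cand_def candE_def)
  have 23: "eval (okE p q) (cells xs) e = of_bool (ok p q)" if "e 2 = n" "e 7 = cand p q" for e
    using that by (simp add: okE_def ok_def)
  show ?thesis
    unfolding ctxE_def ctx_def eval.simps(7) 2
    by (cases "ok p q") (simp_all add: 3 7 23 flip: m_def w_def K_def)
qed

definition out_left where "out_left p q = (if ok p q then n * K else 1)"
definition out_right where "out_right p q = (if ok p q then n * K + D else D)"
definition out_graph where "out_graph p q = (if ok p q then G else {0} \<times> {..<D})"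

lemma transform_eq:
  assumes n: "n > 0"
  shows "transform p q t k D xs = graph_code (out_left p q) (out_right p q) (out_graph p q)"
proof (rule nth_equalityI)
  let ?N = "out_left p q" and ?M = "out_right p q"
  let ?env = "\<lambda>i. ctx p q ((\<lambda>_. 0)(0 := length xs, 1 := i))"
  have env: "?env i 1 = i" "?env i 9 = ?N" "?env i 22 = ?M" for i
    by (simp_all add: ctx_def out_left_def out_right_def)
  have len: "eval (lengthE p q t D) (cells xs) ((\<lambda>_. 0)(0 := length xs)) = ?N + (?M + (2 + ?N * ?M))"
    unfolding lengthE_def using n
    by (subst eval_ctxE) (simp_all add: ctx_def out_left_def out_right_def)
  then show l: "length (transform p q t k D xs) = length (graph_code ?N ?M (out_graph p q))"
    by (simp add: transform_def length_graph_code)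
  fix i assume i: "i < length (transform p q t k D xs)"
  have "?M > 0" by (simp add: out_right_def D_def)
  let ?x = "i - (?N + ?M + 2)"
  let ?env' = "(?env i)(24 := ?x, 10 := ?x div ?M, 11 := ?x mod ?M)"
  have entry: "eval (entryE k D) (cells xs) ?env' = of_bool ((?x div ?M, ?x mod ?M) \<in> out_graph p q)"
    if x: "?x < ?N * ?M"
  proof (cases "ok p q")
    case True
    have u: "?x div ?M < ?N" using x by (simp add: less_mult_imp_div_less)
    have "eval (entryE k D) (cells xs) ?env' = of_bool (padded (n * K) D (link E n w m k) (?env' 10) (?env' 11))"
      by (rule eval_entryE) (use True u in \<open>simp_all add: ctx_def out_left_def\<close>)
    moreover have "?x mod ?M < ?M" using \<open>?M > 0\<close> by simp
    ultimately show ?thesis using u True by (simp add: out_graph_def G_def out_left_def out_right_def)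
  next
    case False
    have "?x div ?M < ?N" using x by (simp add: less_mult_imp_div_less)
    moreover have "?x mod ?M < ?M" using \<open>?M > 0\<close> by simp
    moreover have "eval (entryE k D) (cells xs) ?env' = 1"
      using False by (simp add: entryE_def ctx_def)
    ultimately show ?thesis using False by (simp add: out_graph_def out_left_def out_right_def)
  qed
  have "transform p q t k D xs ! i \<longleftrightarrow>
      eval (bitE p q t k D) (cells xs) ((\<lambda>_. 0)(0 := length xs, 1 := i)) \<noteq> 0"
    using i by (simp add: transform_def)
  also have "\<dots> \<longleftrightarrow> (if i < ?N then True else if i = ?N then False
      else if i \<le> ?N + ?M then True else if i = ?N + ?M + 1 then False
      else eval (entryE k D) (cells xs) ?env' \<noteq> 0)"
    unfolding bitE_def using n \<open>?M > 0\<close>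
    by (subst eval_ctxE) (simp_all add: env del: One_nat_def)
  also have "\<dots> \<longleftrightarrow> graph_code ?N ?M (out_graph p q) ! i"
  proof -
    have "i < ?N + (?M + (2 + ?N * ?M))" using i l by (simp add: length_graph_code)
    then have "?x < ?N * ?M" if "?N + ?M + 1 < i" using that by linarith
    then show ?thesis using i l entry by (subst nth_graph_code) auto
  qed
  finally show "transform p q t k D xs ! i = graph_code ?N ?M (out_graph p q) ! i" .
qed

end

section \<open>Hardness\<close>

lemma edge_expansion_small:
  assumes "2 * card S \<le> n" "S \<subseteq> {..<n}"
  shows "edge_expansion n d E S = card (E \<inter> S \<times> ({..<n} - S)) / (d * card S)"
proof -
  have "card ({..<n} - S) = n - card S" using assms(2) by (simp add: card_Diff_subset finite_subset)
  then show ?thesis using assms(1) by (simp add: edge_expansion_def min_def)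
qed

lemma edge_expansion_compl:
  assumes "S \<subseteq> {..<n}" "sym E"
  shows "edge_expansion n d E ({..<n} - S) = edge_expansion n d E S"
proof -
  have "E \<inter> ({..<n} - S) \<times> S = prod.swap ` (E \<inter> S \<times> ({..<n} - S))"
    using assms(2) by (auto dest: symD intro!: image_eqI[of _ _ "(_, _)"])
  then have "card (E \<inter> ({..<n} - S) \<times> S) = card (E \<inter> S \<times> ({..<n} - S))"
    by (simp add: card_image)
  moreover have "{..<n} - ({..<n} - S) = S" using assms(1) by auto
  ultimately show ?thesis by (simp add: edge_expansion_def min.commute)
qed

text \<open>Complementation of vertex sets preserves the edge expansion. This allows a density above
  1/2 to be replaced by one below 1/2.\<close>

lemma SSE_problem_compl: "SSE_problem \<eta> (1 - \<delta>\<^sub>0) = SSE_problem \<eta> \<delta>\<^sub>0"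
proof -
  have card: "real (card ({..<n} - S)) = (1 - \<delta>) * n" if "S \<subseteq> {..<n}" "real (card S) = \<delta> * n"
    for S and n :: nat and \<delta> :: real
  proof -
    have "card ({..<n} - S) = n - card S" "card S \<le> n"
      using that(1) card_mono[of "{..<n}" S] by (simp_all add: card_Diff_subset finite_subset)
    then show ?thesis using that(2) by (simp add: of_nat_diff algebra_simps)
  qed
  have ex: "\<exists>S\<subseteq>{..<n}. real (card S) = (1 - \<delta>) * n \<and> P (edge_expansion n d E S)"
    if "sym E" "\<exists>S\<subseteq>{..<n}. real (card S) = \<delta> * n \<and> P (edge_expansion n d E S)"
    for n d :: nat and E P and \<delta> :: real
  proof -
    from that(2) obtain S where S: "S \<subseteq> {..<n}" "real (card S) = \<delta> * n" "P (edge_expansion n d E S)"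
      by blast
    then show ?thesis
      using card[OF S(1,2)] edge_expansion_compl[OF S(1) that(1)] by (intro exI[of _ "{..<n} - S"]) auto
  qed
  have iff: "(\<exists>S\<subseteq>{..<n}. real (card S) = (1 - \<delta>\<^sub>0) * n \<and> P (edge_expansion n d E S)) \<longleftrightarrow>
      (\<exists>S\<subseteq>{..<n}. real (card S) = \<delta>\<^sub>0 * n \<and> P (edge_expansion n d E S))"
    if "regular_graph n d E" for n d :: nat and E P
    using ex[of E n "1 - \<delta>\<^sub>0" P d] ex[of E n \<delta>\<^sub>0 P d] that by (auto simp: regular_graph_def)
  have all: "(\<forall>S\<subseteq>{..<n}. real (card S) = (1 - \<delta>\<^sub>0) * n \<longrightarrow> 1 - \<eta> \<le> edge_expansion n d E S) \<longleftrightarrow>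
      (\<forall>S\<subseteq>{..<n}. real (card S) = \<delta>\<^sub>0 * n \<longrightarrow> 1 - \<eta> \<le> edge_expansion n d E S)"
    if "regular_graph n d E" for n d :: nat and E
    using iff[OF that, of "\<lambda>x. \<not> 1 - \<eta> \<le> x"] by blast
  show ?thesis
    unfolding SSE_problem_def using iff[of _ _ _ "\<lambda>x. x \<le> \<eta>"] all by (simp cong: conj_cong)
qed

text \<open>The program cannot compute with a real density, so the condition on the size is replaced
  by an integer equation. A rational density supplies numerator and denominator; for an irrational
  one no size is right, and \<open>q = 1\<close>, \<open>p = 0\<close> reject every \<open>s\<close>
  from 2 on.\<close>

lemma ratio_test:
  fixes \<delta> :: real
  assumes "0 < \<delta>"
  obtains p q :: nat where "q > 0"
    "\<And>n s. n > 0 \<Longrightarrow> 2 \<le> s \<Longrightarrow> q * s = p * n \<longleftrightarrow> real s = \<delta> * n"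
proof (cases "\<delta> \<in> \<rat>")
  case True
  then obtain p q :: nat where "q \<noteq> 0" "\<bar>\<delta>\<bar> = real p / real q" by (rule Rats_abs_nat_div_natE)
  then have *: "\<delta> = real p / real q" "q > 0" using assms by auto
  have "q * s = p * n \<longleftrightarrow> real s = \<delta> * n" for n s
  proof -
    have "q * s = p * n \<longleftrightarrow> real (q * s) = real (p * n)" by (simp only: of_nat_eq_iff)
    also have "\<dots> \<longleftrightarrow> real q * real s = real q * (\<delta> * n)" using * by simp
    also have "\<dots> \<longleftrightarrow> real s = \<delta> * n" using *(2) by simp
    finally show ?thesis .
  qed
  with *(2) show ?thesis by (rule that)
next
  case False
  have "real s \<noteq> \<delta> * n" if "n > 0" for n s :: nat
  proof
    assume "real s = \<delta> * n"
    then have "\<delta> = real s / real n" using that by (simp add: field_simps)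
    with False show False by simp
  qed
  then show ?thesis by (intro that[of 1 0]) auto
qed

text \<open>All \<open>d\<close> arcs at a single vertex leave it, as there are no loops, so a
  singleton has edge expansion 1. Positive instances therefore pass the test for size at least
  2.\<close>

lemma small_set_size:
  assumes E: "regular_graph n d E" "d > 0" and S: "S \<subseteq> {..<n}" "S \<noteq> {}" "2 * card S \<le> n"
    and exp: "edge_expansion n d E S < 1"
  shows "2 \<le> card S"
proof (rule ccontr)
  assume "\<not> 2 \<le> card S"
  moreover have "card S \<noteq> 0" using S(1,2) by (metis card_0_eq finite_lessThan finite_subset)
  ultimately have "card S = 1" by linarith
  then obtain v where v: "S = {v}" by (rule card_1_singletonE)
  then have "E \<inter> S \<times> ({..<n} - S) = Pair v ` (E `` {v})"
    using E(1) by (auto simp: regular_graph_def irrefl_def)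
  then have "card (E \<inter> S \<times> ({..<n} - S)) = card (E `` {v})" by (simp add: card_image inj_on_def)
  also have "\<dots> = d" using E(1) S(1) v by (auto simp: regular_graph_def)
  finally show False
    using edge_expansion_small[OF S(3,1), of d E] exp E(2) \<open>card S = 1\<close> by simp
qed

text \<open>The constants are chosen before the density: \<open>k\<close> so that the expander beats
  \<open>4 * C\<close>, then \<open>D\<close>, then \<open>t\<close> large enough for the dummies to
  be negligible, and \<open>\<eta>\<close> small enough for both cases. The density of the set is
  preserved, so \<open>\<delta>\<^sub>0\<close> serves also for the bipartite graph.\<close>

lemma reduction:
  fixes \<delta> C :: real
  assumes "0 < \<delta>" "1 < C"
  obtains \<eta> :: real and D :: nat where "0 < \<eta>"
    "\<And>\<delta>\<^sub>0. 0 < \<delta>\<^sub>0 \<Longrightarrow> \<delta>\<^sub>0 \<le> 1 / 2 \<Longrightarrow>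
      poly_reducible (SSE_problem \<eta> \<delta>\<^sub>0) (left_expansion_problem \<delta> C \<delta>\<^sub>0 D)"
proof -
  obtain k where k: "4 * C < (1 + 1 / 5000) ^ k" using real_arch_pow[of "1 + 1 / 5000 :: real" "4 * C"] by auto
  define D :: nat where "D = 2 * 5 ^ k"
  \<comment> \<open>Since \<open>t \<le> K \<le> card T\<close> in the positive case, the
    \<open>D\<close> dummies cost at most \<open>\<delta> / 2 * card T\<close>.\<close>
  obtain t' :: nat where t': "2 * D / \<delta> < t'" using reals_Archimedean2 by blast
  define t where "t = t' + 1"
  \<comment> \<open>The first bound is for completeness, the second for soundness, and 1/2 keeps
    \<open>\<eta>\<close> below 1.\<close>
  define \<eta> where "\<eta> = min (\<delta> / (2 * 5 ^ k)) (min (1 / (4 * (12 * C + 1)\<^sup>2)) (1 / 2))"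
  have C: "12 * C + 1 > 0" using assms(2) by simp
  have \<eta>: "0 < \<eta>" "\<eta> < 1" "5 ^ k * \<eta> \<le> \<delta> / 2" "2 * (12 * C + 1)\<^sup>2 * \<eta> < 1"
  proof -
    show "0 < \<eta>" "\<eta> < 1" using assms C by (auto simp: \<eta>_def)
    have "\<eta> \<le> \<delta> / (2 * 5 ^ k)" by (simp add: \<eta>_def)
    then show "5 ^ k * \<eta> \<le> \<delta> / 2" by (simp add: field_simps)
    have "\<eta> \<le> 1 / (4 * (12 * C + 1)\<^sup>2)" by (simp add: \<eta>_def)
    then have "\<eta> * (4 * (12 * C + 1)\<^sup>2) \<le> 1" using C by (simp add: le_divide_eq zero_less_mult_iff)
    then show "2 * (12 * C + 1)\<^sup>2 * \<eta> < 1" by (simp add: mult_ac)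
  qed
  have "poly_reducible (SSE_problem \<eta> \<delta>\<^sub>0) (left_expansion_problem \<delta> C \<delta>\<^sub>0 D)"
    if \<delta>0: "0 < \<delta>\<^sub>0" "\<delta>\<^sub>0 \<le> 1 / 2" for \<delta>\<^sub>0
  proof -
    obtain p q where q: "q > 0"
      and pq: "\<And>n s. n > 0 \<Longrightarrow> 2 \<le> s \<Longrightarrow> q * s = p * n \<longleftrightarrow> real s = \<delta>\<^sub>0 * n"
      using ratio_test[OF \<delta>0(1)] by metis
    let ?f = "transform p q t k D"
    have half: "2 * s \<le> n" if "real s = \<delta>\<^sub>0 * real n" for s n :: nat
    proof -
      have "real s \<le> 1 / 2 * real n" unfolding that using \<delta>0(2) by (rule mult_right_mono) simp
      then show ?thesis by simp
    qed
    have "?f (graph_code n n E) \<in> fst (left_expansion_problem \<delta> C \<delta>\<^sub>0 D)"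
      if H: "n > 0" "d > 0" "regular_graph n d E"
        and S: "S \<subseteq> {..<n}" "real (card S) = \<delta>\<^sub>0 * n" "edge_expansion n d E S \<le> \<eta>" for n d E S
    proof -
      interpret R: regular_instance n d t k E using H by unfold_locales (simp_all add: t_def)
      have D: "R.D = D" by (simp add: R.D_def D_def)
      note h = half[OF S(2)]
      have "real (card S) > 0" using S(2) H(1) \<delta>0(1) by simp
      then have "S \<noteq> {}" "card S > 0" by auto
      have s2: "2 \<le> card S"
        using small_set_size[OF H(3,2) S(1) \<open>S \<noteq> {}\<close> h] S(3) \<eta>(2) by linarith
      have "q * card S = p * n" using pq[OF H(1) s2] S(2) by simp
      moreover from this have "R.cand p q = card S" using h by (intro R.cand_eq q) simp_all
      ultimately have ok: "R.ok p q" using s2 by (simp add: R.ok_def)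
      then have f: "?f (graph_code n n E) = graph_code (n * R.K) (n * R.K + D) R.G"
        using R.transform_eq[OF H(1), of p q] by (simp add: R.out_left_def R.out_right_def R.out_graph_def D)
      have "card (E \<inter> S \<times> ({..<n} - S)) \<le> \<eta> * (d * card S)"
        using S(3) H(2) \<open>card S > 0\<close> unfolding edge_expansion_small[OF h S(1)]
        by (simp add: divide_le_eq)
      from R.completeness[OF S(1) this] obtain T where T: "T \<subseteq> {..<n * R.K}" "card T = card S * R.K"
        "card (R.G `` T) \<le> (1 + 5 ^ k * \<eta>) * card T + D" by (auto simp: D)
      have "t \<le> R.K" using H(2) by (simp add: R.K_def R.m_def)
      also have "\<dots> \<le> card T" using T(2) \<open>card S > 0\<close> by simp
      finally have "2 * D / \<delta> \<le> card T" using t' by (simp add: t_def)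
      then have "D \<le> \<delta> / 2 * card T" using assms(1) by (simp add: field_simps)
      moreover have "5 ^ k * \<eta> * card T \<le> \<delta> / 2 * card T" using \<eta>(3) by (rule mult_right_mono) simp
      ultimately have "card (R.G `` T) \<le> (1 + \<delta>) * card T" using T(3) by (simp add: algebra_simps)
      moreover have "real (card T) = \<delta>\<^sub>0 * real (n * R.K)" using T(2) S(2) by simp
      moreover have "left_regular (n * R.K) (n * R.K + D) D R.G" using R.G_regular by (simp add: D)
      moreover have "n * R.K > 0" using H(1) R.pos by simp
      ultimately show ?thesis using T(1) unfolding f left_expansion_problem_def fst_conv by blast
    qed
    moreover have "?f (graph_code n n E) \<in> snd (left_expansion_problem \<delta> C \<delta>\<^sub>0 D)"
      if H: "n > 0" "d > 0" "regular_graph n d E"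
        and all: "\<And>S. S \<subseteq> {..<n} \<Longrightarrow> real (card S) = \<delta>\<^sub>0 * n \<Longrightarrow> 1 - \<eta> \<le> edge_expansion n d E S" for n d E
    proof -
      interpret R: regular_instance n d t k E using H by unfold_locales (simp_all add: t_def)
      have D: "R.D = D" by (simp add: R.D_def D_def)
      let ?s = "R.cand p q"
      show ?thesis
      proof (cases "R.ok p q")
        case True
        then have s: "2 \<le> ?s" "real ?s = \<delta>\<^sub>0 * n" using pq[OF H(1)] by (auto simp: R.ok_def)
        note h = half[OF s(2)]
        have exp: "(1 - \<eta>) * (d * ?s) \<le> card (E \<inter> S \<times> ({..<n} - S))" if "S \<subseteq> {..<n}" "card S = ?s" for S
          using all[OF that(1)] that(2) s H(2) h
          by (simp add: edge_expansion_small[OF _ that(1)] le_divide_eq)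
        have "C * card T \<le> card (R.G `` T)" if T: "T \<subseteq> {..<n * R.K}" "real (card T) = \<delta>\<^sub>0 * real (n * R.K)" for T
        proof (rule R.soundness[of _ ?s \<eta>])
          have "real (card T) = real (?s * R.K)" using T(2) s(2) by simp
          then show "card T = ?s * R.K" by (simp only: of_nat_eq_iff)
        qed (use assms k s h exp \<eta> T in auto)
        moreover have "left_regular (n * R.K) (n * R.K + D) D R.G" using R.G_regular by (simp add: D)
        moreover have "n * R.K > 0" using H(1) R.pos by simp
        moreover have "?f (graph_code n n E) = graph_code (n * R.K) (n * R.K + D) R.G"
          using R.transform_eq[OF H(1), of p q] True by (simp add: R.out_left_def R.out_right_def R.out_graph_def D)
        ultimately show ?thesis unfolding left_expansion_problem_def snd_conv by blast
      next
        case False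
        \<comment> \<open>In the fixed graph with one left vertex a set of the required size would
          have \<open>\<delta>\<^sub>0\<close> elements, which is not an integer, so the second case
          holds vacuously.\<close>
        have "real c \<noteq> \<delta>\<^sub>0" for c :: nat using \<delta>0 by (cases c) auto
        then have "\<forall>S\<subseteq>{..<1}. real (card S) = \<delta>\<^sub>0 * real 1 \<longrightarrow>
            C * real (card S) \<le> real (card (({0} \<times> {..<D}) `` S))" by simp
        moreover have "left_regular 1 D D ({0} \<times> {..<D})"
        proof -
          have "({0} \<times> {..<D}) `` {0::nat} = {..<D}" by auto
          then show ?thesis by (auto simp: left_regular_def)
        qed
        moreover have "(0::nat) < 1" by simp
        moreover have "?f (graph_code n n E) = graph_code 1 D ({0} \<times> {..<D})"
          using R.transform_eq[OF H(1), of p q] False by (simp add: R.out_left_def R.out_right_def R.out_graph_def D)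
        ultimately show ?thesis unfolding left_expansion_problem_def snd_conv by blast
      qed
    qed
    ultimately show ?thesis
      unfolding poly_reducible_def SSE_problem_def
      by (intro exI[of _ ?f] conjI polytime_transform) auto
  qed
  with \<eta>(1) show thesis by (rule that)
qed

theorem theorem14:
  "\<exists>\<delta>_max::real. \<delta>_max > 0 \<and>
     (\<forall>\<delta> C :: real. 0 < \<delta> \<and> \<delta> < \<delta>_max \<and> C > 1 \<longrightarrow>
        (\<exists>(\<gamma>::real) (D::nat). 0 < \<gamma> \<and> \<gamma> < 1 \<and> SSE_hard (left_expansion_problem \<delta> C \<gamma> D)))"
proof (rule exI[of _ 1], intro conjI allI impI)
  fix \<delta> C :: real
  assume "0 < \<delta> \<and> \<delta> < 1 \<and> C > 1"
  then obtain \<eta> D where \<eta>: "0 < \<eta>" and red: "\<And>\<delta>\<^sub>0. 0 < \<delta>\<^sub>0 \<Longrightarrow> \<delta>\<^sub>0 \<le> 1 / 2 \<Longrightarrow>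
      poly_reducible (SSE_problem \<eta> \<delta>\<^sub>0) (left_expansion_problem \<delta> C \<delta>\<^sub>0 D)"
    using reduction by metis
  \<comment> \<open>\<open>\<gamma>\<close> is the density that the hypothesis provides for this
    \<open>\<eta>\<close>, or its complement if it exceeds 1/2. If the hypothesis is false, the
    required implication is vacuous and 1/2 is taken.\<close>
  obtain \<gamma> where \<gamma>: "0 < \<gamma>" "\<gamma> \<le> 1 / 2" "SSE_hypothesis \<longrightarrow> NP_hard (SSE_problem \<eta> \<gamma>)"
  proof (cases SSE_hypothesis)
    case True
    then obtain \<delta>\<^sub>0 where "0 < \<delta>\<^sub>0" "\<delta>\<^sub>0 < 1" "NP_hard (SSE_problem \<eta> \<delta>\<^sub>0)"
      using \<eta> by (auto simp: SSE_hypothesis_def)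
    then show ?thesis
      using that[of \<delta>\<^sub>0] that[of "1 - \<delta>\<^sub>0"] by (cases "\<delta>\<^sub>0 \<le> 1 / 2") (simp_all add: SSE_problem_compl)
  next
    case False
    then show ?thesis using that[of "1 / 2"] by simp
  qed
  then have "SSE_hard (left_expansion_problem \<delta> C \<gamma> D)"
    unfolding SSE_hard_def using \<eta> red[OF \<gamma>(1,2)] by (intro exI[of _ \<eta>] exI[of _ \<gamma>]) auto
  with \<gamma> show "\<exists>\<gamma> D. 0 < \<gamma> \<and> \<gamma> < 1 \<and> SSE_hard (left_expansion_problem \<delta> C \<gamma> D)"
    by (intro exI[of _ \<gamma>] exI[of _ D]) auto
qed simp

end
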